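(* Let $1<\beta\le2$. For any $t\in\mathbb R$, the potential $t\chi_{C_1}$ is a real-valued Lipschitz continuous function in $\mathcal F$ satisfying $|e^{S_n(t\chi_{C_1})}|_\infty/\lambda_t^n\to0$ as $n\to\infty$. In particular, $r_t<\lambda_t$ and $\mathcal L_t$ is quasi-compact on $\mathcal F$, i.e. every spectral value $\lambda$ of $\mathcal L_t$ with $|\lambda|>r_t$ is an isolated eigenvalue with finite multiplicity.
   Context: For $1<\beta\le2$, $\tau_\beta(x)=\beta x-[\beta x]$ on $[0,1]$ and $g_n(x)=[\beta\tau_\beta^{n-1}(x)]$ are the greedy digits of $x$. $\{0,1\}^{\mathbb N}$ carries the product topology, the lexicographic order $\preceq$ and the left shift $\sigma$. $\underline0=000\cdots$ and $\underline1=(q_n(1))_{n\ge1}:=\lim_{y\nearrow1}(g_n(y))_{n\ge1}$ (quasi-greedy expansion of $1$). The beta-shift is $X_\beta=\{\underline x\in\{0,1\}^{\mathbb N}:\sigma^n(\underline x)\preceq\underline1\ \forall n\ge0\}$ with the map $\sigma$, and Lipschitz continuity is with respect to the metric $d_\beta(\underline x,\underline y)=\beta^{-\min\{k\ge0:x_{k+1}\ne y_{k+1}\}}$ for $\underline x\ne\underline y$. Function spaces: for $f:X_\beta\to\mathbb C$, $\mathrm{var}(f)$ is the supremum of $\sum_{i=1}^n|f(x_i)-f(x_{i-1})|$ over finite chains $\underline0=x_0\prec x_1\prec\dots\prec x_n=\underline1$ in $X_\beta$; $BV=\{f:\mathrm{var}(f)<\infty\}$ with norm $\|f\|_{BV}=|f|_\infty+\mathrm{var}(f)$,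 $|f|_\infty=\sup|f|$. $\mathcal N$ is the set of $f\in BV$ vanishing off a countable set, $\mathcal B=BV/\mathcal N$ with the quotient norm, and $\mathcal F\subset\mathcal B$ is the closure in $\mathcal B$ of the linear span of indicator functions of intervals in $X_\beta$. $\mathcal F^*$ is the dual Banach space. $C_1=\{(x_i)\in X_\beta:x_1=1\}$, $\chi_{C_1}$ its indicator function; $\mathcal L_tf(x)=\sum_{y:\sigma(y)=x}e^{t\chi_{C_1}(y)}f(y)$, a bounded operator on $\mathcal F$; $\mathcal L_t^*\nu=\nu\circ\mathcal L_t$ on $\mathcal F^*$; $S_nf=\sum_{i=0}^{n-1}f\circ\sigma^i$; $r_t=\limsup_{n\to\infty}|e^{S_n(t\chi_{C_1})}|_\infty^{1/n}$. $\lambda_t>0$ and $\nu_t\in\mathcal F^*$ denote a pair with $\mathcal L_t^*\nu_t=\lambda_t\nu_t$, $\nu_t(f)\ge0$ for $f\ge0$ and $\nu_t(1)=1$ (such a pair exists). Multiplicity means algebraic multiplicity. *)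

theory Defs
  imports "HOL-Analysis.Analysis" "HOL-Library.Fun_Lexorder"
begin

section \<open>The beta-shift\<close>

text \<open>Sequences are indexed from 0: \<open>x n\<close> stands for the mathematical \<open>x\<^sub>n\<^sub>+\<^sub>1\<close>.\<close>

type_synonym symseq = "nat \<Rightarrow> nat"

definition beta_map :: "real \<Rightarrow> real \<Rightarrow> real" where
  "beta_map \<beta> x = \<beta> * x - of_int \<lfloor>\<beta> * x\<rfloor>"

definition greedy_digits :: "real \<Rightarrow> real \<Rightarrow> symseq" where
  "greedy_digits \<beta> x = (\<lambda>n. nat \<lfloor>\<beta> * (beta_map \<beta> ^^ n) x\<rfloor>)"

text \<open>A limit in the product topology is a coordinatewise limit.\<close>

definition seq_one :: "real \<Rightarrow> symseq" where
  "seq_one \<beta> = (\<lambda>n. Lim (at_left 1) (\<lambda>y. greedy_digits \<beta> y n))"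

definition seq_zero :: symseq where
  "seq_zero = (\<lambda>_. 0)"

definition shift :: "symseq \<Rightarrow> symseq" where
  "shift x = (\<lambda>n. x (Suc n))"

definition lex_le :: "symseq \<Rightarrow> symseq \<Rightarrow> bool" where
  "lex_le x y \<longleftrightarrow> x = y \<or> less_fun x y"

definition beta_shift :: "real \<Rightarrow> symseq set" where
  "beta_shift \<beta> = {x. range x \<subseteq> {0, 1} \<and> (\<forall>n. lex_le ((shift ^^ n) x) (seq_one \<beta>))}"

definition beta_dist :: "real \<Rightarrow> symseq \<Rightarrow> symseq \<Rightarrow> real" where
  "beta_dist \<beta> x y = (if x = y then 0 else 1 / \<beta> ^ (LEAST k. x k \<noteq> y k))"

section \<open>Complex normed spaces with explicit carrier\<close>

text \<open>The spaces below depend on the real parameter \<open>\<beta>\<close>, so they cannot be types.\<close>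

record 'v cnspace =
  carr :: "'v set"
  vadd :: "'v \<Rightarrow> 'v \<Rightarrow> 'v"
  vscale :: "complex \<Rightarrow> 'v \<Rightarrow> 'v"
  vzero :: 'v
  vnorm :: "'v \<Rightarrow> real"

definition vminus :: "'v cnspace \<Rightarrow> 'v \<Rightarrow> 'v \<Rightarrow> 'v" where
  "vminus V v w = vadd V v (vscale V (-1) w)"

definition cn_subspace :: "'v cnspace \<Rightarrow> 'v set \<Rightarrow> bool" where
  "cn_subspace V W \<longleftrightarrow> W \<subseteq> carr V \<and> vzero V \<in> W \<and>
     (\<forall>v\<in>W. \<forall>w\<in>W. vadd V v w \<in> W) \<and> (\<forall>z. \<forall>v\<in>W. vscale V z v \<in> W)"

definition cn_span :: "'v cnspace \<Rightarrow> 'v set \<Rightarrow> 'v set" where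
  "cn_span V S = \<Inter> {W. cn_subspace V W \<and> S \<subseteq> W}"

definition cn_closure :: "'v cnspace \<Rightarrow> 'v set \<Rightarrow> 'v set" where
  "cn_closure V S = {v \<in> carr V. \<forall>\<epsilon>>0. \<exists>w\<in>S. vnorm V (vminus V v w) < \<epsilon>}"

definition cn_finite_dim :: "'v cnspace \<Rightarrow> 'v set \<Rightarrow> bool" where
  "cn_finite_dim V W \<longleftrightarrow> (\<exists>S. finite S \<and> S \<subseteq> carr V \<and> W = cn_span V S)"

definition cn_dual :: "'v cnspace \<Rightarrow> ('v \<Rightarrow> complex) set" where
  "cn_dual V = {\<phi>.
     (\<forall>v\<in>carr V. \<forall>w\<in>carr V. \<phi> (vadd V v w) = \<phi> v + \<phi> w) \<and>
     (\<forall>z. \<forall>v\<in>carr V. \<phi> (vscale V z v) = z * \<phi> v) \<and>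
     (\<exists>K. \<forall>v\<in>carr V. cmod (\<phi> v) \<le> K * vnorm V v)}"

definition cn_bounded_op :: "'v cnspace \<Rightarrow> ('v \<Rightarrow> 'v) \<Rightarrow> bool" where
  "cn_bounded_op V T \<longleftrightarrow> (\<forall>v\<in>carr V. T v \<in> carr V) \<and>
     (\<forall>v\<in>carr V. \<forall>w\<in>carr V. T (vadd V v w) = vadd V (T v) (T w)) \<and>
     (\<forall>z. \<forall>v\<in>carr V. T (vscale V z v) = vscale V z (T v)) \<and>
     (\<exists>K. \<forall>v\<in>carr V. vnorm V (T v) \<le> K * vnorm V v)"

definition cn_shifted :: "'v cnspace \<Rightarrow> ('v \<Rightarrow> 'v) \<Rightarrow> complex \<Rightarrow> 'v \<Rightarrow> 'v" where
  "cn_shifted V T z v = vminus V (vscale V z v) (T v)"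

definition cn_spectrum :: "'v cnspace \<Rightarrow> ('v \<Rightarrow> 'v) \<Rightarrow> complex set" where
  "cn_spectrum V T = {z. \<not> (\<exists>R. cn_bounded_op V R \<and>
     (\<forall>v\<in>carr V. R (cn_shifted V T z v) = v \<and> cn_shifted V T z (R v) = v))}"

definition cn_eigenvalue :: "'v cnspace \<Rightarrow> ('v \<Rightarrow> 'v) \<Rightarrow> complex \<Rightarrow> bool" where
  "cn_eigenvalue V T z \<longleftrightarrow> (\<exists>v\<in>carr V. v \<noteq> vzero V \<and> T v = vscale V z v)"

text \<open>The algebraic multiplicity of \<open>z\<close> is the dimension of this space.\<close>

definition cn_gen_eigenspace :: "'v cnspace \<Rightarrow> ('v \<Rightarrow> 'v) \<Rightarrow> complex \<Rightarrow> 'v set" where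
  "cn_gen_eigenspace V T z = {v \<in> carr V. \<exists>k. (cn_shifted V T z ^^ k) v = vzero V}"

definition cn_quasi_compact :: "'v cnspace \<Rightarrow> ('v \<Rightarrow> 'v) \<Rightarrow> ereal \<Rightarrow> bool" where
  "cn_quasi_compact V T r \<longleftrightarrow> (\<forall>z\<in>cn_spectrum V T. r < ereal (cmod z) \<longrightarrow>
     z isolated_in cn_spectrum V T \<and> cn_eigenvalue V T z \<and>
     cn_finite_dim V (cn_gen_eigenspace V T z))"

section \<open>Functions of bounded variation\<close>

text \<open>
  A function on the beta-shift is represented by any function on all sequences that extends it:
  only values on the beta-shift enter the definitions, and the subspace \<open>null_funs\<close>
  that is divided out contains every function vanishing on the beta-shift.
\<close>

type_synonym symfun = "symseq \<Rightarrow> complex"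

definition sup_norm :: "real \<Rightarrow> symfun \<Rightarrow> real" where
  "sup_norm \<beta> f = (SUP x\<in>beta_shift \<beta>. cmod (f x))"

definition variation_sums :: "real \<Rightarrow> symfun \<Rightarrow> real set" where
  "variation_sums \<beta> f = {\<Sum>i<n. cmod (f (c (Suc i)) - f (c i)) | n c.
     (\<forall>i\<le>n. c i \<in> beta_shift \<beta>) \<and> c 0 = seq_zero \<and> c n = seq_one \<beta> \<and>
     (\<forall>i<n. less_fun (c i) (c (Suc i)))}"

definition variation :: "real \<Rightarrow> symfun \<Rightarrow> real" where
  "variation \<beta> f = Sup (variation_sums \<beta> f)"

definition BV_funs :: "real \<Rightarrow> symfun set" where
  "BV_funs \<beta> = {f. bdd_above (variation_sums \<beta> f)}"

definition BV_norm :: "real \<Rightarrow> symfun \<Rightarrow> real" where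
  "BV_norm \<beta> f = sup_norm \<beta> f + variation \<beta> f"

definition null_funs :: "real \<Rightarrow> symfun set" where
  "null_funs \<beta> = {f \<in> BV_funs \<beta>. countable {x \<in> beta_shift \<beta>. f x \<noteq> 0}}"

definition coset :: "real \<Rightarrow> symfun \<Rightarrow> symfun set" where
  "coset \<beta> f = {g. (\<lambda>x. g x - f x) \<in> null_funs \<beta>}"

definition BV_quot :: "real \<Rightarrow> symfun set cnspace" where
  "BV_quot \<beta> = \<lparr>
     carr = coset \<beta> ` BV_funs \<beta>,
     vadd = (\<lambda>c d. \<Union>f\<in>c. \<Union>g\<in>d. coset \<beta> (\<lambda>x. f x + g x)),
     vscale = (\<lambda>z c. \<Union>f\<in>c. coset \<beta> (\<lambda>x. z * f x)),
     vzero = null_funs \<beta>,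
     vnorm = (\<lambda>c. INF f\<in>c. BV_norm \<beta> f)\<rparr>"

definition shift_intervals :: "real \<Rightarrow> symseq set set" where
  "shift_intervals \<beta> = {I. I \<subseteq> beta_shift \<beta> \<and>
     (\<forall>x\<in>I. \<forall>y\<in>I. \<forall>z\<in>beta_shift \<beta>. lex_le x z \<and> lex_le z y \<longrightarrow> z \<in> I)}"

definition F_space :: "real \<Rightarrow> symfun set cnspace" where
  "F_space \<beta> = (BV_quot \<beta>)\<lparr>carr :=
     cn_closure (BV_quot \<beta>)
       (cn_span (BV_quot \<beta>) ((\<lambda>I. coset \<beta> (indicator I)) ` shift_intervals \<beta>))\<rparr>"

section \<open>Potential and transfer operator\<close>

definition cyl_one :: "real \<Rightarrow> symseq set" where
  "cyl_one \<beta> = {x \<in> beta_shift \<beta>. x 0 = 1}"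

definition potential :: "real \<Rightarrow> real \<Rightarrow> symfun" where
  "potential \<beta> t x = complex_of_real t * indicator (cyl_one \<beta>) x"

definition birkhoff_sum :: "nat \<Rightarrow> symfun \<Rightarrow> symfun" where
  "birkhoff_sum n f x = (\<Sum>i<n. f ((shift ^^ i) x))"

definition weight_norm :: "real \<Rightarrow> real \<Rightarrow> nat \<Rightarrow> real" where
  "weight_norm \<beta> t n = sup_norm \<beta> (\<lambda>x. exp (birkhoff_sum n (potential \<beta> t) x))"

definition r_bound :: "real \<Rightarrow> real \<Rightarrow> ereal" where
  "r_bound \<beta> t = limsup (\<lambda>n. ereal (root n (weight_norm \<beta> t n)))"

definition transfer_fun :: "real \<Rightarrow> real \<Rightarrow> symfun \<Rightarrow> symfun" where
  "transfer_fun \<beta> t f x =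
     (\<Sum>y \<in> {y \<in> beta_shift \<beta>. shift y = x}. exp (potential \<beta> t y) * f y)"

definition transfer_op :: "real \<Rightarrow> real \<Rightarrow> symfun set \<Rightarrow> symfun set" where
  "transfer_op \<beta> t c = (\<Union>f\<in>c. coset \<beta> (transfer_fun \<beta> t f))"

text \<open>
  An element of the quotient is \<open>\<ge> 0\<close> if it has a representative that is \<open>\<ge> 0\<close>;
  \<open>transfer_op\<close> acts on functionals by composition.
\<close>

definition eigenpair :: "real \<Rightarrow> real \<Rightarrow> real \<Rightarrow> (symfun set \<Rightarrow> complex) \<Rightarrow> bool" where
  "eigenpair \<beta> t l \<nu> \<longleftrightarrow> l > 0 \<and> \<nu> \<in> cn_dual (F_space \<beta>) \<and>
     (\<forall>c\<in>carr (F_space \<beta>). \<nu> (transfer_op \<beta> t c) = of_real l * \<nu> c) \<and>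
     (\<forall>c\<in>carr (F_space \<beta>). (\<exists>f\<in>c. \<forall>x\<in>beta_shift \<beta>. f x \<in> \<real>\<^sub>\<ge>\<^sub>0) \<longrightarrow> \<nu> c \<in> \<real>\<^sub>\<ge>\<^sub>0) \<and>
     \<nu> (coset \<beta> (\<lambda>_. 1)) = 1"

end

theory Submission
  imports Defs "HOL-Complex_Analysis.Complex_Analysis"
begin

text \<open>
  For \<open>p\<close> in the beta-shift let \<open>H\<^sub>p\<close> be the indicator of the initial segment \<open>{x. x \<preceq> p}\<close>. The key
  observation is the identity \<open>\<L>\<^sub>t H\<^sub>p = exp (t p\<^sub>1) H\<^bsub>\<sigma> p\<^esub> + p\<^sub>1 1\<close>. Modulo functions with countable
  support, the \<open>H\<^sub>p\<close> with \<open>p\<close> in the set \<open>P\<close> of sequences having infinitely many ones suffice, and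
  between two such points there are uncountably many others; therefore \<open>(a\<^sub>p) \<mapsto> \<Sum> a\<^sub>p H\<^sub>p\<close> is an
  isomorphism of \<open>\<ell>\<^sup>1(P)\<close> onto \<open>\<F>\<close>. In these coordinates \<open>\<L>\<^sub>t\<close> is a weighted shift \<open>T\<close>, whose powers
  have norm at most \<open>|exp (S\<^sub>n (t \<chi>))|\<^sub>\<infinity>\<close>, plus the rank-one operator \<open>a \<mapsto> \<ell>(a) e\<close>, where \<open>e\<close> is the
  coordinate vector of the constant 1. Hence for \<open>|z| > r\<^sub>t\<close> the spectrum consists of the zeros of
  \<open>1 - \<ell>((z - T)\<^sup>-\<^sup>1 e)\<close>, a nonconstant power series in \<open>1/z\<close>, and the generalized eigenspace of a zero is
  spanned by finitely many of the vectors \<open>(z - T)\<^sup>-\<^sup>k e\<close>.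

  For an eigenpair, \<open>\<phi>(p) = \<nu>(H\<^sub>p)\<close> takes values in \<open>[0, 1]\<close> and satisfies
  \<open>\<lambda> \<phi>(p) = exp (t p\<^sub>1) \<phi>(\<sigma> p) + p\<^sub>1\<close>. Iterating this bounds \<open>\<Sum> p\<^sub>k\<^sub>+\<^sub>1 exp (S\<^sub>k(p)) / \<lambda>\<^sup>k\<close> by \<open>\<lambda>\<close>, which
  forces \<open>\<lambda> > 1\<close> and the uniform decay of \<open>exp (S\<^sub>n) / \<lambda>\<^sup>n\<close>.
\<close>

section \<open>Complex Banach spaces and absolutely summable families\<close>

text \<open>The space is a closure inside a quotient, so its elements have neither point values nor
  an accessible norm; coordinates turn it into a concrete sequence space on which every bound and
  every operator identity is checked on basis vectors. \<open>P\<close> suffices because a point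
  \<open>w1000...\<close> of the beta-shift has the immediate predecessor \<open>w0\<omega>\<close>:
  their initial segments differ at one point and define the same class, while
  \<open>{seq_zero}\<close> defines the class 0. The point \<open>\<omega>\<close> is special. It is
  the maximum, so its segment is the constant 1 and has no variation; its coefficient is visible
  only to the sup norm, all others to the variation. The two parts of the BV norm together therefore
  dominate the \<open>\<ell>\<^sup>1\<close> norm. The limsup defining the spectral bound gives
  estimates \<open>C * s ^ n\<close> only for radii \<open>s\<close> above it. Hence the spectral
  theory is carried out outside the disc of a fixed radius \<open>s\<close>, chosen between the
  bound and \<open>|z|\<close>.\<close>

class complex_banach = banach +
  fixes scaleC :: "complex \<Rightarrow> 'a \<Rightarrow> 'a" (infixr "*\<^sub>C" 75)
  assumes scaleC_add_right: "z *\<^sub>C (a + b) = z *\<^sub>C a + z *\<^sub>C b"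
    and scaleC_add_left: "(y + z) *\<^sub>C a = y *\<^sub>C a + z *\<^sub>C a"
    and scaleC_scaleC [simp]: "y *\<^sub>C z *\<^sub>C a = (y * z) *\<^sub>C a"
    and scaleC_of_real: "complex_of_real r *\<^sub>C a = r *\<^sub>R a"
    and norm_scaleC [simp]: "norm (z *\<^sub>C a) = cmod z * norm a"

lemma scaleC_one [simp]: "1 *\<^sub>C a = (a::'a::complex_banach)"
  using scaleC_of_real[of 1 a] by simp

lemma scaleC_zero_left [simp]: "0 *\<^sub>C a = (0::'a::complex_banach)"
  using scaleC_of_real[of 0 a] by simp

lemma scaleC_zero_right [simp]: "z *\<^sub>C 0 = (0::'a::complex_banach)"
  using scaleC_add_right[of z 0 "0::'a"] by simp

lemma scaleC_minus_right: "z *\<^sub>C (- a) = - (z *\<^sub>C (a::'a::complex_banach))"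
  using scaleC_add_right[of z a "- a"] by (simp add: eq_neg_iff_add_eq_0 add.commute)

lemma scaleC_minus_left: "(- z) *\<^sub>C a = - (z *\<^sub>C (a::'a::complex_banach))"
  using scaleC_add_left[of z "- z" a] by (simp add: eq_neg_iff_add_eq_0 add.commute)

lemma scaleC_diff_right: "z *\<^sub>C (a - b) = z *\<^sub>C a - z *\<^sub>C (b::'a::complex_banach)"
  using scaleC_add_right[of z a "- b"] by (simp add: scaleC_minus_right)

lemma scaleC_diff_left: "(y - z) *\<^sub>C a = y *\<^sub>C a - z *\<^sub>C (a::'a::complex_banach)"
  using scaleC_add_left[of y "- z" a] by (simp add: scaleC_minus_left)

lemma scaleC_sum_right: "z *\<^sub>C (\<Sum>i\<in>I. f i) = (\<Sum>i\<in>I. z *\<^sub>C (f i::'a::complex_banach))"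
  by (induction I rule: infinite_finite_induct) (simp_all add: scaleC_add_right)

lemma bounded_linear_scaleC_right: "bounded_linear (\<lambda>a::'a::complex_banach. z *\<^sub>C a)"
proof (rule bounded_linear_intro)
  show "z *\<^sub>C (a + b) = z *\<^sub>C a + z *\<^sub>C b" for a b :: 'a
    by (rule scaleC_add_right)
  show "z *\<^sub>C r *\<^sub>R a = r *\<^sub>R z *\<^sub>C a" for r and a :: 'a
    by (metis scaleC_of_real scaleC_scaleC mult.commute)
  show "norm (z *\<^sub>C a) \<le> norm a * cmod z" for a :: 'a
    by simp
qed

instantiation complex :: complex_banach
begin

definition scaleC_complex :: "complex \<Rightarrow> complex \<Rightarrow> complex" where
  "scaleC_complex = (*)"

instance
  by standard (simp_all add: scaleC_complex_def algebra_simps norm_mult scaleR_conv_of_real)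

end

definition bounded_clinear :: "('a::complex_banach \<Rightarrow> 'b::complex_banach) \<Rightarrow> bool" where
  "bounded_clinear G \<longleftrightarrow> bounded_linear G \<and> (\<forall>z a. G (z *\<^sub>C a) = z *\<^sub>C G a)"

lemma bounded_clinearI:
  assumes "\<And>a b. G (a + b) = G a + G b" "\<And>z a. G (z *\<^sub>C a) = z *\<^sub>C G a"
    and "\<And>a. norm (G a) \<le> K * norm a"
  shows "bounded_clinear G"
  unfolding bounded_clinear_def
proof
  show "bounded_linear G"
  proof (rule bounded_linear_intro)
    show "G (r *\<^sub>R a) = r *\<^sub>R G a" for r a
      using assms(2)[of "of_real r" a] by (simp add: scaleC_of_real)
    show "norm (G a) \<le> norm a * K" for a
      using assms(3)[of a] by (simp add: mult.commute)
  qed (rule assms(1))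
qed (use assms(2) in auto)

lemma bounded_clinear_bounded_linear: "bounded_clinear G \<Longrightarrow> bounded_linear G"
  by (simp add: bounded_clinear_def)

lemma
  assumes "bounded_clinear G"
  shows bounded_clinear_add: "G (a + b) = G a + G b"
    and bounded_clinear_diff: "G (a - b) = G a - G b"
    and bounded_clinear_zero: "G 0 = 0"
    and bounded_clinear_scaleC: "G (z *\<^sub>C a) = z *\<^sub>C G a"
    and bounded_clinear_sum: "G (\<Sum>i\<in>I. f i) = (\<Sum>i\<in>I. G (f i))"
proof -
  interpret bounded_linear G
    using assms by (rule bounded_clinear_bounded_linear)
  show "G (a + b) = G a + G b" "G (a - b) = G a - G b" "G 0 = 0"
    "G (\<Sum>i\<in>I. f i) = (\<Sum>i\<in>I. G (f i))"
    by (fact add, fact diff, fact zero, fact sum)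
  show "G (z *\<^sub>C a) = z *\<^sub>C G a"
    using assms by (simp add: bounded_clinear_def)
qed

lemma bounded_clinear_bound:
  assumes "bounded_clinear G"
  obtains K where "K > 0" "\<And>a. norm (G a) \<le> K * norm a"
  using bounded_linear.pos_bounded[OF bounded_clinear_bounded_linear[OF assms]]
  by (metis mult.commute)

lemma bounded_clinear_ident: "bounded_clinear (\<lambda>a::'a::complex_banach. a)"
  by (simp add: bounded_clinear_def bounded_linear_ident)

lemma bounded_clinear_plus:
  assumes "bounded_clinear G" "bounded_clinear H"
  shows "bounded_clinear (\<lambda>a. G a + H a)"
  using assms by (simp add: bounded_clinear_def bounded_linear_add scaleC_add_right)

lemma bounded_clinear_const_scaleC:
  assumes "bounded_clinear G"
  shows "bounded_clinear (\<lambda>a. z *\<^sub>C G a)"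
  using assms bounded_linear_compose[OF bounded_linear_scaleC_right]
  by (auto simp: bounded_clinear_def mult.commute)

lemma bounded_clinear_minus:
  assumes "bounded_clinear G" "bounded_clinear H"
  shows "bounded_clinear (\<lambda>a. G a - H a)"
  using assms by (simp add: bounded_clinear_def bounded_linear_sub scaleC_diff_right)

lemma bounded_clinear_setsum:
  assumes "\<And>i. i \<in> I \<Longrightarrow> bounded_clinear (G i)"
  shows "bounded_clinear (\<lambda>a. \<Sum>i\<in>I. G i a)"
  using assms by (auto simp: bounded_clinear_def bounded_linear_sum scaleC_sum_right)

lemma bounded_clinear_compose:
  assumes "bounded_clinear G" "bounded_clinear H"
  shows "bounded_clinear (\<lambda>a. G (H a))"
  using assms bounded_linear_compose by (auto simp: bounded_clinear_def)

section \<open>The Banach space of absolutely summable complex families\<close>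

typedef 'a ell1 = "{f :: 'a \<Rightarrow> complex. (\<lambda>x. cmod (f x)) summable_on UNIV}"
  morphisms coeff Abs_ell1
  by (rule exI[of _ "\<lambda>_. 0"]) simp

setup_lifting type_definition_ell1

lemma summable_coeff [simp]: "(\<lambda>x. cmod (coeff a x)) summable_on A"
  using coeff[of a] summable_on_subset_banach by blast

lemma ell1_eqI: "(\<And>x. coeff a x = coeff b x) \<Longrightarrow> a = b"
  by (simp add: coeff_inject[symmetric] fun_eq_iff)

instantiation ell1 :: (type) real_vector
begin

lift_definition zero_ell1 :: "'a ell1" is "\<lambda>_. 0"
  by simp

lift_definition plus_ell1 :: "'a ell1 \<Rightarrow> 'a ell1 \<Rightarrow> 'a ell1" is "\<lambda>f g x. f x + g x"
proof -
  fix f g :: "'a \<Rightarrow> complex"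
  assume "(\<lambda>x. cmod (f x)) summable_on UNIV" "(\<lambda>x. cmod (g x)) summable_on UNIV"
  from summable_on_add[OF this] show "(\<lambda>x. cmod (f x + g x)) summable_on UNIV"
    by (rule summable_on_comparison_test) (auto intro: norm_triangle_ineq)
qed

lift_definition uminus_ell1 :: "'a ell1 \<Rightarrow> 'a ell1" is "\<lambda>f x. - f x"
  by simp

lift_definition minus_ell1 :: "'a ell1 \<Rightarrow> 'a ell1 \<Rightarrow> 'a ell1" is "\<lambda>f g x. f x - g x"
proof -
  fix f g :: "'a \<Rightarrow> complex"
  assume "(\<lambda>x. cmod (f x)) summable_on UNIV" "(\<lambda>x. cmod (g x)) summable_on UNIV"
  from summable_on_add[OF this] show "(\<lambda>x. cmod (f x - g x)) summable_on UNIV"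
    by (rule summable_on_comparison_test) (auto intro: norm_triangle_ineq4)
qed

lift_definition scaleR_ell1 :: "real \<Rightarrow> 'a ell1 \<Rightarrow> 'a ell1" is "\<lambda>r f x. complex_of_real r * f x"
  by (simp add: norm_mult summable_on_cmult_right)

instance
  by standard (transfer; simp add: fun_eq_iff algebra_simps)+

end

instantiation ell1 :: (type) real_normed_vector
begin

definition norm_ell1 :: "'a ell1 \<Rightarrow> real" where
  "norm_ell1 a = (\<Sum>\<^sub>\<infinity>x. cmod (coeff a x))"

definition sgn_ell1 :: "'a ell1 \<Rightarrow> 'a ell1" where
  "sgn_ell1 a = a /\<^sub>R norm a"

definition dist_ell1 :: "'a ell1 \<Rightarrow> 'a ell1 \<Rightarrow> real" where
  "dist_ell1 a b = norm (a - b)"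

definition uniformity_ell1 :: "('a ell1 \<times> 'a ell1) filter" where
  "uniformity_ell1 = (INF e\<in>{0 <..}. principal {(x, y). dist x y < e})"

definition open_ell1 :: "'a ell1 set \<Rightarrow> bool" where
  "open_ell1 U \<longleftrightarrow> (\<forall>x\<in>U. \<forall>\<^sub>F (x', y) in uniformity. x' = x \<longrightarrow> y \<in> U)"

instance
proof
  fix a b :: "'a ell1" and r :: real
  show "sgn a = a /\<^sub>R norm a" "dist a b = norm (a - b)"
    "uniformity = (INF e\<in>{0 <..}. principal {(x, y::'a ell1). dist x y < e})"
    by (fact sgn_ell1_def dist_ell1_def uniformity_ell1_def)+
  show "open U = (\<forall>x\<in>U. \<forall>\<^sub>F (x', y) in uniformity. x' = x \<longrightarrow> y \<in> U)" for U :: "'a ell1 set"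
    by (fact open_ell1_def)
  show "norm a = 0 \<longleftrightarrow> a = 0"
  proof
    assume "norm a = 0"
    then have "cmod (coeff a x) = 0" for x
      using nonneg_infsum_le_0D[of "\<lambda>x. cmod (coeff a x)" UNIV]
      by (auto simp: norm_ell1_def)
    then show "a = 0"
      by (intro ell1_eqI) (simp add: zero_ell1.rep_eq)
  qed (simp add: norm_ell1_def zero_ell1.rep_eq)
  show "norm (a + b) \<le> norm a + norm b"
  proof -
    have "norm (a + b) \<le> (\<Sum>\<^sub>\<infinity>x. cmod (coeff a x) + cmod (coeff b x))"
      unfolding norm_ell1_def
    proof (rule infsum_mono)
      show "cmod (coeff (a + b) x) \<le> cmod (coeff a x) + cmod (coeff b x)" for x
        by (simp add: plus_ell1.rep_eq norm_triangle_ineq)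
    qed (auto intro: summable_on_add)
    also have "\<dots> = norm a + norm b"
      by (simp add: norm_ell1_def infsum_add)
    finally show ?thesis .
  qed
  show "norm (r *\<^sub>R a) = \<bar>r\<bar> * norm a"
    by (simp add: norm_ell1_def scaleR_ell1.rep_eq norm_mult infsum_cmult_right)
qed

end

lemma coeff_simps [simp]:
  "coeff 0 x = 0" "coeff (a + b) x = coeff a x + coeff b x"
  "coeff (a - b) x = coeff a x - coeff b x" "coeff (- a) x = - coeff a x"
  by (simp_all add: zero_ell1.rep_eq plus_ell1.rep_eq minus_ell1.rep_eq uminus_ell1.rep_eq)

lemma sum_coeff_le_norm:
  assumes "finite F"
  shows "(\<Sum>x\<in>F. cmod (coeff a x)) \<le> norm a"
  unfolding norm_ell1_def by (rule finite_sum_le_infsum) (use assms in auto)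

lemma coeff_le_norm: "cmod (coeff a x) \<le> norm a"
  using sum_coeff_le_norm[of "{x}" a] by simp

lemma norm_ell1_le:
  assumes "\<And>F. finite F \<Longrightarrow> (\<Sum>x\<in>F. cmod (coeff a x)) \<le> B"
  shows "norm a \<le> B"
  unfolding norm_ell1_def by (rule infsum_le_finite_sums) (use assms in auto)

lemma coeff_Abs_ell1:
  assumes "\<And>F. finite F \<Longrightarrow> (\<Sum>x\<in>F. cmod (f x)) \<le> B"
  shows "coeff (Abs_ell1 f) = f"
proof (rule Abs_ell1_inverse)
  show "f \<in> {f. (\<lambda>x. cmod (f x)) summable_on UNIV}"
    using assms by (auto intro!: nonneg_bdd_above_summable_on bdd_aboveI[of _ B])
qed

text \<open>Coordinates of a Cauchy sequence converge; that the limit family is summable and is a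
  limit in norm is read off from finite partial sums.\<close>

instance ell1 :: (type) banach
proof
  fix X :: "nat \<Rightarrow> 'a ell1"
  assume X: "Cauchy X"
  have "Cauchy (\<lambda>n. coeff (X n) x)" for x
  proof (rule CauchyI)
    fix e :: real assume "e > 0"
    then obtain M where "\<forall>m\<ge>M. \<forall>n\<ge>M. norm (X m - X n) < e"
      using CauchyD[OF X] by blast
    then show "\<exists>M. \<forall>m\<ge>M. \<forall>n\<ge>M. cmod (coeff (X m) x - coeff (X n) x) < e"
      using coeff_le_norm[of "X _ - X _" x] by (metis coeff_simps(3) le_less_trans)
  qed
  then obtain f where f: "(\<lambda>n. coeff (X n) x) \<longlonglongrightarrow> f x" for x
    unfolding Cauchy_convergent_iff convergent_def by metis
  \<comment> \<open>On a finite index set the Cauchy estimate passes to the pointwise limit. Its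
    uniformity in \<open>F\<close> gives both the summability of \<open>f\<close> and the
    convergence in norm.\<close>
  have fin: "\<exists>M. \<forall>m\<ge>M. \<forall>F::'a set. finite F \<longrightarrow> (\<Sum>x\<in>F. cmod (coeff (X m) x - f x)) \<le> e"
    if "e > 0" for e
  proof -
    obtain M where M: "norm (X m - X n) < e" if "m \<ge> M" "n \<ge> M" for m n
      using CauchyD[OF X \<open>e > 0\<close>] by blast
    show ?thesis
    proof (intro exI[of _ M] allI impI)
      fix m and F :: "'a set" assume "m \<ge> M" "finite F"
      show "(\<Sum>x\<in>F. cmod (coeff (X m) x - f x)) \<le> e"
      proof (rule LIMSEQ_le_const2)
        show "(\<lambda>n. \<Sum>x\<in>F. cmod (coeff (X m) x - coeff (X n) x)) \<longlonglongrightarrow>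
          (\<Sum>x\<in>F. cmod (coeff (X m) x - f x))"
          by (intro tendsto_intros f)
        show "\<exists>N. \<forall>n\<ge>N. (\<Sum>x\<in>F. cmod (coeff (X m) x - coeff (X n) x)) \<le> e"
        proof (intro exI[of _ M] allI impI)
          fix n assume "n \<ge> M"
          then show "(\<Sum>x\<in>F. cmod (coeff (X m) x - coeff (X n) x)) \<le> e"
            using sum_coeff_le_norm[OF \<open>finite F\<close>, of "X m - X n"] M[of m n] \<open>m \<ge> M\<close> by simp
        qed
      qed
    qed
  qed
  obtain M where M: "\<And>F. finite F \<Longrightarrow> (\<Sum>x\<in>F. cmod (coeff (X M) x - f x)) \<le> 1"
    using fin[of 1] by auto
  have "(\<Sum>x\<in>F. cmod (f x)) \<le> 1 + norm (X M)" if "finite F" for F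
  proof -
    have "(\<Sum>x\<in>F. cmod (f x)) \<le> (\<Sum>x\<in>F. cmod (coeff (X M) x - f x) + cmod (coeff (X M) x))"
      by (rule sum_mono) (metis norm_minus_commute norm_triangle_sub add.commute)
    also have "\<dots> \<le> 1 + norm (X M)"
      using M[OF that] sum_coeff_le_norm[OF that, of "X M"] by (simp add: sum.distrib)
    finally show ?thesis .
  qed
  then have f_coeff: "coeff (Abs_ell1 f) = f"
    by (rule coeff_Abs_ell1)
  have "X \<longlonglongrightarrow> Abs_ell1 f"
  proof (rule LIMSEQ_I)
    fix r :: real assume "r > 0"
    then obtain M where M: "\<And>m F. m \<ge> M \<Longrightarrow> finite F \<Longrightarrow> (\<Sum>x\<in>F. cmod (coeff (X m) x - f x)) \<le> r / 2"
      using fin[of "r / 2"] by auto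
    have "norm (X m - Abs_ell1 f) \<le> r / 2" if "m \<ge> M" for m
      by (rule norm_ell1_le) (simp only: coeff_simps f_coeff M that)
    then show "\<exists>no. \<forall>n\<ge>no. norm (X n - Abs_ell1 f) < r"
      using \<open>r > 0\<close> by (smt (verit) field_sum_of_halves)
  qed
  then show "convergent X"
    by (rule convergentI)
qed

instantiation ell1 :: (type) complex_banach
begin

lift_definition scaleC_ell1 :: "complex \<Rightarrow> 'a ell1 \<Rightarrow> 'a ell1" is "\<lambda>z f x. z * f x"
  by (simp add: norm_mult summable_on_cmult_right)

instance
proof
  fix a b :: "'a ell1" and y z :: complex and r :: real
  show "z *\<^sub>C (a + b) = z *\<^sub>C a + z *\<^sub>C b" "(y + z) *\<^sub>C a = y *\<^sub>C a + z *\<^sub>C a"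
    "y *\<^sub>C z *\<^sub>C a = (y * z) *\<^sub>C a" "complex_of_real r *\<^sub>C a = r *\<^sub>R a"
    by (transfer; simp add: fun_eq_iff algebra_simps)+
  show "norm (z *\<^sub>C a) = cmod z * norm a"
    by (simp add: norm_ell1_def scaleC_ell1.rep_eq norm_mult infsum_cmult_right)
qed

end

lemma coeff_scaleC [simp]: "coeff (z *\<^sub>C a) x = z * coeff a x"
  by (simp add: scaleC_ell1.rep_eq)

lemma bounded_clinear_coeff: "bounded_clinear (\<lambda>a. coeff a x)"
  by (rule bounded_clinearI[where K = 1]) (auto simp: scaleC_complex_def coeff_le_norm)

definition basis_ell1 :: "'a \<Rightarrow> 'a ell1" where
  "basis_ell1 x = Abs_ell1 (\<lambda>y. if y = x then 1 else 0)"

lemma sum_cmod_delta_le: "finite F \<Longrightarrow> (\<Sum>y\<in>F. cmod (if y = x then 1 else 0)) \<le> 1"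
proof -
  assume "finite F"
  have "(\<Sum>y\<in>F. cmod (if y = x then 1 else 0)) = (\<Sum>y\<in>F. if y = x then 1 else 0)"
    by (rule sum.cong) auto
  also have "\<dots> \<le> 1"
    using \<open>finite F\<close> by simp
  finally show ?thesis .
qed

lemma coeff_basis_ell1 [simp]: "coeff (basis_ell1 x) y = (if y = x then 1 else 0)"
  by (simp add: basis_ell1_def coeff_Abs_ell1[OF sum_cmod_delta_le])

lemma norm_basis_ell1 [simp]: "norm (basis_ell1 x) = 1"
proof (rule antisym)
  show "norm (basis_ell1 x) \<le> 1"
    by (rule norm_ell1_le) (simp only: coeff_basis_ell1 sum_cmod_delta_le)
  show "1 \<le> norm (basis_ell1 x)"
    using coeff_le_norm[of "basis_ell1 x" x] by simp
qed

text \<open>The universal property of \<open>\<ell>\<^sup>1\<close>: a bounded family of vectors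
  \<open>v x\<close> extends uniquely to a bounded linear map sending \<open>basis_ell1 x\<close> to
  \<open>v x\<close>, with norm bounded by that of the family. All operators on coordinates are
  produced in this way.\<close>

definition ell1_extend :: "('a \<Rightarrow> 'b::complex_banach) \<Rightarrow> 'a ell1 \<Rightarrow> 'b" where
  "ell1_extend v a = (\<Sum>\<^sub>\<infinity>x. coeff a x *\<^sub>C v x)"

context
  fixes v :: "'a \<Rightarrow> 'b::complex_banach" and B :: real
  assumes v: "\<And>x. norm (v x) \<le> B"
begin

lemma ell1_extend_abs_summable: "(\<lambda>x. norm (coeff a x *\<^sub>C v x)) summable_on UNIV"
proof (rule summable_on_comparison_test)
  show "(\<lambda>x. B * cmod (coeff a x)) summable_on UNIV"
    by (simp add: summable_on_cmult_right)
  show "norm (coeff a x *\<^sub>C v x) \<le> B * cmod (coeff a x)" for x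
    using v[of x] by (simp add: mult.commute mult_right_mono)
qed auto

lemma ell1_extend_summable: "(\<lambda>x. coeff a x *\<^sub>C v x) summable_on UNIV"
  by (rule abs_summable_summable[OF ell1_extend_abs_summable])

lemma norm_ell1_extend_le: "norm (ell1_extend v a) \<le> B * norm a"
proof -
  have "norm (ell1_extend v a) \<le> (\<Sum>\<^sub>\<infinity>x. norm (coeff a x *\<^sub>C v x))"
    unfolding ell1_extend_def by (rule norm_infsum_bound[OF ell1_extend_abs_summable])
  also have "\<dots> \<le> (\<Sum>\<^sub>\<infinity>x. B * cmod (coeff a x))"
  proof (rule infsum_mono[OF ell1_extend_abs_summable])
    show "norm (coeff a x *\<^sub>C v x) \<le> B * cmod (coeff a x)" for x
      using v[of x] by (simp add: mult.commute mult_right_mono)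
  qed (simp add: summable_on_cmult_right)
  also have "\<dots> = B * norm a"
    by (simp add: norm_ell1_def infsum_cmult_right)
  finally show ?thesis .
qed

lemma bounded_clinear_ell1_extend: "bounded_clinear (ell1_extend v)"
proof (rule bounded_clinearI[where K = B])
  show "ell1_extend v (a + b) = ell1_extend v a + ell1_extend v b" for a b
    by (simp add: ell1_extend_def scaleC_add_left infsum_add ell1_extend_summable)
  show "ell1_extend v (z *\<^sub>C a) = z *\<^sub>C ell1_extend v a" for z a
    unfolding ell1_extend_def
    using infsumI[OF has_sum_bounded_linear[OF bounded_linear_scaleC_right
          has_sum_infsum[OF ell1_extend_summable]], of z a]
    by simp
qed (rule norm_ell1_extend_le)

lemma bounded_clinear_ell1_extend_eq:
  assumes "bounded_clinear G"
  shows "G (ell1_extend v a) = ell1_extend (\<lambda>x. G (v x)) a"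
  using infsumI[OF has_sum_bounded_linear[OF bounded_clinear_bounded_linear[OF assms]
        has_sum_infsum[OF ell1_extend_summable]], of a]
  by (simp add: ell1_extend_def bounded_clinear_scaleC[OF assms])

end

lemma ell1_extend_basis [simp]: "ell1_extend v (basis_ell1 x) = v x"
proof -
  have "ell1_extend v (basis_ell1 x) = (\<Sum>\<^sub>\<infinity>y\<in>{x}. coeff (basis_ell1 x) y *\<^sub>C v y)"
    unfolding ell1_extend_def by (rule infsum_cong_neutral) auto
  then show ?thesis
    by simp
qed

lemma ell1_extend_cong:
  assumes "\<And>x. coeff a x \<noteq> 0 \<Longrightarrow> v x = w x"
  shows "ell1_extend v a = ell1_extend w a"
  unfolding ell1_extend_def by (rule infsum_cong) (metis assms scaleC_zero_left)

lemma ell1_extend_basis_eq: "ell1_extend basis_ell1 a = a"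
proof (rule ell1_eqI)
  fix x
  have "coeff (ell1_extend basis_ell1 a) x = ell1_extend (\<lambda>y. coeff (basis_ell1 y) x) a"
    by (rule bounded_clinear_ell1_extend_eq[where B = 1]) (auto simp: bounded_clinear_coeff)
  also have "\<dots> = (\<Sum>\<^sub>\<infinity>y\<in>{x}. coeff a y *\<^sub>C coeff (basis_ell1 y) x)"
    unfolding ell1_extend_def by (rule infsum_cong_neutral) (auto simp: scaleC_complex_def)
  finally show "coeff (ell1_extend basis_ell1 a) x = coeff a x"
    by (simp add: scaleC_complex_def)
qed

lemma bounded_clinear_eqI:
  fixes G H :: "'a ell1 \<Rightarrow> 'b::complex_banach"
  assumes "bounded_clinear G" "bounded_clinear H" "\<And>x. G (basis_ell1 x) = H (basis_ell1 x)"
  shows "G a = H a"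
  using bounded_clinear_ell1_extend_eq[OF _ assms(1), of basis_ell1 1 a]
    bounded_clinear_ell1_extend_eq[OF _ assms(2), of basis_ell1 1 a]
  by (simp add: ell1_extend_basis_eq assms(3))

lemma ell1_extend_finite:
  assumes "finite F" "\<And>x. x \<notin> F \<Longrightarrow> coeff a x = 0"
  shows "ell1_extend v a = (\<Sum>x\<in>F. coeff a x *\<^sub>C v x)"
proof -
  have "ell1_extend v a = (\<Sum>\<^sub>\<infinity>x\<in>F. coeff a x *\<^sub>C v x)"
    unfolding ell1_extend_def by (rule infsum_cong_neutral) (use assms in auto)
  then show ?thesis
    using assms(1) by simp
qed

lemma ell1_finite_approx:
  assumes "e > 0"
  obtains F where "finite F" "norm (a - (\<Sum>x\<in>F. coeff a x *\<^sub>C basis_ell1 x)) < e"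
    "\<And>x. x \<in> F \<Longrightarrow> coeff a x \<noteq> 0"
proof -
  have "((\<lambda>x. coeff a x *\<^sub>C basis_ell1 x) has_sum a) UNIV"
    using has_sum_infsum[OF ell1_extend_summable[of basis_ell1 1 a]] ell1_extend_basis_eq[of a]
    by (simp add: ell1_extend_def)
  then have "((\<lambda>x. coeff a x *\<^sub>C basis_ell1 x) has_sum a) {x. coeff a x \<noteq> 0}"
    by (rule has_sum_cong_neutral[THEN iffD1, rotated -1]) auto
  from has_sum_finite_approximation[OF this, of "e / 2"] assms obtain F
    where "finite F" "F \<subseteq> {x. coeff a x \<noteq> 0}"
      "dist (\<Sum>x\<in>F. coeff a x *\<^sub>C basis_ell1 x) a \<le> e / 2"
    by auto
  with assms show ?thesis
    by (intro that[of F]) (auto simp: dist_norm norm_minus_commute)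
qed

lemma ell1_op_expand:
  fixes G :: "'a ell1 \<Rightarrow> 'b::complex_banach"
  assumes "bounded_clinear G"
  shows "G a = ell1_extend (\<lambda>x. G (basis_ell1 x)) a"
  using bounded_clinear_ell1_extend_eq[OF _ assms, of basis_ell1 1 a]
  by (simp add: ell1_extend_basis_eq)

lemma ell1_op_bound:
  fixes G :: "'a ell1 \<Rightarrow> 'b::complex_banach"
  assumes "bounded_clinear G" "\<And>x. norm (G (basis_ell1 x)) \<le> B"
  shows "norm (G a) \<le> B * norm a"
  by (subst ell1_op_expand[OF assms(1)]) (rule norm_ell1_extend_le[OF assms(2)])

text \<open>Agreement is asked only on the support of \<open>a\<close>, because the maps to be
  compared are known to agree on \<open>basis_ell1 p\<close> only for
  \<open>p \<in> P\<close>.\<close>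

lemma ell1_op_eq_on_support:
  fixes G H :: "'a ell1 \<Rightarrow> 'b::complex_banach"
  assumes "bounded_clinear G" "bounded_clinear H"
    and "\<And>x. coeff a x \<noteq> 0 \<Longrightarrow> G (basis_ell1 x) = H (basis_ell1 x)"
  shows "G a = H a"
  by (subst ell1_op_expand[OF assms(1)], subst ell1_op_expand[OF assms(2)])
    (rule ell1_extend_cong, rule assms(3))

section \<open>Rank-one perturbations\<close>

text \<open>\<open>R z\<close> is the resolvent of \<open>T\<close> outside the disc of radius
  \<open>s\<close>, and \<open>c n\<close> stands for the moment \<open>l (T\<^sup>n e)\<close>. The
  growth bound on the moments makes \<open>l (R z e)\<close> analytic in
  \<open>1 / z\<close>.\<close>

locale rank_one_perturbation =
  fixes T :: "'a::complex_banach \<Rightarrow> 'a" and l :: "'a \<Rightarrow> complex" and e :: 'a and s :: real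
    and R :: "complex \<Rightarrow> 'a \<Rightarrow> 'a" and c :: "nat \<Rightarrow> complex" and C :: real
  assumes s_pos: "s > 0"
    and T: "bounded_clinear T" and l: "bounded_clinear l"
    and R: "s < cmod z \<Longrightarrow> bounded_clinear (R z)"
    and R_right: "s < cmod z \<Longrightarrow> z *\<^sub>C R z a - T (R z a) = a"
    and R_left: "s < cmod z \<Longrightarrow> R z (z *\<^sub>C a - T a) = a"
    and c_bound: "cmod (c n) \<le> C * s ^ n"
    and l_R_sums: "s < cmod z \<Longrightarrow> (\<lambda>n. c n / z ^ Suc n) sums l (R z e)"
begin

definition pert :: "'a \<Rightarrow> 'a" where
  "pert a = T a + l a *\<^sub>C e"

definition shifted :: "complex \<Rightarrow> 'a \<Rightarrow> 'a" where
  "shifted z a = z *\<^sub>C a - pert a"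

text \<open>The Sherman-Morrison formula; it inverts \<open>shifted z\<close> whenever
  \<open>l (R z e) \<noteq> 1\<close>.\<close>

definition resolvent :: "complex \<Rightarrow> 'a \<Rightarrow> 'a" where
  "resolvent z b = R z b + (l (R z b) / (1 - l (R z e))) *\<^sub>C R z e"

lemmas linear_simps =
  bounded_clinear_add[OF T] bounded_clinear_diff[OF T] bounded_clinear_zero[OF T]
  bounded_clinear_scaleC[OF T] bounded_clinear_add[OF l] bounded_clinear_diff[OF l]
  bounded_clinear_zero[OF l] bounded_clinear_scaleC[OF l]

lemma shifted_eq: "shifted z a = z *\<^sub>C a - T a - l a *\<^sub>C e"
  by (simp add: shifted_def pert_def)

lemma shifted_add: "shifted z (a + b) = shifted z a + shifted z b"
  by (simp add: shifted_eq linear_simps scaleC_add_left scaleC_add_right)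

lemma shifted_scaleC: "shifted z (y *\<^sub>C a) = y *\<^sub>C shifted z a"
  by (simp add: shifted_eq linear_simps scaleC_diff_right scaleC_complex_def mult.commute)

lemma shifted_zero: "shifted z 0 = 0"
  by (simp add: shifted_eq linear_simps)

lemma bounded_clinear_resolvent:
  assumes "s < cmod z"
  shows "bounded_clinear (resolvent z)"
proof -
  note Rz = R[OF assms]
  obtain K where K: "K > 0" "\<And>a. norm (R z a) \<le> K * norm a"
    using bounded_clinear_bound[OF Rz] by blast
  obtain M where M: "M > 0" "\<And>a. norm (l a) \<le> M * norm a"
    using bounded_clinear_bound[OF l] by blast
  define N where "N = cmod (1 / (1 - l (R z e))) * norm (R z e)"
  have "N \<ge> 0"
    by (simp add: N_def)
  show ?thesis
  proof (rule bounded_clinearI[where K = "K + M * K * N"])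
    show "resolvent z (a + b) = resolvent z a + resolvent z b" for a b
      by (simp add: resolvent_def bounded_clinear_add[OF Rz] linear_simps add_divide_distrib
          scaleC_add_left)
    show "resolvent z (y *\<^sub>C a) = y *\<^sub>C resolvent z a" for y a
      by (simp add: resolvent_def bounded_clinear_scaleC[OF Rz] linear_simps
          scaleC_add_right scaleC_complex_def)
    show "norm (resolvent z a) \<le> (K + M * K * N) * norm a" for a
    proof -
      have "norm (resolvent z a) \<le> norm (R z a) + cmod (l (R z a)) * N"
        using norm_triangle_ineq[of "R z a" "(l (R z a) / (1 - l (R z e))) *\<^sub>C R z e"]
        by (simp add: resolvent_def N_def norm_divide)
      moreover have "cmod (l (R z a)) \<le> M * (K * norm a)"
        using order_trans[OF M(2) mult_left_mono[OF K(2)]] M(1) by simp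
      then have "norm (R z a) + cmod (l (R z a)) * N \<le> K * norm a + M * (K * norm a) * N"
        using K(2) \<open>N \<ge> 0\<close> by (intro add_mono mult_right_mono)
      ultimately show ?thesis
        by (simp add: algebra_simps)
    qed
  qed
qed

lemma resolvent_shifted:
  assumes "s < cmod z" "l (R z e) \<noteq> 1"
  shows "resolvent z (shifted z a) = a" "shifted z (resolvent z a) = a"
proof -
  note Rz = R[OF assms(1)]
  have "R z (shifted z a) = a - l a *\<^sub>C R z e"
    using R_left[OF assms(1), of a]
    by (simp add: shifted_eq bounded_clinear_diff[OF Rz] bounded_clinear_scaleC[OF Rz])
  moreover have "l a - l a * l (R z e) = l a * (1 - l (R z e))"
    by (simp add: algebra_simps)
  ultimately show "resolvent z (shifted z a) = a"
    using assms(2) by (simp add: resolvent_def linear_simps scaleC_complex_def)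
  \<comment> \<open>\<open>q\<close> is the value of \<open>l\<close> at
    \<open>resolvent z a\<close>, so the rank-one term of \<open>shifted z\<close> cancels
    exactly.\<close>
  define q where "q = l (R z a) / (1 - l (R z e))"
  have q: "l (R z a) + q * l (R z e) = q"
    using assms(2) by (simp add: q_def divide_simps) (simp add: algebra_simps)
  have "shifted z (resolvent z a) =
      (z *\<^sub>C R z a - T (R z a)) + q *\<^sub>C (z *\<^sub>C R z e - T (R z e)) - (l (R z a) + q * l (R z e)) *\<^sub>C e"
    unfolding resolvent_def q_def[symmetric]
    by (simp add: shifted_eq linear_simps scaleC_add_right scaleC_diff_right scaleC_complex_def
        mult.commute)
  then show "shifted z (resolvent z a) = a"
    by (simp add: R_right[OF assms(1)] q)
qed

text \<open>\<open>l (R z e)\<close> is a power series in \<open>1 / z\<close> that vanishes at \<open>1 / z = 0\<close>, so it is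
  not identically 1.\<close>

lemma eventually_l_R_neq_1:
  assumes "s < cmod z"
  shows "\<forall>\<^sub>F y in at z. l (R y e) \<noteq> 1"
proof -
  define h where "h u = u * (\<Sum>n. c n * u ^ n) - 1" for u
  have "summable (\<lambda>n. c n * u ^ n)" if "cmod u < 1 / s" for u
  proof (rule summable_comparison_test')
    show "summable (\<lambda>n. C * (s * cmod u) ^ n)"
      using that s_pos by (intro summable_mult summable_geometric) (simp add: field_simps)
    show "norm (c n * u ^ n) \<le> C * (s * cmod u) ^ n" for n
      using mult_right_mono[OF c_bound[of n], of "cmod u ^ n"]
      by (simp add: norm_mult norm_power power_mult_distrib mult.assoc)
  qed
  then have sums: "(\<lambda>n. c n * u ^ n) sums (\<Sum>n. c n * u ^ n)" if "u \<in> ball 0 (1 / s)" for u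
    using that by (simp add: summable_sums)
  have "(\<lambda>u. \<Sum>n. c n * u ^ n) holomorphic_on ball 0 (1 / s)"
    by (rule power_series_holomorphic[where a = c]) (use sums in auto)
  then have hol: "h holomorphic_on ball 0 (1 / s)"
    unfolding h_def by (intro holomorphic_intros)
  have h: "h (1 / y) = l (R y e) - 1" if y: "s < cmod y" for y
  proof -
    have "1 / y \<in> ball 0 (1 / s)"
      using y s_pos frac_less2[of 1 1 s "cmod y"] by (simp add: norm_divide)
    from sums_mult[OF sums[OF this], of "1 / y"]
    have "(\<lambda>n. c n / y ^ Suc n) sums (1 / y * (\<Sum>n. c n * (1 / y) ^ n))"
      by (simp add: power_divide)
    with l_R_sums[OF y] show ?thesis
      unfolding h_def using sums_unique2 by fastforce
  qed
  have z0: "z \<noteq> 0" "1 / z \<in> ball 0 (1 / s)"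
    using assms s_pos frac_less2[of 1 1 s "cmod z"] by (auto simp: norm_divide)
  have "\<forall>\<^sub>F u in at (1 / z). h u \<noteq> 0 \<and> u \<in> ball 0 (1 / s)"
    by (rule non_zero_neighbour_alt[OF hol _ _ z0(2), of 0]) (use s_pos in \<open>auto simp: h_def\<close>)
  then have "\<forall>\<^sub>F u in at (1 / z). h u \<noteq> 0"
    by (rule eventually_mono) blast
  moreover have "filterlim (\<lambda>y. 1 / y) (at (1 / z)) (at z)"
  proof (rule filterlim_atI)
    show "((\<lambda>y. 1 / y) \<longlongrightarrow> 1 / z) (at z)"
      using z0 by (intro tendsto_intros)
    show "\<forall>\<^sub>F y in at z. 1 / y \<noteq> 1 / z"
      using eventually_neq_at_within by (rule eventually_mono) (simp add: z0)
  qed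
  ultimately have "\<forall>\<^sub>F y in at z. h (1 / y) \<noteq> 0"
    unfolding filterlim_iff by blast
  moreover have "\<forall>\<^sub>F y in at z. s < cmod y"
    by (rule order_tendstoD(1)[OF tendsto_norm[OF tendsto_ident_at] assms])
  ultimately show ?thesis
    by eventually_elim (auto simp: h)
qed

section \<open>Jordan chain and generalized eigenspace at a zero of
  \<open>1 - l (R z e)\<close>\<close>

context
  fixes z :: complex
  assumes z: "s < cmod z" and root: "l (R z e) = 1"
begin

abbreviation gen :: "nat \<Rightarrow> 'a" where
  "gen i \<equiv> (R z ^^ i) e"

text \<open>\<open>shifted z\<close> lowers the index by one up to a multiple of \<open>e\<close>;
  as long as \<open>l\<close> vanishes on the vectors \<open>gen (Suc i)\<close> with
  \<open>i \<ge> 1\<close>, these form a Jordan chain above the eigenvector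
  \<open>gen 1\<close>.\<close>

lemma shifted_gen: "shifted z (gen (Suc i)) = gen i - l (gen (Suc i)) *\<^sub>C e"
  using R_right[OF z, of "gen i"] by (simp add: shifted_eq)

lemma gen_one_eigen: "shifted z (gen 1) = 0" "gen 1 \<noteq> 0"
  using shifted_gen[of 0] root by (auto simp: linear_simps)

text \<open>Iterating the resolvent identity \<open>R y = R z + (z - y) R z R y\<close> gives the
  Taylor expansion of \<open>R y e\<close> at \<open>z\<close> with an explicit remainder.\<close>

lemma R_expand:
  assumes y: "s < cmod y"
  shows "R y e = (\<Sum>i<M. (z - y) ^ i *\<^sub>C gen (Suc i)) + (z - y) ^ M *\<^sub>C (R z ^^ M) (R y e)"
proof (induction M)
  case (Suc M)
  have Ry: "R y e = R z e + (z - y) *\<^sub>C R z (R y e)"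
  proof -
    have "z *\<^sub>C R y e - T (R y e) = e + (z - y) *\<^sub>C R y e"
      using R_right[OF y, of e] by (simp add: scaleC_diff_left algebra_simps)
    then show ?thesis
      using R_left[OF z, of "R y e"]
      by (simp add: bounded_clinear_add[OF R[OF z]] bounded_clinear_scaleC[OF R[OF z]])
  qed
  have pow_add: "(R z ^^ M) (a + b) = (R z ^^ M) a + (R z ^^ M) b" for a b
    by (induction M) (simp_all add: bounded_clinear_add[OF R[OF z]])
  have pow_scale: "(R z ^^ M) (w *\<^sub>C a) = w *\<^sub>C (R z ^^ M) a" for w a
    by (induction M) (simp_all add: bounded_clinear_scaleC[OF R[OF z]])
  have "(R z ^^ M) (R y e) = gen (Suc M) + (z - y) *\<^sub>C (R z ^^ Suc M) (R y e)"
    by (subst Ry) (simp only: pow_add pow_scale funpow_Suc_right o_apply)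
  then have "(z - y) ^ M *\<^sub>C (R z ^^ M) (R y e) =
      (z - y) ^ M *\<^sub>C gen (Suc M) + (z - y) ^ Suc M *\<^sub>C (R z ^^ Suc M) (R y e)"
    by (simp only: scaleC_add_right scaleC_scaleC power_Suc2)
  with Suc.IH show ?case
    by (simp only: sum.lessThan_Suc add.assoc)
qed simp

text \<open>Up to sign, the numbers \<open>l (gen (Suc m))\<close> are the Taylor coefficients at
  \<open>z\<close> of \<open>y \<mapsto> l (R y e)\<close>. If all of them with
  \<open>m \<ge> 1\<close> vanished, this function would be 1 near \<open>z\<close>, against
  \<open>eventually_l_R_neq_1\<close>.\<close>

lemma ex_l_gen_nonzero: "\<exists>m\<ge>1. l (gen (Suc m)) \<noteq> 0"
proof (rule ccontr)
  assume "\<not> ?thesis"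
  then have l0: "l (gen (Suc m)) = 0" if "m \<ge> 1" for m
    using that by blast
  obtain B where B: "B > 0" "\<And>a. norm (R z a) \<le> B * norm a"
    using bounded_clinear_bound[OF R[OF z]] by blast
  obtain K where K: "K > 0" "\<And>a. norm (l a) \<le> K * norm a"
    using bounded_clinear_bound[OF l] by blast
  have pow: "norm ((R z ^^ M) a) \<le> B ^ M * norm a" for M a
  proof (induction M)
    case (Suc M)
    then show ?case
      using order_trans[OF B(2) mult_left_mono[OF Suc]] B(1) by (simp add: mult.assoc)
  qed simp
  \<comment> \<open>The radius \<open>1 / B\<close> makes the remainder of \<open>R_expand\<close>
    tend to 0, since \<open>(R z ^^ M)\<close> has norm at most \<open>B ^ M\<close>.\<close>
  have l_R: "l (R y e) = 1" if y: "s < cmod y" "cmod (z - y) < 1 / B" for y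
  proof -
    have "cmod (l (R y e) - 1) \<le> K * norm (R y e) * (cmod (z - y) * B) ^ M" if "M \<ge> 1" for M
    proof -
      have "l (R y e) = (\<Sum>i<M. (z - y) ^ i * l (gen (Suc i))) + (z - y) ^ M * l ((R z ^^ M) (R y e))"
        by (subst R_expand[OF y(1), of M])
          (simp only: linear_simps bounded_clinear_sum[OF l] scaleC_complex_def)
      also have "(\<Sum>i<M. (z - y) ^ i * l (gen (Suc i))) = (\<Sum>i<M. if i = 0 then 1 else 0)"
        using root l0 by (intro sum.cong) auto
      finally have "l (R y e) - 1 = (z - y) ^ M * l ((R z ^^ M) (R y e))"
        using that by simp
      then have "cmod (l (R y e) - 1) = cmod (z - y) ^ M * cmod (l ((R z ^^ M) (R y e)))"
        by (simp add: norm_mult norm_power)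
      also have "\<dots> \<le> cmod (z - y) ^ M * (K * (B ^ M * norm (R y e)))"
      proof (rule mult_left_mono)
        show "cmod (l ((R z ^^ M) (R y e))) \<le> K * (B ^ M * norm (R y e))"
          using order_trans[OF K(2) mult_left_mono[OF pow]] K(1) by simp
      qed simp
      finally show ?thesis
        by (simp add: power_mult_distrib ac_simps)
    qed
    moreover have "(\<lambda>M. K * norm (R y e) * (cmod (z - y) * B) ^ M) \<longlonglongrightarrow> K * norm (R y e) * 0"
      using y(2) B(1) by (intro tendsto_intros LIMSEQ_realpow_zero) (auto simp: field_simps)
    ultimately have "cmod (l (R y e) - 1) \<le> K * norm (R y e) * 0"
      by (intro LIMSEQ_le_const[of _ _ "cmod (l (R y e) - 1)"]) auto
    then show ?thesis
      by simp
  qed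
  have "\<forall>\<^sub>F y in at z. cmod (z - y) < 1 / B"
  proof -
    have "((\<lambda>y. cmod (z - y)) \<longlongrightarrow> cmod (z - z)) (at z)"
      by (intro tendsto_intros)
    from order_tendstoD(2)[OF this, of "1 / B"] show ?thesis
      using B(1) by simp
  qed
  moreover have "\<forall>\<^sub>F y in at z. s < cmod y"
    by (rule order_tendstoD(1)[OF tendsto_norm[OF tendsto_ident_at] z])
  ultimately have "\<forall>\<^sub>F y in at z. False"
    using eventually_l_R_neq_1[OF z] by eventually_elim (use l_R in blast)
  then show False
    by simp
qed

text \<open>The number \<open>m\<close> is the order of \<open>z\<close> as a zero of
  \<open>1 - l (R y e)\<close>: the Jordan chain continues exactly until the first nonzero Taylor
  coefficient.\<close>

lemma gen_eigenspace_eq: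
  obtains m where "{a. \<exists>k. (shifted z ^^ k) a = 0} = range (\<lambda>w. \<Sum>i<m. w i *\<^sub>C gen (Suc i))"
proof -
  define m where "m = (LEAST m. m \<ge> 1 \<and> l (gen (Suc m)) \<noteq> 0)"
  have m: "m \<ge> 1" "l (gen (Suc m)) \<noteq> 0"
    using LeastI_ex[OF ex_l_gen_nonzero[unfolded Bex_def]] by (auto simp: m_def)
  have l0: "l (gen (Suc i)) = 0" if "i \<ge> 1" "i < m" for i
    using not_less_Least[of i "\<lambda>m. m \<ge> 1 \<and> l (gen (Suc m)) \<noteq> 0"] that by (auto simp: m_def)
  have pow_add: "(shifted z ^^ k) (a + b) = (shifted z ^^ k) a + (shifted z ^^ k) b" for k a b
    by (induction k) (simp_all add: shifted_add)
  have pow_scale: "(shifted z ^^ k) (w *\<^sub>C a) = w *\<^sub>C (shifted z ^^ k) a" for k w a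
    by (induction k) (simp_all add: shifted_scaleC)
  have pow_zero: "(shifted z ^^ k) 0 = 0" for k
    by (induction k) (simp_all add: shifted_zero)
  have pow_sum: "(shifted z ^^ k) (\<Sum>i\<in>I. f i) = (\<Sum>i\<in>I. (shifted z ^^ k) (f i))"
    for k and I :: "nat set" and f
    by (induction I rule: infinite_finite_induct) (simp_all add: pow_add pow_zero)
  have pow_gen: "(shifted z ^^ Suc i) (gen (Suc i)) = 0" if "i < m" for i
    using that
  proof (induction i)
    case 0
    then show ?case
      using gen_one_eigen by simp
  next
    case (Suc i)
    then have "shifted z (gen (Suc (Suc i))) = gen (Suc i)"
      using shifted_gen[of "Suc i"] l0[of "Suc i"] by simp
    then have "(shifted z ^^ Suc (Suc i)) (gen (Suc (Suc i))) = (shifted z ^^ Suc i) (gen (Suc i))"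
      by (simp only: funpow_Suc_right o_apply)
    with Suc show ?case
      by simp
  qed
  have pow_gen': "(shifted z ^^ m) (gen (Suc i)) = 0" if "i < m" for i
  proof -
    have "(shifted z ^^ m) (gen (Suc i)) = (shifted z ^^ (m - Suc i)) ((shifted z ^^ Suc i) (gen (Suc i)))"
      using that by (metis Suc_leI comp_apply funpow_add le_add_diff_inverse2)
    then show ?thesis
      by (simp only: pow_gen[OF that] pow_zero)
  qed
  have "a \<in> range (\<lambda>w. \<Sum>i<m. w i *\<^sub>C gen (Suc i))" if "(shifted z ^^ k) a = 0" for k a
    using that
  proof (induction k arbitrary: a)
    case 0
    then show ?case
      by (auto intro!: image_eqI[of _ _ "\<lambda>_. 0"])
  next
    case (Suc k)
    then have "(shifted z ^^ k) (shifted z a) = 0"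
      by (simp only: funpow_Suc_right o_apply)
    with Suc.IH obtain w where w: "shifted z a = (\<Sum>i<m. w i *\<^sub>C gen (Suc i))"
      by blast
    \<comment> \<open>Applying \<open>R z\<close> to \<open>z a - T a = shifted z a + l a e\<close>
      raises every index in the expansion of \<open>shifted z a\<close> by one and adds a multiple
      of \<open>gen 1\<close>.\<close>
    have a: "a = (\<Sum>i<m. w i *\<^sub>C gen (Suc (Suc i))) + l a *\<^sub>C gen 1"
    proof -
      have "z *\<^sub>C a - T a = shifted z a + l a *\<^sub>C e"
        by (simp add: shifted_eq)
      then show ?thesis
        using R_left[OF z, of a]
        by (simp add: w bounded_clinear_add[OF R[OF z]] bounded_clinear_scaleC[OF R[OF z]]
            bounded_clinear_sum[OF R[OF z]])
    qed
    obtain n where n: "m = Suc n"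
      using m(1) by (cases m) auto
    \<comment> \<open>Since \<open>l (gen 1) = 1\<close>, applying \<open>l\<close> cancels
      \<open>l a\<close>. In the remaining sum only the term of \<open>gen (Suc m)\<close> has a
      nonzero value of \<open>l\<close>, so the top coefficient \<open>w n\<close> vanishes and
      \<open>a\<close> stays within the first \<open>m\<close> vectors.\<close>
    have "l a = (\<Sum>i<m. w i * l (gen (Suc (Suc i)))) + l a"
      by (subst a) (simp add: linear_simps bounded_clinear_sum[OF l] scaleC_complex_def root)
    then have "(\<Sum>i<m. w i * l (gen (Suc (Suc i)))) = 0"
      by simp
    moreover have "(\<Sum>i<n. w i * l (gen (Suc (Suc i)))) = 0"
      by (intro sum.neutral) (use l0 n in \<open>auto simp del: funpow.simps\<close>)
    ultimately have "w n * l (gen (Suc m)) = 0"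
      by (simp add: n del: funpow.simps)
    then have "w n = 0"
      using m(2) by simp
    then have "a = (\<Sum>i<n. w i *\<^sub>C gen (Suc (Suc i))) + l a *\<^sub>C gen 1"
      using a by (simp add: n)
    also have "\<dots> = (\<Sum>i<m. (case i of 0 \<Rightarrow> l a | Suc j \<Rightarrow> w j) *\<^sub>C gen (Suc i))"
      unfolding n by (subst sum.lessThan_Suc_shift) (simp add: add.commute)
    finally show ?case
      by (rule range_eqI[where x = "\<lambda>i. case i of 0 \<Rightarrow> l a | Suc j \<Rightarrow> w j"])
  qed
  moreover have "(shifted z ^^ m) (\<Sum>i<m. w i *\<^sub>C gen (Suc i)) = 0" for w
    by (simp only: pow_sum pow_scale) (simp add: pow_gen' del: funpow.simps)
  ultimately have "{a. \<exists>k. (shifted z ^^ k) a = 0} = range (\<lambda>w. \<Sum>i<m. w i *\<^sub>C gen (Suc i))"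
    by blast
  then show thesis
    by (rule that)
qed

end

end

section \<open>Quasi-compactness in coordinates\<close>

text \<open>The coordinates form a subset \<open>S\<close> of a type and not a type, since in the
  application they depend on the real parameter. The two norm inequalities make
  \<open>\<Phi>\<close> an isomorphism, so spectral properties transfer in both directions.\<close>

locale cn_coordinates =
  fixes V :: "'v cnspace" and \<Phi> :: "'a::complex_banach \<Rightarrow> 'v" and S :: "'a set" and K :: real
  assumes S_zero: "0 \<in> S"
    and S_add: "a \<in> S \<Longrightarrow> b \<in> S \<Longrightarrow> a + b \<in> S"
    and S_scaleC: "a \<in> S \<Longrightarrow> z *\<^sub>C a \<in> S"
    and bij: "bij_betw \<Phi> S (carr V)"
    and Phi_zero: "\<Phi> 0 = vzero V"
    and Phi_add: "a \<in> S \<Longrightarrow> b \<in> S \<Longrightarrow> \<Phi> (a + b) = vadd V (\<Phi> a) (\<Phi> b)"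
    and Phi_scaleC: "a \<in> S \<Longrightarrow> \<Phi> (z *\<^sub>C a) = vscale V z (\<Phi> a)"
    and norm_le_vnorm: "a \<in> S \<Longrightarrow> norm a \<le> vnorm V (\<Phi> a)"
    and vnorm_le_norm: "a \<in> S \<Longrightarrow> vnorm V (\<Phi> a) \<le> K * norm a"
begin

lemma Phi_in [simp]: "a \<in> S \<Longrightarrow> \<Phi> a \<in> carr V"
  using bij by (auto simp: bij_betw_def)

lemma carrE:
  assumes "v \<in> carr V"
  obtains a where "a \<in> S" "v = \<Phi> a"
  using assms bij by (auto simp: bij_betw_def)

lemma Phi_eq_iff: "a \<in> S \<Longrightarrow> b \<in> S \<Longrightarrow> \<Phi> a = \<Phi> b \<longleftrightarrow> a = b"
  using bij by (auto simp: bij_betw_def inj_on_def)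

lemma S_sum: "(\<And>i. i \<in> I \<Longrightarrow> f i \<in> S) \<Longrightarrow> (\<Sum>i\<in>I. f i) \<in> S"
  by (induction I rule: infinite_finite_induct) (auto simp: S_zero S_add)

definition lift :: "('a \<Rightarrow> 'a) \<Rightarrow> 'v \<Rightarrow> 'v" where
  "lift G v = \<Phi> (G (inv_into S \<Phi> v))"

lemma lift_Phi [simp]: "a \<in> S \<Longrightarrow> lift G (\<Phi> a) = \<Phi> (G a)"
  using bij by (simp add: lift_def bij_betw_def)

lemma cn_bounded_op_lift:
  assumes G: "bounded_clinear G" and GS: "\<And>a. a \<in> S \<Longrightarrow> G a \<in> S"
  shows "cn_bounded_op V (lift G)"
  unfolding cn_bounded_op_def
proof (intro conjI ballI allI)
  fix v w z assume "v \<in> carr V" "w \<in> carr V"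
  then obtain a b where ab: "a \<in> S" "v = \<Phi> a" "b \<in> S" "w = \<Phi> b"
    by (metis carrE)
  then show "lift G (vadd V v w) = vadd V (lift G v) (lift G w)"
    by (simp add: Phi_add[symmetric] S_add GS bounded_clinear_add[OF G])
next
  fix v z assume "v \<in> carr V"
  then obtain a where a: "a \<in> S" "v = \<Phi> a"
    by (metis carrE)
  then show "lift G v \<in> carr V" "lift G (vscale V z v) = vscale V z (lift G v)"
    by (simp_all add: Phi_scaleC[symmetric] S_scaleC GS bounded_clinear_scaleC[OF G])
next
  obtain M where M: "M > 0" "\<And>a. norm (G a) \<le> M * norm a"
    using bounded_clinear_bound[OF G] by blast
  show "\<exists>L. \<forall>v\<in>carr V. vnorm V (lift G v) \<le> L * vnorm V v"
  proof (intro exI ballI)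
    fix v assume "v \<in> carr V"
    then obtain a where a: "a \<in> S" "v = \<Phi> a"
      by (metis carrE)
    have "vnorm V (lift G v) \<le> K * norm (G a)"
      using a by (simp add: vnorm_le_norm GS)
    also have "\<dots> \<le> \<bar>K\<bar> * norm (G a)"
      by (simp add: mult_right_mono)
    also have "\<dots> \<le> \<bar>K\<bar> * (M * vnorm V v)"
      using order_trans[OF M(2)[of a] mult_left_mono[OF norm_le_vnorm[OF a(1)]]] M(1) a
      by (intro mult_left_mono) auto
    finally show "vnorm V (lift G v) \<le> (\<bar>K\<bar> * M) * vnorm V v"
      by (simp add: mult.assoc)
  qed
qed

lemma cn_span_Phi:
  fixes m :: nat
  assumes g: "\<And>i. i < m \<Longrightarrow> g i \<in> S"
  shows "cn_span V ((\<lambda>i. \<Phi> (g i)) ` {..<m}) = \<Phi> ` range (\<lambda>w. \<Sum>i<m. w i *\<^sub>C g i)"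
    (is "_ = \<Phi> ` range ?c")
proof -
  have c: "?c w \<in> S" for w
    by (rule S_sum) (simp add: S_scaleC g)
  have "cn_subspace V (\<Phi> ` range ?c)"
    unfolding cn_subspace_def
  proof (intro conjI ballI allI)
    show "\<Phi> ` range ?c \<subseteq> carr V"
      using c by auto
    show "vzero V \<in> \<Phi> ` range ?c"
      using Phi_zero by (auto intro!: image_eqI[of _ _ 0] range_eqI[of _ _ "\<lambda>_. 0"])
  next
    fix v w assume "v \<in> \<Phi> ` range ?c" "w \<in> \<Phi> ` range ?c"
    then obtain x y where "v = \<Phi> (?c x)" "w = \<Phi> (?c y)"
      by auto
    then have "vadd V v w = \<Phi> (?c (\<lambda>i. x i + y i))"
      using c by (simp add: Phi_add[symmetric] scaleC_add_left sum.distrib)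
    then show "vadd V v w \<in> \<Phi> ` range ?c"
      by (rule image_eqI) (rule range_eqI, rule refl)
  next
    fix z v assume "v \<in> \<Phi> ` range ?c"
    then obtain x where "v = \<Phi> (?c x)"
      by auto
    then have "vscale V z v = \<Phi> (?c (\<lambda>i. z * x i))"
      using c by (simp add: Phi_scaleC[symmetric] scaleC_sum_right)
    then show "vscale V z v \<in> \<Phi> ` range ?c"
      by (rule image_eqI) (rule range_eqI, rule refl)
  qed
  moreover have "\<Phi> (g i) \<in> \<Phi> ` range ?c" if "i < m" for i
  proof -
    have "?c (\<lambda>j. if j = i then 1 else 0) = (\<Sum>j<m. if j = i then g j else 0)"
      by (rule sum.cong) auto
    also have "\<dots> = g i"
      using that by simp
    finally have "g i \<in> range ?c"
      by (intro range_eqI[where x = "\<lambda>j. if j = i then 1 else 0"]) simp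
    then show ?thesis
      by (rule imageI)
  qed
  ultimately have "cn_span V ((\<lambda>i. \<Phi> (g i)) ` {..<m}) \<subseteq> \<Phi> ` range ?c"
    unfolding cn_span_def by (intro Inter_lower) auto
  moreover have "\<Phi> (?c w) \<in> W" if W: "cn_subspace V W" "(\<lambda>i. \<Phi> (g i)) ` {..<m} \<subseteq> W" for w W
  proof -
    have "\<Phi> (\<Sum>i<n. w i *\<^sub>C g i) \<in> W" if "n \<le> m" for n
      using that
    proof (induction n)
      case 0
      then show ?case
        using W by (simp add: Phi_zero cn_subspace_def)
    next
      case (Suc n)
      have "(\<Sum>i<n. w i *\<^sub>C g i) \<in> S"
        using Suc.prems by (intro S_sum) (simp add: S_scaleC g)
      moreover have "\<Phi> (g n) \<in> W"
        using W(2) Suc.prems by auto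
      ultimately show ?case
        using W(1) Suc by (simp add: Phi_add Phi_scaleC S_scaleC g cn_subspace_def)
    qed
    then show ?thesis
      by simp
  qed
  then have "\<Phi> ` range ?c \<subseteq> cn_span V ((\<lambda>i. \<Phi> (g i)) ` {..<m})"
    unfolding cn_span_def by blast
  ultimately show ?thesis
    by (rule antisym)
qed

text \<open>The data \<open>s\<close>, \<open>c\<close>, \<open>C\<close> may depend on
  \<open>z\<close>, as geometric bounds are available only at radii above \<open>r\<close>. Once
  \<open>z\<close> is fixed, the whole region \<open>|y| > s\<close> is covered, which contains a
  neighbourhood of \<open>z\<close> and thus allows isolation to be proved.\<close>

theorem cn_quasi_compact_rank_one:
  assumes pert: "\<And>z. r < ereal (cmod z) \<Longrightarrow>
      \<exists>s c C. s < cmod z \<and> rank_one_perturbation T l e s R c C \<and> (\<forall>y. s < cmod y \<longrightarrow> R y ` S \<subseteq> S)"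
    and TS: "\<And>a. a \<in> S \<Longrightarrow> T a \<in> S" and eS: "e \<in> S"
    and A: "\<And>a. a \<in> S \<Longrightarrow> A (\<Phi> a) = \<Phi> (T a + l a *\<^sub>C e)"
  shows "cn_quasi_compact V A r"
  unfolding cn_quasi_compact_def
proof (intro ballI impI)
  fix z assume z_spec: "z \<in> cn_spectrum V A" and "r < ereal (cmod z)"
  from pert[OF this(2)] obtain s c C where z: "s < cmod z"
    and "rank_one_perturbation T l e s R c C" and RS': "\<forall>y. s < cmod y \<longrightarrow> R y ` S \<subseteq> S"
    by blast
  then interpret rank_one_perturbation T l e s R c C
    by simp
  have RS: "R y a \<in> S" if "s < cmod y" "a \<in> S" for y a
    using RS' that by blast
  have shiftS: "shifted y a \<in> S" and shift: "cn_shifted V A y (\<Phi> a) = \<Phi> (shifted y a)" if "a \<in> S" for y a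
  proof -
    have P: "pert a \<in> S"
      using that by (simp add: pert_def TS S_add S_scaleC eS)
    have *: "shifted y a = y *\<^sub>C a + (- 1) *\<^sub>C pert a"
      by (simp add: shifted_def scaleC_minus_left)
    show "shifted y a \<in> S"
      unfolding * using that P by (intro S_add S_scaleC)
    show "cn_shifted V A y (\<Phi> a) = \<Phi> (shifted y a)"
      unfolding * using that P
      by (simp add: cn_shifted_def vminus_def A pert_def[symmetric] Phi_add Phi_scaleC S_scaleC)
  qed
  \<comment> \<open>Read contrapositively: outside radius \<open>s\<close> the spectrum lies in the
    zero set of \<open>1 - l (R y e)\<close>.\<close>
  have regular: "y \<notin> cn_spectrum V A" if y: "s < cmod y" "l (R y e) \<noteq> 1" for y
  proof -
    have res: "resolvent y a \<in> S" if "a \<in> S" for a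
      using that y by (simp add: resolvent_def RS S_add S_scaleC eS)
    have "cn_bounded_op V (lift (resolvent y))"
      by (rule cn_bounded_op_lift[OF bounded_clinear_resolvent[OF y(1)] res])
    moreover have "lift (resolvent y) (cn_shifted V A y v) = v \<and> cn_shifted V A y (lift (resolvent y) v) = v"
      if v: "v \<in> carr V" for v
    proof -
      obtain a where "a \<in> S" "v = \<Phi> a"
        using v by (rule carrE)
      then show ?thesis
        by (simp add: shift shiftS res resolvent_shifted[OF y])
    qed
    ultimately show ?thesis
      by (auto simp: cn_spectrum_def)
  qed
  have root: "l (R z e) = 1"
    using regular[OF z] z_spec by blast
  have genS: "(R z ^^ i) e \<in> S" for i
    by (induction i) (simp_all add: RS[OF z] eS)
  show "z isolated_in cn_spectrum V A \<and> cn_eigenvalue V A z \<and> cn_finite_dim V (cn_gen_eigenspace V A z)"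
  proof (intro conjI)
    have "\<forall>\<^sub>F y in at z. s < cmod y"
      by (rule order_tendstoD(1)[OF tendsto_norm[OF tendsto_ident_at] z])
    then have "\<forall>\<^sub>F y in at z. y \<notin> cn_spectrum V A"
      using eventually_l_R_neq_1[OF z] by eventually_elim (rule regular)
    then obtain U where "open U" "z \<in> U" "\<And>y. y \<in> U \<Longrightarrow> y \<noteq> z \<Longrightarrow> y \<notin> cn_spectrum V A"
      by (auto simp: eventually_at_topological)
    then show "z isolated_in cn_spectrum V A"
      using z_spec by (auto simp: isolated_in_def intro!: exI[of _ U])
  next
    have "pert ((R z ^^ 1) e) = z *\<^sub>C (R z ^^ 1) e"
      using gen_one_eigen(1)[OF z root] by (simp add: shifted_def)
    then have "A (\<Phi> ((R z ^^ 1) e)) = vscale V z (\<Phi> ((R z ^^ 1) e))"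
      using A[OF genS, of 1] Phi_scaleC[OF genS, of z 1] by (simp add: pert_def)
    moreover have "\<Phi> ((R z ^^ 1) e) \<noteq> vzero V"
      using gen_one_eigen(2)[OF z root] Phi_eq_iff[OF genS S_zero, of 1] by (simp add: Phi_zero)
    ultimately show "cn_eigenvalue V A z"
      unfolding cn_eigenvalue_def by (meson Phi_in genS)
  next
    obtain m where m: "{a. \<exists>k. (shifted z ^^ k) a = 0} = range (\<lambda>w. \<Sum>i<m. w i *\<^sub>C (R z ^^ Suc i) e)"
      by (rule gen_eigenspace_eq[OF z root])
    have pow: "(shifted z ^^ k) a \<in> S \<and> (cn_shifted V A z ^^ k) (\<Phi> a) = \<Phi> ((shifted z ^^ k) a)"
      if "a \<in> S" for k a
      by (induction k) (simp_all add: that shift shiftS)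
    have "cn_gen_eigenspace V A z = \<Phi> ` {a \<in> S. \<exists>k. (shifted z ^^ k) a = 0}"
    proof (intro equalityI subsetI)
      fix v assume "v \<in> cn_gen_eigenspace V A z"
      then obtain a k where "a \<in> S" "v = \<Phi> a" "(cn_shifted V A z ^^ k) (\<Phi> a) = \<Phi> 0"
        by (auto simp: cn_gen_eigenspace_def Phi_zero elim!: carrE)
      then show "v \<in> \<Phi> ` {a \<in> S. \<exists>k. (shifted z ^^ k) a = 0}"
        using pow[of a k] Phi_eq_iff[OF _ S_zero] by auto
    next
      fix v assume "v \<in> \<Phi> ` {a \<in> S. \<exists>k. (shifted z ^^ k) a = 0}"
      then obtain a k where "a \<in> S" "v = \<Phi> a" "(shifted z ^^ k) a = 0"
        by auto
      then show "v \<in> cn_gen_eigenspace V A z"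
        using pow[of a k] by (auto simp: cn_gen_eigenspace_def Phi_zero intro!: exI[of _ k])
    qed
    \<comment> \<open>The spanning vectors \<open>(R z ^^ Suc i) e\<close> lie in \<open>S\<close>,
      so restricting to \<open>S\<close> loses none of the generalized eigenvectors.\<close>
    also have "{a \<in> S. \<exists>k. (shifted z ^^ k) a = 0} = {a. \<exists>k. (shifted z ^^ k) a = 0}"
    proof -
      have "(\<Sum>i<m. w i *\<^sub>C (R z ^^ Suc i) e) \<in> S" for w
        by (intro S_sum S_scaleC genS)
      then have "{a. \<exists>k. (shifted z ^^ k) a = 0} \<subseteq> S"
        unfolding m by auto
      then show ?thesis
        by blast
    qed
    also have "\<Phi> ` \<dots> = cn_span V ((\<lambda>i. \<Phi> ((R z ^^ Suc i) e)) ` {..<m})"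
      unfolding m by (rule cn_span_Phi[OF genS, symmetric])
    finally show "cn_finite_dim V (cn_gen_eigenspace V A z)"
      unfolding cn_finite_dim_def
      by (intro exI[of _ "(\<lambda>i. \<Phi> ((R z ^^ Suc i) e)) ` {..<m}"])
        (use genS in \<open>auto simp del: funpow.simps\<close>)
  qed
qed

end

section \<open>The symbolic space\<close>

interpretation lex: linorder lex_le "less_fun :: symseq \<Rightarrow> symseq \<Rightarrow> bool"
proof
  fix x y z :: symseq
  show "less_fun x y \<longleftrightarrow> lex_le x y \<and> \<not> lex_le y x"
    using less_fun_asym less_fun_irrefl by (auto simp: lex_le_def)
  show "lex_le x x"
    by (simp add: lex_le_def)
  show "lex_le x y \<Longrightarrow> lex_le y z \<Longrightarrow> lex_le x z"
    using less_fun_trans by (auto simp: lex_le_def)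
  show "lex_le x y \<Longrightarrow> lex_le y x \<Longrightarrow> x = y"
    using less_fun_asym by (auto simp: lex_le_def)
  show "lex_le x y \<or> lex_le y x"
  proof (cases "x = y")
    case False
    define k where "k = (LEAST k. x k \<noteq> y k)"
    have "x k \<noteq> y k"
      unfolding k_def by (rule LeastI_ex) (use False in auto)
    moreover have "x i = y i" if "i < k" for i
      using not_less_Least[of i "\<lambda>k. x k \<noteq> y k"] that by (auto simp: k_def)
    ultimately show ?thesis
      by (cases "x k < y k") (auto simp: lex_le_def less_fun_def intro!: exI[of _ k])
  qed (simp add: lex_le_def)
qed

lemma less_fun_first_diff:
  fixes x y :: symseq
  assumes "x k < y k" "\<And>i. i < k \<Longrightarrow> x i = y i"
  shows "less_fun x y"
  using assms by (auto simp: less_fun_def)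

lemma shift_pow: "(shift ^^ n) x = (\<lambda>k. x (k + n))"
  by (induction n) (auto simp: shift_def fun_eq_iff)

lemma beta_shift_iff:
  "x \<in> beta_shift \<beta> \<longleftrightarrow> (\<forall>n. x n \<le> 1) \<and> (\<forall>n. lex_le (\<lambda>k. x (k + n)) (seq_one \<beta>))"
proof -
  have "range x \<subseteq> {0, 1} \<longleftrightarrow> (\<forall>n. x n \<le> 1)"
    by (auto simp: le_Suc_eq image_subset_iff simp del: not_gr_zero)
  then show ?thesis
    by (simp add: beta_shift_def shift_pow)
qed

lemma seq_zero_le: "lex_le seq_zero x"
proof -
  have "\<not> less_fun x seq_zero"
    by (auto simp: less_fun_def seq_zero_def)
  then show ?thesis
    by (simp add: lex.not_less)
qed

locale beta_base =
  fixes \<beta> :: real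
  assumes beta_gt: "1 < \<beta>" and beta_le: "\<beta> \<le> 2"
begin

abbreviation X :: "symseq set" where
  "X \<equiv> beta_shift \<beta>"

abbreviation \<omega> :: symseq where
  "\<omega> \<equiv> seq_one \<beta>"

subsection \<open>The quasi-greedy expansion of 1\<close>

text \<open>The left-continuous version of \<open>beta_map\<close>; its digits are the quasi-greedy ones.\<close>

definition qg_map :: "real \<Rightarrow> real" where
  "qg_map v = \<beta> * v - of_int \<lceil>\<beta> * v\<rceil> + 1"

definition qg_digits :: "real \<Rightarrow> symseq" where
  "qg_digits v n = nat (\<lceil>\<beta> * (qg_map ^^ n) v\<rceil> - 1)"

lemma qg_map_range: "0 < qg_map v" "qg_map v \<le> 1"
  unfolding qg_map_def by linarith+

lemma qg_orbit_range:
  assumes "0 < v" "v \<le> 1"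
  shows "0 < (qg_map ^^ n) v" "(qg_map ^^ n) v \<le> 1"
  using assms qg_map_range by (cases n; simp)+

lemma qg_ceiling:
  assumes "0 < v" "v \<le> 1"
  shows "\<lceil>\<beta> * v\<rceil> \<in> {1, 2}"
proof -
  have "0 < \<beta> * v" "\<beta> * v \<le> 2"
    using assms beta_gt beta_le mult_mono[of \<beta> 2 v 1] by auto
  then have "0 < \<lceil>\<beta> * v\<rceil>" "\<lceil>\<beta> * v\<rceil> \<le> 2"
    by (simp_all add: ceiling_le_iff)
  then have "\<lceil>\<beta> * v\<rceil> = 1 \<or> \<lceil>\<beta> * v\<rceil> = 2"
    by linarith
  then show ?thesis
    by simp
qed

lemma qg_digits_range:
  assumes "0 < v" "v \<le> 1"
  shows "qg_digits v n \<in> {0, 1}"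
proof -
  have "\<lceil>\<beta> * (qg_map ^^ n) v\<rceil> = 1 \<or> \<lceil>\<beta> * (qg_map ^^ n) v\<rceil> = 2"
    using qg_ceiling[OF qg_orbit_range[OF assms], of n] by blast
  then have "nat (\<lceil>\<beta> * (qg_map ^^ n) v\<rceil> - 1) = nat (1 - 1) \<or> nat (\<lceil>\<beta> * (qg_map ^^ n) v\<rceil> - 1) = nat (2 - 1)"
    by metis
  then show ?thesis
    unfolding qg_digits_def by simp
qed

lemma qg_step:
  assumes "0 < v" "v \<le> 1"
  shows "\<beta> * (qg_map ^^ n) v = real (qg_digits v n) + (qg_map ^^ Suc n) v"
proof -
  have "0 \<le> \<lceil>\<beta> * (qg_map ^^ n) v\<rceil> - 1"
    using qg_orbit_range[OF assms, of n] beta_gt by simp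
  then have "real (nat (\<lceil>\<beta> * (qg_map ^^ n) v\<rceil> - 1)) = real_of_int (\<lceil>\<beta> * (qg_map ^^ n) v\<rceil> - 1)"
    by (rule of_nat_nat)
  then show ?thesis
    by (simp add: qg_digits_def qg_map_def)
qed

text \<open>From the left \<open>\<beta> * y\<close> stays strictly below
  \<open>\<beta> * v\<close>, so even at an integer value of \<open>\<beta> * v\<close> the floor is
  one less. This is where greedy digits turn into quasi-greedy ones.\<close>

lemma eventually_floor_left:
  "\<forall>\<^sub>F y in at_left v. \<lfloor>\<beta> * y\<rfloor> = \<lceil>\<beta> * v\<rceil> - 1"
proof -
  define u where "u = (of_int \<lceil>\<beta> * v\<rceil> - 1) / \<beta>"
  have "u < v"
    unfolding u_def using beta_gt by (simp add: pos_divide_less_eq) (use ceiling_correct[of "\<beta> * v"] in \<open>simp add: mult.commute\<close>)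
  then have "\<forall>\<^sub>F y in at_left v. y \<in> {u<..<v}"
    by (rule eventually_at_left_real)
  then show ?thesis
  proof (rule eventually_mono)
    fix y assume "y \<in> {u<..<v}"
    then have "of_int \<lceil>\<beta> * v\<rceil> - 1 < \<beta> * y" "\<beta> * y < \<beta> * v"
      using beta_gt by (auto simp: u_def pos_divide_less_eq mult.commute)
    then show "\<lfloor>\<beta> * y\<rfloor> = \<lceil>\<beta> * v\<rceil> - 1"
      using le_of_int_ceiling[of "\<beta> * v"] by (intro floor_unique) (simp, linarith)
  qed
qed

text \<open>On the relevant piece the map is affine with positive slope. The image therefore again
  approaches strictly from the left, which is what permits iteration along the orbit.\<close>

lemma filterlim_beta_map_left: "filterlim (beta_map \<beta>) (at_left (qg_map v)) (at_left v)"
  unfolding filterlim_at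
proof (intro conjI)
  have ev: "\<forall>\<^sub>F y in at_left v. beta_map \<beta> y = \<beta> * y - (of_int \<lceil>\<beta> * v\<rceil> - 1)"
    using eventually_floor_left by (rule eventually_mono) (simp add: beta_map_def)
  have "((\<lambda>y. \<beta> * y - (of_int \<lceil>\<beta> * v\<rceil> - 1)) \<longlongrightarrow> \<beta> * v - (of_int \<lceil>\<beta> * v\<rceil> - 1)) (at_left v)"
    by (intro tendsto_intros)
  then show "(beta_map \<beta> \<longlongrightarrow> qg_map v) (at_left v)"
    using tendsto_cong[OF ev] by (simp add: qg_map_def algebra_simps)
  have "\<forall>\<^sub>F y in at_left v. y < v"
    by (auto simp: eventually_at_filter)
  with ev show "\<forall>\<^sub>F y in at_left v. beta_map \<beta> y \<in> {..<qg_map v} \<and> beta_map \<beta> y \<noteq> qg_map v"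
    by eventually_elim (use beta_gt in \<open>auto simp: qg_map_def\<close>)
qed

lemma seq_one_eq: "\<omega> = qg_digits 1"
proof
  fix n
  have orbit: "filterlim (beta_map \<beta> ^^ n) (at_left ((qg_map ^^ n) 1)) (at_left 1)"
  proof (induction n)
    case 0
    then show ?case
      by (simp add: filterlim_ident)
  next
    case (Suc n)
    from filterlim_compose[OF filterlim_beta_map_left Suc] show ?case
      by simp
  qed
  have "\<forall>\<^sub>F y in at_left 1. \<lfloor>\<beta> * (beta_map \<beta> ^^ n) y\<rfloor> = \<lceil>\<beta> * (qg_map ^^ n) 1\<rceil> - 1"
    using eventually_floor_left orbit unfolding filterlim_iff by blast
  then have "\<forall>\<^sub>F y in at_left 1. greedy_digits \<beta> y n = qg_digits 1 n"
    by (rule eventually_mono) (simp add: greedy_digits_def qg_digits_def)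
  then have "((\<lambda>y. greedy_digits \<beta> y n) \<longlongrightarrow> qg_digits 1 n) (at_left 1)"
    by (rule tendsto_eventually)
  then show "\<omega> n = qg_digits 1 n"
    unfolding seq_one_def by (rule tendsto_Lim[rotated]) simp
qed

lemma seq_one_range: "\<omega> n \<le> 1"
  using qg_digits_range[of 1 n] by (auto simp: seq_one_eq)

lemma seq_one_first: "\<omega> 0 = 1"
proof -
  have "\<lceil>\<beta>\<rceil> = 2"
    using beta_gt beta_le by (simp add: ceiling_eq_iff)
  then show ?thesis
    by (simp add: seq_one_eq qg_digits_def)
qed

text \<open>After the last one, \<open>qg_map\<close> would act as multiplication by
  \<open>\<beta> > 1\<close>, and a positive orbit point would eventually leave the interval up to
  1.\<close>

lemma seq_one_infinitely_many_ones: "\<exists>k\<ge>n. \<omega> k > 0"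
proof (rule ccontr)
  assume "\<not> ?thesis"
  then have 0: "qg_digits 1 k = 0" if "k \<ge> n" for k
    using that by (simp add: seq_one_eq)
  have "(qg_map ^^ (n + j)) 1 = \<beta> ^ j * (qg_map ^^ n) 1" for j
  proof (induction j)
    case (Suc j)
    then show ?case
      using qg_step[of 1 "n + j"] 0[of "n + j"] by simp
  qed simp
  then have "\<beta> ^ j * (qg_map ^^ n) 1 \<le> 1" for j
    using qg_orbit_range(2)[of 1 "n + j"] by simp
  moreover obtain j where "1 / (qg_map ^^ n) 1 < \<beta> ^ j"
    using real_arch_pow[OF beta_gt] by blast
  then have "1 < \<beta> ^ j * (qg_map ^^ n) 1"
    using qg_orbit_range(1)[of 1 n] by (simp only: pos_divide_less_eq zero_less_one order_refl)
  ultimately show False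
    by (meson not_le)
qed

text \<open>While the digits agree, both orbits are moved by the same increasing affine map, so at
  the first difference the larger point has the larger digit.\<close>

lemma qg_digits_mono:
  assumes "0 < v" "v \<le> w" "w \<le> 1"
  shows "lex_le (qg_digits v) (qg_digits w)"
proof (rule ccontr)
  assume "\<not> ?thesis"
  then have "less_fun (qg_digits w) (qg_digits v)"
    by (simp add: lex.not_le)
  then obtain k where k: "qg_digits w k < qg_digits v k" "\<And>i. i < k \<Longrightarrow> qg_digits w i = qg_digits v i"
    by (rule less_funE) blast
  have "(qg_map ^^ i) v \<le> (qg_map ^^ i) w" if "i \<le> k" for i
    using that
  proof (induction i)
    case (Suc i)
    then have "\<beta> * (qg_map ^^ i) v \<le> \<beta> * (qg_map ^^ i) w"
      using beta_gt by simp
    then show ?case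
      using qg_step[of v i] qg_step[of w i] k(2)[of i] assms Suc.prems by simp
  qed (use assms in simp)
  then have "\<beta> * (qg_map ^^ k) v \<le> \<beta> * (qg_map ^^ k) w"
    using beta_gt by simp
  then have "qg_digits v k \<le> qg_digits w k"
    unfolding qg_digits_def by (intro nat_mono diff_right_mono ceiling_mono)
  with k(1) show False
    by simp
qed

text \<open>A suffix of \<open>\<omega>\<close> is the quasi-greedy expansion of an orbit point,
  which is at most 1.\<close>

lemma seq_one_in: "\<omega> \<in> X"
  unfolding beta_shift_iff
proof (intro conjI allI)
  fix n
  show "\<omega> n \<le> 1"
    by (rule seq_one_range)
  have "(\<lambda>k. \<omega> (k + n)) = qg_digits ((qg_map ^^ n) 1)"
    by (simp add: seq_one_eq qg_digits_def fun_eq_iff funpow_add)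
  then show "lex_le (\<lambda>k. \<omega> (k + n)) \<omega>"
    unfolding seq_one_eq using qg_orbit_range[of 1 n] by (simp add: qg_digits_mono)
qed

subsection \<open>Admissible sequences\<close>

lemma range_X: "x \<in> X \<Longrightarrow> x n \<le> 1"
  by (simp add: beta_shift_iff)

lemma shift_in_X: "x \<in> X \<Longrightarrow> shift x \<in> X"
  unfolding beta_shift_iff by (auto simp: shift_def simp flip: add_Suc_right)

lemma shift_pow_in_X: "x \<in> X \<Longrightarrow> (shift ^^ n) x \<in> X"
  by (induction n) (simp_all add: shift_in_X)

lemma le_seq_one: "x \<in> X \<Longrightarrow> lex_le x \<omega>"
  using beta_shift_iff[of x] by (auto dest!: spec[of _ 0])

lemma in_X_I:
  assumes "\<And>n. x n \<le> 1" "\<And>n. lex_le (\<lambda>k. x (k + n)) \<omega>"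
  shows "x \<in> X"
  using assms by (simp add: beta_shift_iff)

lemma less_seq_one: "x 0 = 0 \<Longrightarrow> less_fun x \<omega>"
  by (rule less_fun_first_diff[where k = 0]) (simp_all add: seq_one_first)

lemma seq_zero_in: "seq_zero \<in> X"
  by (rule in_X_I) (auto simp: seq_zero_def intro!: lex.less_imp_le less_seq_one)

lemma cons_zero_in_X: "x \<in> X \<Longrightarrow> case_nat 0 x \<in> X"
proof (rule in_X_I)
  assume x: "x \<in> X"
  fix n
  show "case_nat 0 x n \<le> 1"
    using range_X[OF x] by (auto split: nat.splits)
  show "lex_le (\<lambda>k. case_nat 0 x (k + n)) \<omega>"
  proof (cases n)
    case 0
    then show ?thesis
      by (intro lex.less_imp_le less_seq_one) simp
  next
    case (Suc m)
    then show ?thesis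
      using x by (simp add: beta_shift_iff)
  qed
qed

text \<open>Closedness in the product topology: a violated lexicographic inequality is already
  visible on finitely many digits.\<close>

lemma X_closed:
  assumes "\<And>n. \<exists>y\<in>X. \<forall>i<n. y i = x i"
  shows "x \<in> X"
proof (rule in_X_I)
  show "x n \<le> 1" for n
    using assms[of "Suc n"] range_X by (metis lessI)
  show "lex_le (\<lambda>k. x (k + n)) \<omega>" for n
  proof (rule ccontr)
    assume "\<not> ?thesis"
    then have "less_fun \<omega> (\<lambda>k. x (k + n))"
      by (simp add: lex.not_le)
    then obtain k where k: "\<omega> k < x (k + n)" "\<And>i. i < k \<Longrightarrow> \<omega> i = x (i + n)"
      by (rule less_funE) blast
    obtain y where y: "y \<in> X" "\<And>i. i < Suc (k + n) \<Longrightarrow> y i = x i"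
      using assms[of "Suc (k + n)"] by blast
    have "less_fun \<omega> (\<lambda>k. y (k + n))"
      by (rule less_fun_first_diff[of _ k]) (use k y(2) in auto)
    with y(1) show False
      by (metis beta_shift_iff lex.leD)
  qed
qed

text \<open>Modulo countable sets, every uncountable initial segment of the beta-shift is the one below a
  unique point of \<open>P\<close>.\<close>

definition P :: "symseq set" where
  "P = {x \<in> X. \<forall>n. \<exists>k\<ge>n. x k > 0}"

lemma P_subset: "x \<in> P \<Longrightarrow> x \<in> X"
  by (simp add: P_def)

lemma seq_one_in_P: "\<omega> \<in> P"
  by (simp add: P_def seq_one_in seq_one_infinitely_many_ones)

lemma shift_in_P: "x \<in> P \<Longrightarrow> shift x \<in> P"
proof -
  assume x: "x \<in> P"
  have "\<exists>k\<ge>n. shift x k > 0" for n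
  proof -
    obtain k where "k \<ge> Suc n" "x k > 0"
      using x by (auto simp: P_def)
    then show ?thesis
      by (intro exI[of _ "k - 1"]) (auto simp: shift_def)
  qed
  with x show ?thesis
    by (simp add: P_def shift_in_X)
qed

text \<open>Ones are allowed only at multiples of \<open>Suc K\<close>, where
  \<open>\<omega> K > 0\<close>. Each of them is followed by \<open>K\<close> zeros, so a suffix
  starting with 1 drops below \<open>\<omega>\<close> at the second one of \<open>\<omega>\<close>,
  at position \<open>K\<close> or earlier. The subsets of \<open>nat\<close> are thereby embedded
  into \<open>X\<close>.\<close>

lemma uncountable_X: "uncountable X"
proof
  assume "countable X"
  obtain K where K: "K \<ge> 1" "\<omega> K > 0"
    using seq_one_infinitely_many_ones by blast
  define x :: "nat set \<Rightarrow> symseq" where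
    "x A n = (if Suc K dvd n \<and> n div Suc K \<in> A then 1 else 0)" for A n
  have "x A \<in> X" for A
  proof (rule in_X_I)
    fix n
    show "x A n \<le> 1"
      by (simp add: x_def)
    show "lex_le (\<lambda>k. x A (k + n)) \<omega>"
    proof (cases "x A n = 0")
      case True
      then show ?thesis
        by (intro lex.less_imp_le less_seq_one) simp
    next
      case False
      then have n: "x A n = 1" "Suc K dvd n"
        by (auto simp: x_def split: if_splits)
      have gap: "x A (k + n) = 0" if "1 \<le> k" "k \<le> K" for k
        using that n(2) by (auto simp: x_def dvd_add_left_iff dest: dvd_imp_le)
      define k where "k = (LEAST k. k \<ge> 1 \<and> \<omega> k > 0)"
      have k: "k \<ge> 1" "\<omega> k > 0" "k \<le> K"
        using LeastI[of "\<lambda>k. k \<ge> 1 \<and> \<omega> k > 0" K] Least_le[of "\<lambda>k. k \<ge> 1 \<and> \<omega> k > 0" K] K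
        by (auto simp: k_def)
      have "less_fun (\<lambda>k. x A (k + n)) \<omega>"
      proof (rule less_fun_first_diff[of _ k])
        show "x A (k + n) < \<omega> k"
          using gap[of k] k by simp
        show "x A (i + n) = \<omega> i" if "i < k" for i
          using not_less_Least[of i "\<lambda>k. k \<ge> 1 \<and> \<omega> k > 0"] that gap[of i] k(3) n(1) seq_one_first
          by (cases "i = 0") (auto simp: k_def)
      qed
      then show ?thesis
        by (rule lex.less_imp_le)
    qed
  qed
  moreover have "inj x"
  proof (rule injI)
    fix A B assume "x A = x B"
    then have "x A (Suc K * m) = x B (Suc K * m)" for m
      by simp
    then have "m \<in> A \<longleftrightarrow> m \<in> B" for m
      unfolding x_def by (metis dvd_triv_left nonzero_mult_div_cancel_left nat.distinct(1) zero_neq_one)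
    then show "A = B"
      by blast
  qed
  ultimately have "countable (UNIV :: nat set set)"
    using \<open>countable X\<close> by (meson countable_image_inj_on countable_subset image_subset_iff UNIV_I)
  then obtain f :: "nat \<Rightarrow> nat set" where "surj f"
    by (metis uncountable_def UNIV_not_empty)
  then show False
    using Cantors_theorem[of UNIV] by (metis Pow_UNIV)
qed

text \<open>Follow \<open>b\<close> beyond the place \<open>k\<close> where it exceeds
  \<open>x\<close>, replace a later one, at \<open>j\<close>, by 0, and continue with any point of
  \<open>X\<close>. The change at \<open>j\<close> puts the result below \<open>b\<close>, and
  suffixes starting up to \<open>j\<close> below those of \<open>b\<close>, hence below
  \<open>\<omega>\<close>. The later one exists because \<open>b \<in> P\<close>.\<close>

lemma uncountable_between:
  assumes "x \<in> X" "b \<in> P" "less_fun x b"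
  shows "uncountable {y \<in> X. less_fun x y \<and> less_fun y b}"
proof -
  obtain k where k: "x k < b k" "\<And>i. i < k \<Longrightarrow> x i = b i"
    using assms(3) by (rule less_funE) blast
  obtain j where j: "j > k" "b j > 0"
    using assms(2) by (auto simp: P_def Suc_le_eq dest!: spec[of _ "Suc k"])
  define glue where "glue z i = (if i < j then b i else if i = j then 0 else z (i - Suc j))" for z :: symseq and i
  have bX: "b \<in> X"
    using assms(2) by (rule P_subset)
  have less: "less_fun (\<lambda>k. glue z (k + n)) (\<lambda>k. b (k + n))" if "n \<le> j" for z n
    by (rule less_fun_first_diff[of _ "j - n"]) (use that j in \<open>auto simp: glue_def\<close>)
  have "glue z \<in> X" if "z \<in> X" for z
  proof (rule in_X_I)
    fix n
    show "glue z n \<le> 1"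
      using range_X[OF bX] range_X[OF that] by (simp add: glue_def)
    show "lex_le (\<lambda>k. glue z (k + n)) \<omega>"
    proof (cases "n \<le> j")
      case True
      have "lex_le (\<lambda>k. b (k + n)) \<omega>"
        using bX by (simp add: beta_shift_iff)
      then show ?thesis
        using less[OF True] by (metis lex.less_imp_le lex.order.trans)
    next
      case False
      then have "(\<lambda>k. glue z (k + n)) = (\<lambda>k. z (k + (n - Suc j)))"
        by (auto simp: glue_def fun_eq_iff)
      then show ?thesis
        using that by (simp add: beta_shift_iff)
    qed
  qed
  moreover have "less_fun x (glue z)" for z
    by (rule less_fun_first_diff[of _ k]) (use k j in \<open>auto simp: glue_def\<close>)
  moreover have "less_fun (glue z) b" for z
    using less[of 0] by simp
  ultimately have sub: "glue ` X \<subseteq> {y \<in> X. less_fun x y \<and> less_fun y b}"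
    by auto
  have "inj glue"
  proof (rule injI)
    fix z w assume "glue z = glue w"
    then have "glue z (i + Suc j) = glue w (i + Suc j)" for i
      by simp
    then show "z = w"
      by (simp add: glue_def fun_eq_iff)
  qed
  then have "uncountable (glue ` X)"
    using uncountable_X countable_image_inj_on by (metis inj_on_subset subset_UNIV)
  with sub show ?thesis
    using countable_subset by blast
qed

text \<open>\<open>p\<close> is the essential supremum of \<open>D\<close> modulo countable sets,
  found digit by digit: the digit is 1 whenever uncountably many points of \<open>D\<close> continue
  the prefix with 1. A point of \<open>D\<close> above \<open>p\<close> leaves \<open>p\<close> at a
  digit where only countably many do.\<close>

lemma down_set_almost_segment:
  assumes D: "D \<subseteq> X" "\<forall>x\<in>D. \<forall>y\<in>X. lex_le y x \<longrightarrow> y \<in> D"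
    and "uncountable D"
  obtains p where "p \<in> P" "\<And>x. x \<in> X \<Longrightarrow> less_fun x p \<Longrightarrow> x \<in> D"
    "countable {x \<in> D. less_fun p x}"
proof -
  define E where "E = rec_nat D (\<lambda>n F. if uncountable {y \<in> F. y n = 1} then {y \<in> F. y n = 1} else {y \<in> F. y n = 0})"
  define p :: symseq where "p n = (if uncountable {y \<in> E n. y n = 1} then 1 else 0)" for n
  have E_Suc: "E (Suc n) = {y \<in> E n. y n = p n}" for n
    by (simp add: E_def p_def)
  have E_eq: "E n = {y \<in> D. \<forall>i<n. y i = p i}" for n
  proof (induction n)
    case 0
    then show ?case
      by (simp add: E_def)
  next
    case (Suc n)
    then show ?case
      unfolding E_Suc by (auto simp: less_Suc_eq)
  qed
  have E_unc: "uncountable (E n)" for n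
  proof (induction n)
    case 0
    then show ?case
      using assms(3) by (simp add: E_def)
  next
    case (Suc n)
    show ?case
    proof (cases "p n = 1")
      case True
      then have "uncountable {y \<in> E n. y n = 1}"
        unfolding p_def by (metis zero_neq_one)
      then show ?thesis
        unfolding E_Suc True .
    next
      case False
      then have p: "p n = 0" "countable {y \<in> E n. y n = 1}"
        unfolding p_def by metis+
      have "E n \<subseteq> {y \<in> E n. y n = 1} \<union> E (Suc n)"
        using D(1) range_X[of _ n] by (fastforce simp: E_Suc p(1) E_eq[of n] le_Suc_eq)
      then show ?thesis
        using p(2) Suc by (meson countable_Un countable_subset)
    qed
  qed
  then have E_ne: "\<exists>y. y \<in> E n" for n
    by (metis countable_empty ex_in_conv)
  have "p \<in> X"
  proof (rule X_closed)
    show "\<exists>y\<in>X. \<forall>i<n. y i = p i" for n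
      using E_ne[of n] D(1) by (auto simp: E_eq)
  qed
  have count: "countable {y \<in> E k. y k = 1}" if "p k = 0" for k
    using that unfolding p_def by (metis zero_neq_one)
  have first: "\<exists>k. y \<in> E k \<and> p k \<noteq> y k" if "y \<in> D" "y \<noteq> p" for y
  proof -
    define k where "k = (LEAST k. p k \<noteq> y k)"
    have "p k \<noteq> y k"
      unfolding k_def by (rule LeastI_ex) (use that(2) in auto)
    moreover have "\<forall>i<k. y i = p i"
      unfolding k_def by (metis (mono_tags, lifting) not_less_Least)
    then have "y \<in> E k"
      using that(1) by (simp add: E_eq)
    ultimately show ?thesis
      by blast
  qed
  \<comment> \<open>If only zeros followed, every other point of \<open>E n\<close> would branch off
    upwards into one of countably many countable sets, although \<open>E n\<close> is
    uncountable.\<close>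
  have "\<exists>k\<ge>n. p k > 0" for n
  proof (rule ccontr)
    assume "\<not> ?thesis"
    then have p0: "p k = 0" if "k \<ge> n" for k
      using that by auto
    have "E n \<subseteq> {p} \<union> (\<Union>k\<in>{n..}. {y \<in> E k. y k = 1})"
    proof
      fix y assume y: "y \<in> E n"
      show "y \<in> {p} \<union> (\<Union>k\<in>{n..}. {y \<in> E k. y k = 1})"
      proof (cases "y = p")
        case False
        then obtain k where k: "y \<in> E k" "p k \<noteq> y k"
          using first[of y] y by (auto simp: E_eq)
        have "k \<ge> n"
          using k(2) y by (force simp: E_eq not_le[symmetric])
        moreover have "y k = 1"
          using k(2) p0[OF \<open>k \<ge> n\<close>] range_X[of y k] D(1) y by (auto simp: E_eq le_Suc_eq)
        ultimately show ?thesis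
          using k(1) by auto
      qed simp
    qed
    moreover have "countable ({p} \<union> (\<Union>k\<in>{n..}. {y \<in> E k. y k = 1}))"
      using count p0 by (intro countable_Un countable_UN) auto
    ultimately show False
      using E_unc countable_subset by blast
  qed
  with \<open>p \<in> X\<close> have "p \<in> P"
    by (simp add: P_def)
  moreover have "x \<in> D" if x: "x \<in> X" "less_fun x p" for x
  proof -
    obtain k where k: "x k < p k" "\<And>i. i < k \<Longrightarrow> x i = p i"
      using x(2) by (rule less_funE) blast
    obtain y where y: "y \<in> E (Suc k)"
      using E_ne by blast
    have "less_fun x y"
      by (rule less_fun_first_diff[of _ k]) (use k y in \<open>auto simp: E_eq\<close>)
    then have "lex_le x y"
      by (rule lex.less_imp_le)
    then show ?thesis
      using D(2) y x(1) by (auto simp: E_eq)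
  qed
  moreover have "countable {x \<in> D. less_fun p x}"
  proof (rule countable_subset)
    show "{x \<in> D. less_fun p x} \<subseteq> (\<Union>k\<in>{k. p k = 0}. {y \<in> E k. y k = 1})"
    proof
      fix x assume x: "x \<in> {x \<in> D. less_fun p x}"
      then obtain k where k: "p k < x k" "\<And>i. i < k \<Longrightarrow> p i = x i"
        by (auto elim: less_funE)
      have "x k = 1" "p k = 0"
        using k(1) range_X[of x k] x D(1) by (auto simp: le_Suc_eq)
      moreover have "x \<in> E k"
        using x k(2) by (auto simp: E_eq)
      ultimately show "x \<in> (\<Union>k\<in>{k. p k = 0}. {y \<in> E k. y k = 1})"
        by blast
    qed
    show "countable (\<Union>k\<in>{k. p k = 0}. {y \<in> E k. y k = 1})"
      using count by (intro countable_UN) auto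
  qed
  ultimately show thesis
    by (rule that)
qed

end

section \<open>Functions of bounded variation on the beta-shift\<close>

definition chain_sum :: "symfun \<Rightarrow> nat \<Rightarrow> (nat \<Rightarrow> symseq) \<Rightarrow> real" where
  "chain_sum f n c = (\<Sum>i<n. cmod (f (c (Suc i)) - f (c i)))"

context beta_base
begin

text \<open>Weak inequalities and free endpoints, unlike in \<open>variation_sums\<close>: such
  chains are preserved by the monotone inverse branches of the shift and may contain repetitions.
  Repetitions contribute nothing, and adding the two extreme points can only increase the
  sum.\<close>

definition mono_chain :: "nat \<Rightarrow> (nat \<Rightarrow> symseq) \<Rightarrow> bool" where
  "mono_chain n c \<longleftrightarrow> (\<forall>i\<le>n. c i \<in> X) \<and> (\<forall>i<n. lex_le (c i) (c (Suc i)))"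

lemma mono_chain_snoc:
  assumes "mono_chain n c" "y \<in> X" "lex_le (c n) y"
  shows "mono_chain (Suc n) (c(Suc n := y))"
  using assms by (auto simp: mono_chain_def less_Suc_eq le_Suc_eq)

lemma chain_sum_snoc:
  "chain_sum f (Suc n) (c(Suc n := y)) = chain_sum f n c + cmod (f y - f (c n))"
  by (simp add: chain_sum_def)

lemma strict_chain:
  assumes "mono_chain n c"
  shows "\<exists>m d. (\<forall>i\<le>m. d i \<in> X) \<and> d 0 = c 0 \<and> d m = c n \<and>
    (\<forall>i<m. less_fun (d i) (d (Suc i))) \<and> chain_sum f m d = chain_sum f n c"
  using assms
proof (induction n)
  case 0
  then show ?case
    by (intro exI[of _ 0] exI[of _ c]) (simp add: mono_chain_def)
next
  case (Suc n)
  then have "mono_chain n c" and le: "lex_le (c n) (c (Suc n))" and cX: "c (Suc n) \<in> X"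
    by (auto simp: mono_chain_def)
  with Suc.IH obtain m d where md: "\<forall>i\<le>m. d i \<in> X" "d 0 = c 0" "d m = c n"
    "\<forall>i<m. less_fun (d i) (d (Suc i))" "chain_sum f m d = chain_sum f n c"
    by blast
  show ?case
  proof (cases "c n = c (Suc n)")
    case True
    then show ?thesis
      using md by (intro exI[of _ m] exI[of _ d]) (simp add: chain_sum_def)
  next
    case False
    with le have "less_fun (c n) (c (Suc n))"
      by (simp add: lex_le_def)
    then show ?thesis
      using md cX
      by (intro exI[of _ "Suc m"] exI[of _ "d(Suc m := c (Suc n))"])
        (auto simp: chain_sum_snoc less_Suc_eq le_Suc_eq, simp add: chain_sum_def)
  qed
qed

lemma seq_zero_less_seq_one: "less_fun seq_zero \<omega>"
  by (rule less_seq_one) (simp add: seq_zero_def)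

lemma chain_sum_le_variation:
  assumes f: "f \<in> BV_funs \<beta>" and c: "mono_chain n c"
  shows "chain_sum f n c \<le> variation \<beta> f"
proof -
  define d where "d = (case_nat seq_zero c)(Suc (Suc n) := \<omega>)"
  have "mono_chain (Suc n) (case_nat seq_zero c)"
    using c seq_zero_in seq_zero_le by (auto simp: mono_chain_def split: nat.split)
  then have d: "mono_chain (Suc (Suc n)) d"
    unfolding d_def
    by (rule mono_chain_snoc) (use c in \<open>auto simp: seq_one_in mono_chain_def intro: le_seq_one\<close>)
  have "chain_sum f n c \<le> chain_sum f (Suc n) (case_nat seq_zero c)"
    unfolding chain_sum_def by (subst sum.lessThan_Suc_shift) simp
  also have "\<dots> \<le> chain_sum f (Suc (Suc n)) d"
    unfolding d_def chain_sum_snoc by simp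
  also have "\<dots> \<le> variation \<beta> f"
  proof -
    obtain m e where "\<forall>i\<le>m. e i \<in> X" "e 0 = seq_zero" "e m = \<omega>"
      "\<forall>i<m. less_fun (e i) (e (Suc i))" "chain_sum f m e = chain_sum f (Suc (Suc n)) d"
      using strict_chain[OF d, of f] by (auto simp: d_def)
    then have "chain_sum f (Suc (Suc n)) d \<in> variation_sums \<beta> f"
      unfolding variation_sums_def chain_sum_def by (auto intro!: exI[of _ m] exI[of _ e])
    then show ?thesis
      unfolding variation_def using f by (intro cSup_upper) (auto simp: BV_funs_def)
  qed
  finally show ?thesis .
qed

lemma BV_I:
  assumes "\<And>n c. mono_chain n c \<Longrightarrow> chain_sum f n c \<le> B"
  shows "f \<in> BV_funs \<beta>" "variation \<beta> f \<le> B"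
proof -
  have le: "s \<le> B" if "s \<in> variation_sums \<beta> f" for s
    using that assms
    by (fastforce simp: variation_sums_def chain_sum_def mono_chain_def lex.less_imp_le)
  then show "f \<in> BV_funs \<beta>"
    by (auto simp: BV_funs_def bdd_above_def)
  have "(\<Sum>i<1. cmod (f ((\<lambda>i. if i = 0 then seq_zero else \<omega>) (Suc i)) - f ((\<lambda>i. if i = 0 then seq_zero else \<omega>) i)))
      \<in> variation_sums \<beta> f"
    unfolding variation_sums_def
    by (rule CollectI, rule exI[of _ "1::nat"], rule exI[of _ "\<lambda>i. if i = 0 then seq_zero else \<omega>"])
      (auto simp: seq_zero_in seq_one_in seq_zero_less_seq_one)
  then have "variation_sums \<beta> f \<noteq> {}"
    by blast
  then show "variation \<beta> f \<le> B"
    unfolding variation_def using le by (rule cSup_least)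
qed

lemma chain_sum_cong:
  assumes "\<And>x. x \<in> X \<Longrightarrow> f x = g x" "mono_chain n c"
  shows "chain_sum f n c = chain_sum g n c"
  using assms by (auto simp: chain_sum_def mono_chain_def intro!: sum.cong)

lemma variation_nonneg: "f \<in> BV_funs \<beta> \<Longrightarrow> 0 \<le> variation \<beta> f"
  using chain_sum_le_variation[of f 0 "\<lambda>_. \<omega>"] seq_one_in by (simp add: mono_chain_def chain_sum_def)

lemma BV_bounded:
  assumes "f \<in> BV_funs \<beta>" "x \<in> X"
  shows "cmod (f x) \<le> cmod (f \<omega>) + variation \<beta> f"
proof -
  have "chain_sum f 1 (\<lambda>i. if i = 0 then x else \<omega>) \<le> variation \<beta> f"
    by (rule chain_sum_le_variation[OF assms(1)])
      (use assms(2) in \<open>auto simp: mono_chain_def seq_one_in le_seq_one\<close>)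
  then have "cmod (f \<omega> - f x) \<le> variation \<beta> f"
    by (simp add: chain_sum_def)
  then show ?thesis
    using norm_triangle_sub[of "f x" "f \<omega>"] by (simp add: norm_minus_commute)
qed

lemma le_sup_norm:
  assumes "f \<in> BV_funs \<beta>" "x \<in> X"
  shows "cmod (f x) \<le> sup_norm \<beta> f"
  unfolding sup_norm_def
  by (rule cSUP_upper[OF assms(2)]) (use BV_bounded[OF assms(1)] in \<open>auto simp: bdd_above_def\<close>)

lemma sup_norm_le:
  assumes "\<And>x. x \<in> X \<Longrightarrow> cmod (f x) \<le> B"
  shows "sup_norm \<beta> f \<le> B"
  unfolding sup_norm_def by (rule cSUP_least) (use assms seq_one_in in auto)

lemma BV_norm_nonneg: "f \<in> BV_funs \<beta> \<Longrightarrow> 0 \<le> BV_norm \<beta> f"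
  using le_sup_norm[OF _ seq_one_in, of f] variation_nonneg[of f]
  by (auto simp: BV_norm_def intro: order_trans[OF norm_ge_zero] add_nonneg_nonneg)

lemma BV_add:
  assumes "f \<in> BV_funs \<beta>" "g \<in> BV_funs \<beta>"
  shows "(\<lambda>x. f x + g x) \<in> BV_funs \<beta>" "BV_norm \<beta> (\<lambda>x. f x + g x) \<le> BV_norm \<beta> f + BV_norm \<beta> g"
proof -
  have le: "chain_sum (\<lambda>x. f x + g x) n c \<le> variation \<beta> f + variation \<beta> g" if "mono_chain n c" for n c
  proof -
    have "chain_sum (\<lambda>x. f x + g x) n c \<le> chain_sum f n c + chain_sum g n c"
      unfolding chain_sum_def sum.distrib[symmetric]
      by (rule sum_mono) (metis add_diff_add norm_triangle_ineq)
    then show ?thesis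
      using chain_sum_le_variation[OF assms(1) that] chain_sum_le_variation[OF assms(2) that] by simp
  qed
  show "(\<lambda>x. f x + g x) \<in> BV_funs \<beta>"
    by (rule BV_I[OF le])
  have "cmod (f x + g x) \<le> sup_norm \<beta> f + sup_norm \<beta> g" if "x \<in> X" for x
    using le_sup_norm[OF assms(1) that] le_sup_norm[OF assms(2) that] norm_triangle_ineq[of "f x" "g x"]
    by simp
  then show "BV_norm \<beta> (\<lambda>x. f x + g x) \<le> BV_norm \<beta> f + BV_norm \<beta> g"
    using sup_norm_le[of "\<lambda>x. f x + g x"] BV_I(2)[OF le] by (fastforce simp: BV_norm_def)
qed

lemma BV_scale:
  assumes "f \<in> BV_funs \<beta>"
  shows "(\<lambda>x. z * f x) \<in> BV_funs \<beta>" "BV_norm \<beta> (\<lambda>x. z * f x) \<le> cmod z * BV_norm \<beta> f"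
proof -
  have le: "chain_sum (\<lambda>x. z * f x) n c \<le> cmod z * variation \<beta> f" if "mono_chain n c" for n c
  proof -
    have "chain_sum (\<lambda>x. z * f x) n c = cmod z * chain_sum f n c"
      by (simp add: chain_sum_def sum_distrib_left norm_mult flip: right_diff_distrib)
    then show ?thesis
      using chain_sum_le_variation[OF assms(1) that] by (simp add: mult_left_mono)
  qed
  show "(\<lambda>x. z * f x) \<in> BV_funs \<beta>"
    by (rule BV_I[OF le])
  have "cmod (z * f x) \<le> cmod z * sup_norm \<beta> f" if "x \<in> X" for x
    using le_sup_norm[OF assms that] by (simp add: norm_mult mult_left_mono)
  then show "BV_norm \<beta> (\<lambda>x. z * f x) \<le> cmod z * BV_norm \<beta> f"
    using sup_norm_le[of "\<lambda>x. z * f x"] BV_I(2)[OF le] by (fastforce simp: BV_norm_def distrib_left)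
qed

lemma BV_cong:
  assumes "f \<in> BV_funs \<beta>" "\<And>x. x \<in> X \<Longrightarrow> g x = f x"
  shows "g \<in> BV_funs \<beta>"
proof (rule BV_I(1))
  show "chain_sum g n c \<le> variation \<beta> f" if "mono_chain n c" for n c
    using chain_sum_cong[OF assms(2) that] chain_sum_le_variation[OF assms(1) that] by simp
qed

lemma decreasing_chain_sum:
  fixes h :: "symseq \<Rightarrow> real"
  assumes "\<And>x y. x \<in> X \<Longrightarrow> y \<in> X \<Longrightarrow> lex_le x y \<Longrightarrow> h y \<le> h x"
    and "mono_chain n c"
  shows "chain_sum (\<lambda>x. of_real (h x)) n c = h (c 0) - h (c n)"
proof -
  have "chain_sum (\<lambda>x. of_real (h x)) n c = (\<Sum>i<n. h (c i) - h (c (Suc i)))"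
    unfolding chain_sum_def
  proof (rule sum.cong)
    fix i assume "i \<in> {..<n}"
    then have "h (c (Suc i)) \<le> h (c i)"
      using assms by (auto simp: mono_chain_def)
    then show "cmod (of_real (h (c (Suc i))) - of_real (h (c i))) = h (c i) - h (c (Suc i))"
      by (simp flip: of_real_diff)
  qed simp
  then show ?thesis
    using sum_lessThan_telescope'[of "\<lambda>i. h (c i)" n] by simp
qed

lemma down_set_chain_sum:
  assumes "\<And>x y. y \<in> D \<Longrightarrow> x \<in> X \<Longrightarrow> lex_le x y \<Longrightarrow> x \<in> D" "mono_chain n c"
  shows "chain_sum (indicator D) n c \<le> 1"
proof -
  have "chain_sum (\<lambda>x. of_real (indicator D x)) n c = indicator D (c 0) - indicator D (c n)"
    by (rule decreasing_chain_sum[OF _ assms(2)]) (use assms(1) in \<open>auto simp: indicator_def\<close>)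
  then show ?thesis
    by (simp add: of_real_indicator) (simp add: indicator_def)
qed

lemma BV_down_set:
  assumes "\<And>x y. y \<in> D \<Longrightarrow> x \<in> X \<Longrightarrow> lex_le x y \<Longrightarrow> x \<in> D"
  shows "indicator D \<in> BV_funs \<beta>"
  by (rule BV_I(1)[where B = 1]) (rule down_set_chain_sum[OF assms])

subsection \<open>The quotient by functions with countable support\<close>

lemma null_BV: "f \<in> null_funs \<beta> \<Longrightarrow> f \<in> BV_funs \<beta>"
  by (simp add: null_funs_def)

lemma null_add:
  assumes "f \<in> null_funs \<beta>" "g \<in> null_funs \<beta>"
  shows "(\<lambda>x. f x + g x) \<in> null_funs \<beta>"
proof -
  have "{x \<in> X. f x + g x \<noteq> 0} \<subseteq> {x \<in> X. f x \<noteq> 0} \<union> {x \<in> X. g x \<noteq> 0}"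
    by auto
  then show ?thesis
    using assms BV_add(1) countable_subset by (fastforce simp: null_funs_def)
qed

lemma null_scale: "f \<in> null_funs \<beta> \<Longrightarrow> (\<lambda>x. z * f x) \<in> null_funs \<beta>"
  using BV_scale(1)[of f z] countable_subset[of "{x \<in> X. z * f x \<noteq> 0}" "{x \<in> X. f x \<noteq> 0}"]
  by (auto simp: null_funs_def)

lemma null_zero_on: "(\<And>x. x \<in> X \<Longrightarrow> f x = 0) \<Longrightarrow> f \<in> null_funs \<beta>"
proof -
  assume f: "\<And>x. x \<in> X \<Longrightarrow> f x = 0"
  then have "{x \<in> X. f x \<noteq> 0} = {}"
    by auto
  then have "countable {x \<in> X. f x \<noteq> 0}"
    by (simp only: countable_empty)
  moreover have "(\<lambda>_. 0) \<in> BV_funs \<beta>"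
    by (rule BV_I(1)[where B = 0]) (simp add: chain_sum_def)
  ultimately show ?thesis
    using BV_cong[of "\<lambda>_. 0" f] f by (simp add: null_funs_def)
qed

lemma coset_self: "f \<in> coset \<beta> f"
  by (simp add: coset_def null_zero_on)

lemma coset_eq_iff: "coset \<beta> f = coset \<beta> g \<longleftrightarrow> (\<lambda>x. f x - g x) \<in> null_funs \<beta>"
proof
  assume "coset \<beta> f = coset \<beta> g"
  then show "(\<lambda>x. f x - g x) \<in> null_funs \<beta>"
    using coset_self[of f] by (simp add: coset_def)
next
  assume fg: "(\<lambda>x. f x - g x) \<in> null_funs \<beta>"
  show "coset \<beta> f = coset \<beta> g"
  proof (intro equalityI subsetI)
    fix h assume "h \<in> coset \<beta> f"
    then show "h \<in> coset \<beta> g"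
      using null_add[OF _ fg, of "\<lambda>x. h x - f x"] by (simp add: coset_def)
  next
    fix h assume "h \<in> coset \<beta> g"
    then show "h \<in> coset \<beta> f"
      using null_add[OF _ null_scale[OF fg, of "-1"], of "\<lambda>x. h x - g x"] by (simp add: coset_def)
  qed
qed

lemma coset_cong: "(\<And>x. x \<in> X \<Longrightarrow> f x = g x) \<Longrightarrow> coset \<beta> f = coset \<beta> g"
  by (simp add: coset_eq_iff null_zero_on)

lemma mem_coset: "g \<in> coset \<beta> f \<Longrightarrow> coset \<beta> g = coset \<beta> f"
  by (simp add: coset_eq_iff) (simp add: coset_def)

lemma coset_zero: "coset \<beta> (\<lambda>_. 0) = null_funs \<beta>"
  by (simp add: coset_def)

lemma coset_BV: "f \<in> BV_funs \<beta> \<Longrightarrow> g \<in> coset \<beta> f \<Longrightarrow> g \<in> BV_funs \<beta>"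
  using BV_add(1)[of f "\<lambda>x. g x - f x"] by (simp add: coset_def null_BV)

text \<open>Operations on classes are encoded as unions over all representatives; such a union is a
  single coset once the result does not depend on the representative.\<close>

lemma Union_coset:
  assumes "\<And>g. g \<in> coset \<beta> f \<Longrightarrow> coset \<beta> (h g) = coset \<beta> (h f)"
  shows "(\<Union>g\<in>coset \<beta> f. coset \<beta> (h g)) = coset \<beta> (h f)"
  using assms coset_self by blast

lemma vadd_coset: "vadd (BV_quot \<beta>) (coset \<beta> f) (coset \<beta> g) = coset \<beta> (\<lambda>x. f x + g x)"
proof -
  have "coset \<beta> (\<lambda>x. f' x + g' x) = coset \<beta> (\<lambda>x. f x + g x)"
    if "f' \<in> coset \<beta> f" "g' \<in> coset \<beta> g" for f' g'
    using null_add[of "\<lambda>x. f' x - f x" "\<lambda>x. g' x - g x"] that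
    by (simp add: coset_eq_iff) (simp add: coset_def algebra_simps)
  then have "(\<Union>f'\<in>coset \<beta> f. \<Union>g'\<in>coset \<beta> g. coset \<beta> (\<lambda>x. f' x + g' x)) =
      (\<Union>f'\<in>coset \<beta> f. \<Union>g'\<in>coset \<beta> g. coset \<beta> (\<lambda>x. f x + g x))"
    by (intro SUP_cong refl)
  also have "\<dots> = coset \<beta> (\<lambda>x. f x + g x)"
    using coset_self[of f] coset_self[of g] by auto
  finally show ?thesis
    by (simp add: BV_quot_def)
qed

lemma vscale_coset: "vscale (BV_quot \<beta>) z (coset \<beta> f) = coset \<beta> (\<lambda>x. z * f x)"
proof -
  have "coset \<beta> (\<lambda>x. z * g x) = coset \<beta> (\<lambda>x. z * f x)" if "g \<in> coset \<beta> f" for g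
    using null_scale[of "\<lambda>x. g x - f x" z] that
    by (simp add: coset_eq_iff) (simp add: coset_def algebra_simps)
  then show ?thesis
    using Union_coset[of f "\<lambda>g x. z * g x"] by (simp add: BV_quot_def)
qed

lemma vminus_coset: "vminus (BV_quot \<beta>) (coset \<beta> f) (coset \<beta> g) = coset \<beta> (\<lambda>x. f x - g x)"
  by (simp add: vminus_def vadd_coset vscale_coset)

abbreviation quot_norm :: "symfun \<Rightarrow> real" where
  "quot_norm f \<equiv> vnorm (BV_quot \<beta>) (coset \<beta> f)"

lemma quot_norm_eq: "quot_norm f = (INF g\<in>coset \<beta> f. BV_norm \<beta> g)"
  by (simp add: BV_quot_def)

lemma quot_norm_le:
  assumes "f \<in> BV_funs \<beta>" "g \<in> coset \<beta> f"
  shows "quot_norm f \<le> BV_norm \<beta> g"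
  unfolding quot_norm_eq
  by (rule cINF_lower[OF _ assms(2)])
    (use coset_BV[OF assms(1)] BV_norm_nonneg in \<open>auto simp: bdd_below_def\<close>)

lemma quot_norm_ge:
  assumes "\<And>g. g \<in> coset \<beta> f \<Longrightarrow> B \<le> BV_norm \<beta> g"
  shows "B \<le> quot_norm f"
  unfolding quot_norm_eq by (rule cINF_greatest) (use assms coset_self in auto)

lemma quot_norm_approx:
  assumes "e > 0"
  obtains g where "g \<in> coset \<beta> f" "BV_norm \<beta> g < quot_norm f + e"
proof -
  have "\<not> quot_norm f + e \<le> quot_norm f"
    using assms by simp
  then show thesis
    using quot_norm_ge[of f "quot_norm f + e"] that by (meson not_le)
qed

lemma quot_norm_add:
  assumes "f \<in> BV_funs \<beta>" "g \<in> BV_funs \<beta>"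
  shows "quot_norm (\<lambda>x. f x + g x) \<le> quot_norm f + quot_norm g"
proof (rule field_le_epsilon)
  fix e :: real assume "e > 0"
  obtain f' where f': "f' \<in> coset \<beta> f" "BV_norm \<beta> f' < quot_norm f + e / 2"
    using quot_norm_approx[of "e / 2"] \<open>e > 0\<close> by auto
  obtain g' where g': "g' \<in> coset \<beta> g" "BV_norm \<beta> g' < quot_norm g + e / 2"
    using quot_norm_approx[of "e / 2"] \<open>e > 0\<close> by auto
  have "coset \<beta> (\<lambda>x. f x + g x) = coset \<beta> (\<lambda>x. f' x + g' x)"
    using vadd_coset[of f g] vadd_coset[of f' g'] mem_coset[OF f'(1)] mem_coset[OF g'(1)] by simp
  then have "quot_norm (\<lambda>x. f x + g x) \<le> BV_norm \<beta> (\<lambda>x. f' x + g' x)"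
    using quot_norm_le[OF BV_add(1)[OF assms]] coset_self by metis
  also have "\<dots> \<le> BV_norm \<beta> f' + BV_norm \<beta> g'"
    using f' g' assms by (intro BV_add(2)) (auto intro: coset_BV)
  finally show "quot_norm (\<lambda>x. f x + g x) \<le> quot_norm f + quot_norm g + e"
    using f'(2) g'(2) by simp
qed

lemma quot_norm_minus_commute:
  assumes "f \<in> BV_funs \<beta>" "g \<in> BV_funs \<beta>"
  shows "quot_norm (\<lambda>x. f x - g x) = quot_norm (\<lambda>x. g x - f x)"
proof -
  have le: "quot_norm (\<lambda>x. f x - g x) \<le> quot_norm (\<lambda>x. g x - f x)"
    if "f \<in> BV_funs \<beta>" "g \<in> BV_funs \<beta>" for f g
  proof (rule quot_norm_ge)
    fix h assume h: "h \<in> coset \<beta> (\<lambda>x. g x - f x)"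
    have BV: "(\<lambda>x. f x - g x) \<in> BV_funs \<beta>" "(\<lambda>x. g x - f x) \<in> BV_funs \<beta>"
      using BV_add(1)[OF that(1) BV_scale(1)[OF that(2), of "-1"]]
        BV_add(1)[OF that(2) BV_scale(1)[OF that(1), of "-1"]] by simp_all
    have "(\<lambda>x. (-1) * h x) \<in> coset \<beta> (\<lambda>x. f x - g x)"
      using h null_scale[of _ "-1"] by (fastforce simp: coset_def algebra_simps)
    then have "quot_norm (\<lambda>x. f x - g x) \<le> BV_norm \<beta> (\<lambda>x. (-1) * h x)"
      by (rule quot_norm_le[OF BV(1)])
    also have "\<dots> \<le> BV_norm \<beta> h"
      using BV_scale(2)[OF coset_BV[OF BV(2) h], of "-1"] by simp
    finally show "quot_norm (\<lambda>x. f x - g x) \<le> BV_norm \<beta> h" .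
  qed
  show ?thesis
    using le[OF assms] le[OF assms(2,1)] by simp
qed

lemma quot_norm_triangle:
  assumes "f \<in> BV_funs \<beta>" "g \<in> BV_funs \<beta>" "h \<in> BV_funs \<beta>"
  shows "quot_norm (\<lambda>x. f x - h x) \<le> quot_norm (\<lambda>x. f x - g x) + quot_norm (\<lambda>x. g x - h x)"
proof -
  have "(\<lambda>x. f x - g x) \<in> BV_funs \<beta>" "(\<lambda>x. g x - h x) \<in> BV_funs \<beta>"
    using BV_add(1)[OF assms(1) BV_scale(1)[OF assms(2), of "-1"]]
      BV_add(1)[OF assms(2) BV_scale(1)[OF assms(3), of "-1"]] by simp_all
  from quot_norm_add[OF this] show ?thesis
    by simp
qed

text \<open>Choose representatives with BV norm tending to 0. Off the countable union of their
  exceptional sets \<open>f\<close> coincides with all of them, so its value there is 0.\<close>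

lemma quot_norm_eq_0:
  assumes f: "f \<in> BV_funs \<beta>" and "quot_norm f \<le> 0"
  shows "f \<in> null_funs \<beta>"
proof -
  have "\<exists>g. g \<in> coset \<beta> f \<and> BV_norm \<beta> g < 1 / real (Suc k)" for k
  proof -
    obtain g where "g \<in> coset \<beta> f" "BV_norm \<beta> g < quot_norm f + 1 / real (Suc k)"
      by (rule quot_norm_approx[of "1 / real (Suc k)" f]) auto
    with assms(2) show ?thesis
      by (intro exI[of _ g]) linarith
  qed
  then obtain g where g: "\<And>k. g k \<in> coset \<beta> f" "\<And>k. BV_norm \<beta> (g k) < 1 / real (Suc k)"
    by metis
  have "{x \<in> X. f x \<noteq> 0} \<subseteq> (\<Union>k. {x \<in> X. g k x - f x \<noteq> 0})"
  proof
    fix x assume x: "x \<in> {x \<in> X. f x \<noteq> 0}"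
    show "x \<in> (\<Union>k. {x \<in> X. g k x - f x \<noteq> 0})"
    proof (rule ccontr)
      assume "\<not> ?thesis"
      then have eq: "g k x = f x" for k
        using x by auto
      obtain k where k: "1 / real (Suc k) < cmod (f x)"
        using x reals_Archimedean[of "cmod (f x)"] by (auto simp: inverse_eq_divide)
      have gBV: "g k \<in> BV_funs \<beta>"
        by (rule coset_BV[OF f g(1)])
      have "cmod (f x) \<le> BV_norm \<beta> (g k)"
        using le_sup_norm[OF gBV, of x] variation_nonneg[OF gBV] x eq[of k] by (simp add: BV_norm_def)
      with g(2)[of k] k show False
        by simp
    qed
  qed
  moreover have "countable (\<Union>k. {x \<in> X. g k x - f x \<noteq> 0})"
    using g(1) by (intro countable_UN) (auto simp: coset_def null_funs_def)
  ultimately show ?thesis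
    using f by (auto simp: null_funs_def intro: countable_subset)
qed

subsection \<open>Coordinates on the space of jump functions\<close>

text \<open>The function \<open>H\<^sub>p\<close> of the overview.\<close>

definition seg :: "symseq \<Rightarrow> symseq \<Rightarrow> complex" where
  "seg p x = (if lex_le x p then 1 else 0)"

definition jump_fun :: "symseq ell1 \<Rightarrow> symfun" where
  "jump_fun a x = ell1_extend (\<lambda>p. seg p x) a"

text \<open>This is \<open>\<ell>\<^sup>1(P)\<close>, realized inside the families indexed by all
  sequences because \<open>P\<close> depends on \<open>\<beta>\<close>.\<close>

definition coords :: "symseq ell1 set" where
  "coords = {a. \<forall>p. p \<notin> P \<longrightarrow> coeff a p = 0}"

definition Phi :: "symseq ell1 \<Rightarrow> symfun set" where
  "Phi a = coset \<beta> (jump_fun a)"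

lemma seg_eq_0: "less_fun p x \<Longrightarrow> seg p x = 0"
  by (auto simp: seg_def dest: lex.leD)

lemma seg_eq_1: "less_fun x p \<Longrightarrow> seg p x = 1"
  by (simp add: seg_def lex.less_imp_le)

lemma norm_seg_le: "norm (seg p x) \<le> 1"
  by (simp add: seg_def)

lemma bounded_clinear_jump_fun: "bounded_clinear (\<lambda>a. jump_fun a x)"
  unfolding jump_fun_def by (rule bounded_clinear_ell1_extend[OF norm_seg_le])

lemma jump_fun_basis [simp]: "jump_fun (basis_ell1 p) = seg p"
  by (simp add: jump_fun_def fun_eq_iff)

lemma jump_fun_add: "jump_fun (a + b) = (\<lambda>x. jump_fun a x + jump_fun b x)"
  and jump_fun_diff: "jump_fun (a - b) = (\<lambda>x. jump_fun a x - jump_fun b x)"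
  and jump_fun_scaleC: "jump_fun (z *\<^sub>C a) = (\<lambda>x. z * jump_fun a x)"
  and jump_fun_zero: "jump_fun 0 = (\<lambda>_. 0)"
  by (simp_all add: fun_eq_iff bounded_clinear_add[OF bounded_clinear_jump_fun]
      bounded_clinear_diff[OF bounded_clinear_jump_fun] bounded_clinear_zero[OF bounded_clinear_jump_fun]
      bounded_clinear_scaleC[OF bounded_clinear_jump_fun] scaleC_complex_def)

lemma seg_chain_sum: "mono_chain n c \<Longrightarrow> chain_sum (seg p) n c \<le> 1"
proof -
  assume c: "mono_chain n c"
  have "seg p = indicator {x. lex_le x p}"
    by (auto simp: seg_def indicator_def fun_eq_iff)
  then show ?thesis
    using down_set_chain_sum[OF _ c, of "{x. lex_le x p}"] lex.order.trans by auto
qed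

text \<open>The phases \<open>u i\<close> turn the variation along a chain into a bounded linear functional, which is
  estimated on the basis.\<close>

lemma jump_fun_chain_sum:
  assumes "mono_chain n c"
  shows "chain_sum (jump_fun a) n c \<le> norm a"
proof -
  define u where "u i = cnj (sgn (jump_fun a (c (Suc i)) - jump_fun a (c i)))" for i
  define G where "G b = (\<Sum>i<n. u i *\<^sub>C (jump_fun b (c (Suc i)) - jump_fun b (c i)))" for b
  have G: "bounded_clinear G"
    unfolding G_def
    by (intro bounded_clinear_setsum bounded_clinear_const_scaleC bounded_clinear_minus
        bounded_clinear_jump_fun)
  have u: "cmod (u i) \<le> 1" for i
    by (simp add: u_def norm_sgn)
  have "norm (G (basis_ell1 p)) \<le> 1" for p
  proof -
    have "norm (G (basis_ell1 p)) \<le> (\<Sum>i<n. cmod (u i *\<^sub>C (seg p (c (Suc i)) - seg p (c i))))"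
      unfolding G_def jump_fun_basis by (rule norm_sum)
    also have "\<dots> \<le> chain_sum (seg p) n c"
      unfolding chain_sum_def norm_scaleC
      by (rule sum_mono) (use u mult_right_mono[OF u norm_ge_zero] in auto)
    finally show ?thesis
      using seg_chain_sum[OF assms, of p] by simp
  qed
  from ell1_op_bound[OF G this] have "cmod (G a) \<le> norm a"
    by simp
  moreover have "G a = of_real (chain_sum (jump_fun a) n c)"
  proof -
    have "cnj (sgn w) * w = of_real (cmod w)" for w
    proof -
      have "cnj (sgn w) * w = (w * cnj w) / of_real (cmod w)"
        by (simp add: sgn_eq)
      also have "\<dots> = of_real (cmod w)"
        by (cases "w = 0") (simp_all add: complex_norm_square[symmetric] power2_eq_square)
      finally show ?thesis .
    qed
    then show ?thesis
      by (simp add: G_def chain_sum_def u_def scaleC_complex_def)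
  qed
  moreover have "0 \<le> chain_sum (jump_fun a) n c"
    unfolding chain_sum_def by (rule sum_nonneg) simp
  ultimately show ?thesis
    by simp
qed

lemma jump_fun_BV: "jump_fun a \<in> BV_funs \<beta>"
  by (rule BV_I(1)[OF jump_fun_chain_sum])

text \<open>The factor 2 adds up sup norm and variation, each of them at most
  \<open>norm a\<close>.\<close>

lemma quot_norm_jump_fun_le: "quot_norm (jump_fun a) \<le> 2 * norm a"
proof -
  have "variation \<beta> (jump_fun a) \<le> norm a"
    by (rule BV_I(2)[OF jump_fun_chain_sum])
  moreover have "sup_norm \<beta> (jump_fun a) \<le> norm a"
    using norm_ell1_extend_le[OF norm_seg_le, where a = a]
    by (intro sup_norm_le) (simp add: jump_fun_def)
  ultimately have "BV_norm \<beta> (jump_fun a) \<le> 2 * norm a"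
    by (simp add: BV_norm_def)
  then show ?thesis
    using quot_norm_le[OF jump_fun_BV coset_self, of a] by simp
qed

lemma ex_between_avoiding:
  assumes "countable Z" "x \<in> X" "b \<in> P" "less_fun x b"
  obtains y where "y \<in> X" "less_fun x y" "less_fun y b" "y \<notin> Z"
proof -
  have "uncountable ({y \<in> X. less_fun x y \<and> less_fun y b} - Z)"
    using assms by (intro uncountable_minus_countable uncountable_between)
  then have "{y \<in> X. less_fun x y \<and> less_fun y b} - Z \<noteq> {}"
    by (metis countable_empty)
  then show thesis
    using that by blast
qed

text \<open>The gaps between points of \<open>P\<close> are uncountable, so the chain can avoid the countable set
  \<open>Z\<close> and still detect every jump.\<close>

lemma chain_detects_jumps:
  assumes Z: "countable Z" and "finite Q"
  shows "Q \<subseteq> P \<Longrightarrow> b \<in> P \<Longrightarrow> (\<And>q. q \<in> Q \<Longrightarrow> less_fun q b) \<Longrightarrow>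
    (\<And>x. x \<in> X - Z \<Longrightarrow> less_fun x b \<Longrightarrow> g x = (\<Sum>q\<in>Q. \<alpha> q * seg q x) + K) \<Longrightarrow>
    \<exists>n c. mono_chain n c \<and> c n \<notin> Z \<and> less_fun (c n) b \<and> (\<forall>q\<in>Q. less_fun q (c n)) \<and>
      (\<Sum>q\<in>Q. cmod (\<alpha> q)) \<le> chain_sum g n c"
  using assms(2)
proof (induction Q arbitrary: b K rule: lex.finite_linorder_max_induct)
  case empty
  have "less_fun seq_zero b"
    using empty.prems(2) seq_zero_le[of b] by (auto simp: lex_le_def P_def seq_zero_def)
  then obtain y where "y \<in> X" "less_fun y b" "y \<notin> Z"
    using ex_between_avoiding[OF Z seq_zero_in empty.prems(2)] by metis
  then show ?case
    by (intro exI[of _ 0] exI[of _ "\<lambda>_. y"]) (simp add: mono_chain_def chain_sum_def)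
next
  case (insert m Q)
  have m: "m \<in> P" "less_fun m b" "m \<notin> Q"
    using insert by auto
  have g: "g x = (\<Sum>q\<in>Q. \<alpha> q * seg q x) + \<alpha> m * seg m x + K" if "x \<in> X - Z" "less_fun x b" for x
    using insert.prems(4)[OF that] insert.hyps(1) m(3) by simp
  \<comment> \<open>Below the largest jump \<open>m\<close>, its contribution is constant and is
    absorbed into the additive constant. This is why \<open>K\<close> and the upper barrier
    \<open>b\<close> are arbitrary in the induction.\<close>
  have g': "g x = (\<Sum>q\<in>Q. \<alpha> q * seg q x) + (\<alpha> m + K)" if "x \<in> X - Z" "less_fun x m" for x
    using g[OF that(1) lex.less_trans[OF that(2) m(2)]] that(2) by (simp add: seg_eq_1)
  have "\<exists>n c. mono_chain n c \<and> c n \<notin> Z \<and> less_fun (c n) m \<and> (\<forall>q\<in>Q. less_fun q (c n)) \<and>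
      (\<Sum>q\<in>Q. cmod (\<alpha> q)) \<le> chain_sum g n c"
    by (rule insert.IH[OF _ m(1) _ g']) (use insert.prems(1) insert.hyps(2) in auto)
  then obtain n c where
    c: "mono_chain n c" "c n \<notin> Z" "less_fun (c n) m" "\<And>q. q \<in> Q \<Longrightarrow> less_fun q (c n)"
      "(\<Sum>q\<in>Q. cmod (\<alpha> q)) \<le> chain_sum g n c"
    by blast
  \<comment> \<open>The step from \<open>c n\<close> to \<open>y\<close> crosses only the jump at
    \<open>m\<close>: all smaller jumps lie below \<open>c n\<close> already.\<close>
  obtain y where y: "y \<in> X" "less_fun m y" "less_fun y b" "y \<notin> Z"
    using ex_between_avoiding[OF Z P_subset[OF m(1)] insert.prems(2) m(2)] by metis
  have zero: "(\<Sum>q\<in>Q. \<alpha> q * seg q x) = 0" if "\<And>q. q \<in> Q \<Longrightarrow> less_fun q x" for x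
    using that by (intro sum.neutral) (simp add: seg_eq_0)
  have qy: "less_fun q y" if "q \<in> insert m Q" for q
    using that y(2) insert.hyps(2) lex.less_trans by blast
  have "c n \<in> X"
    using c(1) by (simp add: mono_chain_def)
  then have "g (c n) = \<alpha> m + K"
    using g[OF _ lex.less_trans[OF c(3) m(2)]] c zero[of "c n"] by (simp add: seg_eq_1)
  moreover have "g y = K"
    using g[of y] y zero[of y] qy by (simp add: seg_eq_0)
  ultimately have "chain_sum g (Suc n) (c(Suc n := y)) = chain_sum g n c + cmod (\<alpha> m)"
    by (simp add: chain_sum_snoc)
  moreover have "lex_le (c n) y"
    using c(3) y(2) lex.less_trans lex.less_imp_le by blast
  then have "mono_chain (Suc n) (c(Suc n := y))"
    using c(1) y(1) by (intro mono_chain_snoc)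
  ultimately show ?case
    using c(5) y qy insert.hyps(1) m(3)
    by (intro exI[of _ "Suc n"] exI[of _ "c(Suc n := y)"])
      (simp del: fun_upd_apply add: fun_upd_same)
qed

text \<open>The variation of any representative detects all jumps below \<open>\<omega>\<close>. The
  coefficient at \<open>\<omega>\<close> is an additive constant; it is the value at the end of the
  detecting chain, where all other segments vanish, and is bounded by the sup norm.\<close>

lemma norm_le_quot_norm_finite:
  assumes F: "finite F" "F \<subseteq> P" and a: "\<And>p. p \<notin> F \<Longrightarrow> coeff a p = 0"
  shows "norm a \<le> quot_norm (jump_fun a)"
proof (rule quot_norm_ge)
  fix g assume g: "g \<in> coset \<beta> (jump_fun a)"
  then have gBV: "g \<in> BV_funs \<beta>"
    by (rule coset_BV[OF jump_fun_BV])
  define Z where "Z = {x \<in> X. g x - jump_fun a x \<noteq> 0}"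
  have Z: "countable Z"
    using g by (simp add: Z_def coset_def null_funs_def)
  define Q where "Q = F - {\<omega>}"
  have Q: "finite Q" "\<omega> \<notin> Q"
    using F(1) by (auto simp: Q_def)
  have jump: "jump_fun a x = (\<Sum>q\<in>Q. coeff a q * seg q x) + coeff a \<omega>" if "x \<in> X" for x
  proof -
    have "jump_fun a x = (\<Sum>p\<in>insert \<omega> Q. coeff a p * seg p x)"
      unfolding jump_fun_def scaleC_complex_def[symmetric]
      by (rule ell1_extend_finite) (use F a in \<open>auto simp: Q_def\<close>)
    then show ?thesis
      using Q le_seq_one[OF that] by (simp add: seg_def)
  qed
  have "\<exists>n c. mono_chain n c \<and> c n \<notin> Z \<and> less_fun (c n) \<omega> \<and> (\<forall>q\<in>Q. less_fun q (c n)) \<and>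
      (\<Sum>q\<in>Q. cmod (coeff a q)) \<le> chain_sum g n c"
  proof (rule chain_detects_jumps[OF Z])
    show "g x = (\<Sum>q\<in>Q. coeff a q * seg q x) + coeff a \<omega>" if "x \<in> X - Z" for x
      using that jump[of x] by (simp add: Z_def)
    show "less_fun q \<omega>" if "q \<in> Q" for q
      using that F le_seq_one[OF P_subset, of q] by (auto simp: Q_def lex_le_def)
  qed (use F seq_one_in_P in \<open>auto simp: Q_def\<close>)
  then obtain n c where c: "mono_chain n c" "c n \<notin> Z" "\<And>q. q \<in> Q \<Longrightarrow> less_fun q (c n)"
      "(\<Sum>q\<in>Q. cmod (coeff a q)) \<le> chain_sum g n c"
    by blast
  have "c n \<in> X"
    using c(1) by (simp add: mono_chain_def)
  moreover have "(\<Sum>q\<in>Q. coeff a q * seg q (c n)) = 0"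
    using c(3) by (intro sum.neutral) (simp add: seg_eq_0)
  ultimately have "g (c n) = coeff a \<omega>"
    using c(2) jump[of "c n"] by (simp add: Z_def)
  then have "cmod (coeff a \<omega>) \<le> sup_norm \<beta> g"
    using le_sup_norm[OF gBV \<open>c n \<in> X\<close>] by simp
  moreover have "(\<Sum>q\<in>Q. cmod (coeff a q)) \<le> variation \<beta> g"
    using c(4) chain_sum_le_variation[OF gBV c(1)] by simp
  moreover have "norm a \<le> (\<Sum>p\<in>insert \<omega> Q. cmod (coeff a p))"
  proof (rule norm_ell1_le)
    fix G :: "symseq set" assume "finite G"
    have "(\<Sum>p\<in>G. cmod (coeff a p)) = (\<Sum>p\<in>G \<inter> insert \<omega> Q. cmod (coeff a p))"
      by (rule sum.mono_neutral_right) (use \<open>finite G\<close> a in \<open>auto simp: Q_def\<close>)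
    also have "\<dots> \<le> (\<Sum>p\<in>insert \<omega> Q. cmod (coeff a p))"
      by (rule sum_mono2) (use F in \<open>auto simp: Q_def\<close>)
    finally show "(\<Sum>p\<in>G. cmod (coeff a p)) \<le> (\<Sum>p\<in>insert \<omega> Q. cmod (coeff a p))" .
  qed
  ultimately show "norm a \<le> BV_norm \<beta> g"
    using Q by (simp add: BV_norm_def)
qed

lemma coords_truncate:
  assumes "a \<in> coords" "e > 0"
  obtains F where "finite F" "F \<subseteq> P" "norm (a - (\<Sum>p\<in>F. coeff a p *\<^sub>C basis_ell1 p)) < e"
proof -
  obtain F where F: "finite F" "norm (a - (\<Sum>p\<in>F. coeff a p *\<^sub>C basis_ell1 p)) < e"
    "\<And>p. p \<in> F \<Longrightarrow> coeff a p \<noteq> 0"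
    using ell1_finite_approx[OF assms(2)] by metis
  have "F \<subseteq> P"
    using F(3) assms(1) by (auto simp: coords_def)
  with F show thesis
    by (intro that)
qed

lemma coeff_sum_basis:
  assumes "finite F" "p \<notin> F"
  shows "coeff (\<Sum>q\<in>F. w q *\<^sub>C basis_ell1 q) p = 0"
  using assms by (induction F) auto

lemma norm_le_quot_norm:
  assumes "a \<in> coords"
  shows "norm a \<le> quot_norm (jump_fun a)"
proof (rule field_le_epsilon)
  fix e :: real assume "e > 0"
  \<comment> \<open>The truncation error is paid three times: twice through
    \<open>quot_norm_jump_fun_le\<close> and once in the triangle inequality for
    \<open>norm a\<close>.\<close>
  then obtain F where F: "finite F" "F \<subseteq> P" "norm (a - (\<Sum>p\<in>F. coeff a p *\<^sub>C basis_ell1 p)) < e / 3"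
    by (rule_tac coords_truncate[OF assms, of "e / 3"]) auto
  define b where "b = (\<Sum>p\<in>F. coeff a p *\<^sub>C basis_ell1 p)"
  have "norm b \<le> quot_norm (jump_fun b)"
    using F coeff_sum_basis[OF F(1)] by (intro norm_le_quot_norm_finite[of F]) (auto simp: b_def)
  also have "\<dots> \<le> quot_norm (jump_fun a) + quot_norm (jump_fun (b - a))"
    using quot_norm_add[OF jump_fun_BV jump_fun_BV, of a "b - a"] by (simp flip: jump_fun_add)
  also have "\<dots> \<le> quot_norm (jump_fun a) + 2 * norm (a - b)"
    using quot_norm_jump_fun_le[of "b - a"] by (simp add: norm_minus_commute)
  finally show "norm a \<le> quot_norm (jump_fun a) + e"
    using F(3) norm_triangle_sub[of a b] by (simp add: b_def)
qed

section \<open>Identification of \<open>F_space \<beta>\<close> with the coordinate space\<close>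

lemma coords_zero: "0 \<in> coords"
  and coords_add: "a \<in> coords \<Longrightarrow> b \<in> coords \<Longrightarrow> a + b \<in> coords"
  and coords_diff: "a \<in> coords \<Longrightarrow> b \<in> coords \<Longrightarrow> a - b \<in> coords"
  and coords_scaleC: "a \<in> coords \<Longrightarrow> z *\<^sub>C a \<in> coords"
  and coords_basis: "p \<in> P \<Longrightarrow> basis_ell1 p \<in> coords"
  by (auto simp: coords_def)

lemma Phi_inj:
  assumes "a \<in> coords" "b \<in> coords" "Phi a = Phi b"
  shows "a = b"
proof -
  have "(\<lambda>x. jump_fun a x - jump_fun b x) \<in> null_funs \<beta>"
    using assms(3) by (simp add: Phi_def coset_eq_iff)
  then have *: "coset \<beta> (jump_fun (a - b)) = coset \<beta> (\<lambda>_. 0)"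
    by (simp add: coset_eq_iff jump_fun_diff)
  have "norm (a - b) \<le> quot_norm (jump_fun (a - b))"
    by (rule norm_le_quot_norm[OF coords_diff[OF assms(1,2)]])
  also have "\<dots> = quot_norm (jump_fun 0)"
    by (simp add: * jump_fun_zero)
  also have "\<dots> \<le> 0"
    using quot_norm_jump_fun_le[of 0] by simp
  finally show ?thesis
    by simp
qed

text \<open>A countable initial segment is 0 in the quotient; an uncountable one agrees with some
  \<open>seg p\<close>, \<open>p \<in> P\<close>, up to countably many points.\<close>

lemma coset_down_set:
  assumes D: "D \<subseteq> X" "\<forall>x\<in>D. \<forall>y\<in>X. lex_le y x \<longrightarrow> y \<in> D"
  shows "\<exists>a\<in>coords. coset \<beta> (indicator D) = Phi a"
proof (cases "countable D")
  case True
  have "{x \<in> X. indicator D x \<noteq> (0::complex)} = D"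
    using D(1) by (auto simp: indicator_def)
  then have "indicator D \<in> null_funs \<beta>"
    using True BV_down_set[of D] D(2) by (simp add: null_funs_def)
  then have "coset \<beta> (indicator D) = Phi 0"
    by (simp add: Phi_def coset_eq_iff jump_fun_zero)
  then show ?thesis
    using coords_zero by blast
next
  case False
  then obtain p where p: "p \<in> P" "\<And>x. x \<in> X \<Longrightarrow> less_fun x p \<Longrightarrow> x \<in> D" "countable {x \<in> D. less_fun p x}"
    using down_set_almost_segment[OF D False] by blast
  have "(\<lambda>x. indicator D x - seg p x) \<in> BV_funs \<beta>"
    using BV_add(1)[OF BV_down_set[of D] BV_scale(1)[OF jump_fun_BV, of "-1" "basis_ell1 p"]] D(2) by simp
  moreover have "{x \<in> X. indicator D x - seg p x \<noteq> 0} \<subseteq> {x \<in> D. less_fun p x} \<union> {p}"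
    using p(2) by (auto simp: indicator_def seg_def lex.not_le lex_le_def split: if_splits)
  then have "countable {x \<in> X. indicator D x - seg p x \<noteq> 0}"
    by (rule countable_subset) (use p(3) in auto)
  ultimately have "coset \<beta> (indicator D) = Phi (basis_ell1 p)"
    by (simp add: Phi_def coset_eq_iff null_funs_def)
  then show ?thesis
    using coords_basis[OF p(1)] by blast
qed

text \<open>An interval is the difference of two initial segments: the one it generates, and the
  points strictly below it.\<close>

lemma coset_interval:
  assumes "I \<in> shift_intervals \<beta>"
  shows "\<exists>a\<in>coords. coset \<beta> (indicator I) = Phi a"
proof -
  define D where "D = {x \<in> X. \<exists>y\<in>I. lex_le x y}"
  \<comment> \<open>The condition \<open>I \<noteq> {}\<close> keeps \<open>E\<close> empty for the
    empty interval; without it \<open>E\<close> would be all of \<open>X\<close> and not contained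
    in \<open>D\<close>.\<close>
  define E where "E = {x \<in> X. I \<noteq> {} \<and> (\<forall>y\<in>I. less_fun x y)}"
  have I: "I \<subseteq> X" "\<And>x y z. x \<in> I \<Longrightarrow> y \<in> I \<Longrightarrow> z \<in> X \<Longrightarrow> lex_le x z \<Longrightarrow> lex_le z y \<Longrightarrow> z \<in> I"
    using assms unfolding shift_intervals_def by blast+
  have "\<forall>x\<in>D. \<forall>y\<in>X. lex_le y x \<longrightarrow> y \<in> D"
    unfolding D_def using lex.order.trans by blast
  then obtain a where a: "a \<in> coords" "coset \<beta> (indicator D) = Phi a"
    using coset_down_set[of D] by (auto simp: D_def)
  have "\<forall>x\<in>E. \<forall>y\<in>X. lex_le y x \<longrightarrow> y \<in> E"
    unfolding E_def using lex.le_less_trans by blast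
  then obtain b where b: "b \<in> coords" "coset \<beta> (indicator E) = Phi b"
    using coset_down_set[of E] by (auto simp: E_def)
  have "indicator I x = indicator D x - (indicator E x :: complex)" if "x \<in> X" for x
  proof -
    have "x \<in> I \<longleftrightarrow> x \<in> D \<and> x \<notin> E"
    proof
      assume "x \<in> I"
      then show "x \<in> D \<and> x \<notin> E"
        using that by (auto simp: D_def E_def)
    next
      assume x: "x \<in> D \<and> x \<notin> E"
      then obtain y where "y \<in> I" "lex_le x y"
        by (auto simp: D_def)
      moreover from this x obtain w where "w \<in> I" "lex_le w x"
        by (auto simp: D_def E_def lex.not_less)
      ultimately show "x \<in> I"
        using I(2) that by blast
    qed
    moreover have "E \<subseteq> D"
      unfolding D_def E_def using lex.less_imp_le by blast
    ultimately show ?thesis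
      by (auto simp: indicator_def)
  qed
  then have "coset \<beta> (indicator I) = coset \<beta> (\<lambda>x. indicator D x - indicator E x)"
    by (rule coset_cong)
  also have "\<dots> = vminus (BV_quot \<beta>) (Phi a) (Phi b)"
    using a b by (simp add: vminus_coset flip: a(2) b(2))
  also have "\<dots> = Phi (a - b)"
    by (simp add: Phi_def vminus_coset jump_fun_diff)
  finally show ?thesis
    using coords_diff[OF a(1) b(1)] by blast
qed

lemma cn_subspace_Phi: "cn_subspace (BV_quot \<beta>) (Phi ` coords)"
  unfolding cn_subspace_def
proof (intro conjI ballI allI)
  show "Phi ` coords \<subseteq> carr (BV_quot \<beta>)"
    using jump_fun_BV by (auto simp: BV_quot_def Phi_def)
  have "vzero (BV_quot \<beta>) = Phi 0"
    by (simp add: BV_quot_def Phi_def jump_fun_zero coset_zero)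
  then show "vzero (BV_quot \<beta>) \<in> Phi ` coords"
    using coords_zero by blast
next
  fix v w assume "v \<in> Phi ` coords" "w \<in> Phi ` coords"
  then obtain a b where ab: "a \<in> coords" "b \<in> coords" "v = Phi a" "w = Phi b"
    by blast
  then have "vadd (BV_quot \<beta>) v w = Phi (a + b)"
    by (simp add: Phi_def vadd_coset jump_fun_add)
  then show "vadd (BV_quot \<beta>) v w \<in> Phi ` coords"
    using coords_add[OF ab(1,2)] by blast
next
  fix z v assume "v \<in> Phi ` coords"
  then obtain a where a: "a \<in> coords" "v = Phi a"
    by blast
  then have "vscale (BV_quot \<beta>) z v = Phi (z *\<^sub>C a)"
    by (simp add: Phi_def vscale_coset jump_fun_scaleC)
  then show "vscale (BV_quot \<beta>) z v \<in> Phi ` coords"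
    using coords_scaleC[OF a(1)] by blast
qed

lemma coords_closed:
  assumes "\<And>n. a n \<in> coords" "a \<longlonglongrightarrow> b"
  shows "b \<in> coords"
  unfolding coords_def
proof (intro CollectI allI impI)
  fix p assume "p \<notin> P"
  have "(\<lambda>n. coeff (a n) p) \<longlonglongrightarrow> coeff b p"
    by (rule bounded_linear.tendsto[OF bounded_clinear_bounded_linear[OF bounded_clinear_coeff] assms(2)])
  moreover have "coeff (a n) p = 0" for n
    using assms(1)[of n] \<open>p \<notin> P\<close> by (simp add: coords_def)
  ultimately show "coeff b p = 0"
    by (simp add: LIMSEQ_const_iff)
qed

abbreviation interval_cosets :: "symfun set set" where
  "interval_cosets \<equiv> (\<lambda>I. coset \<beta> (indicator I)) ` shift_intervals \<beta>"

lemma Phi_basis_interval: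
  assumes "p \<in> X"
  shows "coset \<beta> (seg p) \<in> interval_cosets"
proof -
  have "{x \<in> X. lex_le x p} \<in> shift_intervals \<beta>"
    unfolding shift_intervals_def using lex.order.trans by blast
  moreover have "coset \<beta> (seg p) = coset \<beta> (indicator {x \<in> X. lex_le x p})"
    by (rule coset_cong) (simp add: seg_def indicator_def)
  ultimately show ?thesis
    by blast
qed

text \<open>The lower norm bound makes the image of \<open>coords\<close> closed: approximants of a
  point of the closure are Cauchy in coordinates, and their limit represents the point. Conversely,
  finite truncations are combinations of intervals.\<close>

lemma carr_F_space: "carr (F_space \<beta>) = Phi ` coords"
proof -
  have "carr (F_space \<beta>) = cn_closure (BV_quot \<beta>) (cn_span (BV_quot \<beta>) interval_cosets)"
    by (simp add: F_space_def)
  also have "\<dots> = Phi ` coords"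
  proof (intro equalityI subsetI)
    fix v assume "v \<in> cn_closure (BV_quot \<beta>) (cn_span (BV_quot \<beta>) interval_cosets)"
    then have v: "v \<in> carr (BV_quot \<beta>)"
      "\<And>e. e > 0 \<Longrightarrow> \<exists>w\<in>cn_span (BV_quot \<beta>) interval_cosets. vnorm (BV_quot \<beta>) (vminus (BV_quot \<beta>) v w) < e"
      by (auto simp: cn_closure_def)
    then obtain f where f: "f \<in> BV_funs \<beta>" "v = coset \<beta> f"
      by (auto simp: BV_quot_def)
    have span: "cn_span (BV_quot \<beta>) interval_cosets \<subseteq> Phi ` coords"
      unfolding cn_span_def
      by (rule Inter_lower) (use cn_subspace_Phi coset_interval in auto)
    have "\<exists>a\<in>coords. quot_norm (\<lambda>x. f x - jump_fun a x) < e" if "e > 0" for e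
    proof -
      obtain w where "w \<in> cn_span (BV_quot \<beta>) interval_cosets"
        "vnorm (BV_quot \<beta>) (vminus (BV_quot \<beta>) v w) < e"
        using v(2)[OF \<open>e > 0\<close>] by blast
      moreover from this(1) span obtain a where "a \<in> coords" "w = Phi a"
        by blast
      ultimately show ?thesis
        by (intro bexI[of _ a]) (simp_all add: f(2) Phi_def vminus_coset)
    qed
    then have "\<exists>a\<in>coords. quot_norm (\<lambda>x. f x - jump_fun a x) < 1 / real (Suc n)" for n
      by simp
    then obtain a where a: "\<And>n. a n \<in> coords" "\<And>n. quot_norm (\<lambda>x. f x - jump_fun (a n) x) < 1 / real (Suc n)"
      by metis
    have dist_le: "norm (a m - a n) \<le> 1 / real (Suc m) + 1 / real (Suc n)" for m n
    proof -
      have "norm (a m - a n) \<le> quot_norm (\<lambda>x. jump_fun (a m) x - jump_fun (a n) x)"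
        using norm_le_quot_norm[OF coords_diff[OF a(1) a(1)], of m n] by (simp add: jump_fun_diff)
      also have "\<dots> \<le> quot_norm (\<lambda>x. jump_fun (a m) x - f x) + quot_norm (\<lambda>x. f x - jump_fun (a n) x)"
        by (intro quot_norm_triangle jump_fun_BV f)
      also have "quot_norm (\<lambda>x. jump_fun (a m) x - f x) = quot_norm (\<lambda>x. f x - jump_fun (a m) x)"
        by (intro quot_norm_minus_commute jump_fun_BV f)
      finally show ?thesis
        using a(2)[of m] a(2)[of n] by simp
    qed
    have "Cauchy a"
    proof (rule CauchyI)
      fix e :: real assume "e > 0"
      then obtain N where N: "1 / real (Suc N) < e / 2"
        using reals_Archimedean[of "e / 2"] by (auto simp: inverse_eq_divide)
      have "norm (a m - a n) < e" if "m \<ge> N" "n \<ge> N" for m n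
      proof -
        have "1 / real (Suc m) \<le> 1 / real (Suc N)" "1 / real (Suc n) \<le> 1 / real (Suc N)"
          using that by (auto intro!: divide_left_mono)
        then show ?thesis
          using N dist_le[of m n] by linarith
      qed
      then show "\<exists>M. \<forall>m\<ge>M. \<forall>n\<ge>M. norm (a m - a n) < e"
        by blast
    qed
    then obtain b where b: "a \<longlonglongrightarrow> b"
      by (auto simp: Cauchy_convergent_iff convergent_def)
    have bS: "b \<in> coords"
      by (rule coords_closed[OF a(1) b])
    have "quot_norm (\<lambda>x. f x - jump_fun b x) \<le> 1 / real (Suc n) + 2 * norm (a n - b)" for n
    proof -
      have "quot_norm (\<lambda>x. f x - jump_fun b x) \<le>
          quot_norm (\<lambda>x. f x - jump_fun (a n) x) + quot_norm (\<lambda>x. jump_fun (a n) x - jump_fun b x)"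
        by (intro quot_norm_triangle jump_fun_BV f)
      also have "quot_norm (\<lambda>x. jump_fun (a n) x - jump_fun b x) \<le> 2 * norm (a n - b)"
        using quot_norm_jump_fun_le[of "a n - b"] by (simp add: jump_fun_diff)
      finally show ?thesis
        using a(2)[of n] by simp
    qed
    moreover have "(\<lambda>n. 1 / real (Suc n) + 2 * norm (a n - b)) \<longlonglongrightarrow> 0 + 2 * 0"
      using LIMSEQ_inverse_real_of_nat tendsto_norm_zero[OF LIM_zero[OF b]]
      by (intro tendsto_intros) (simp_all add: inverse_eq_divide)
    ultimately have "quot_norm (\<lambda>x. f x - jump_fun b x) \<le> 0 + 2 * 0"
      by (intro LIMSEQ_le_const) auto
    moreover have "(\<lambda>x. f x - jump_fun b x) \<in> BV_funs \<beta>"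
      using BV_add(1)[OF f(1) BV_scale(1)[OF jump_fun_BV, of "-1" b]] by simp
    ultimately have "(\<lambda>x. f x - jump_fun b x) \<in> null_funs \<beta>"
      by (intro quot_norm_eq_0) auto
    then have "v = Phi b"
      by (simp add: f(2) Phi_def coset_eq_iff)
    then show "v \<in> Phi ` coords"
      using bS by blast
  next
    fix v assume "v \<in> Phi ` coords"
    then obtain a where a: "a \<in> coords" "v = Phi a"
      by blast
    show "v \<in> cn_closure (BV_quot \<beta>) (cn_span (BV_quot \<beta>) interval_cosets)"
      unfolding cn_closure_def
    proof (intro CollectI conjI allI impI)
      show "v \<in> carr (BV_quot \<beta>)"
        using a jump_fun_BV by (auto simp: BV_quot_def Phi_def)
      fix e :: real assume "e > 0"
      then obtain F where F: "finite F" "F \<subseteq> P" "norm (a - (\<Sum>p\<in>F. coeff a p *\<^sub>C basis_ell1 p)) < e / 2"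
        by (rule_tac coords_truncate[OF a(1), of "e / 2"]) auto
      define b where "b = (\<Sum>p\<in>F. coeff a p *\<^sub>C basis_ell1 p)"
      have "Phi b \<in> cn_span (BV_quot \<beta>) interval_cosets"
        unfolding cn_span_def b_def
      proof (intro InterI, elim CollectE conjE)
        fix W assume W: "cn_subspace (BV_quot \<beta>) W" "interval_cosets \<subseteq> W"
        show "Phi (\<Sum>p\<in>F. coeff a p *\<^sub>C basis_ell1 p) \<in> W"
          using F(1,2)
        proof (induction F)
          case empty
          then show ?case
            using W(1) by (simp add: Phi_def jump_fun_zero coset_zero cn_subspace_def BV_quot_def)
        next
          case (insert p F)
          have "coset \<beta> (seg p) \<in> W"
            using W(2) Phi_basis_interval[of p] insert.prems P_subset by auto
          then have "vscale (BV_quot \<beta>) (coeff a p) (coset \<beta> (seg p)) \<in> W"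
            using W(1) by (simp add: cn_subspace_def)
          then have "vadd (BV_quot \<beta>) (vscale (BV_quot \<beta>) (coeff a p) (coset \<beta> (seg p)))
              (Phi (\<Sum>p\<in>F. coeff a p *\<^sub>C basis_ell1 p)) \<in> W"
            using W(1) insert by (simp add: cn_subspace_def)
          then show ?case
            using insert.hyps
            by (simp add: Phi_def vadd_coset vscale_coset jump_fun_add jump_fun_scaleC)
        qed
      qed
      moreover have "vnorm (BV_quot \<beta>) (vminus (BV_quot \<beta>) v (Phi b)) < e"
        using quot_norm_jump_fun_le[of "a - b"] F(3)
        by (simp add: a(2) Phi_def vminus_coset jump_fun_diff b_def)
      ultimately show "\<exists>w\<in>cn_span (BV_quot \<beta>) interval_cosets.
          vnorm (BV_quot \<beta>) (vminus (BV_quot \<beta>) v w) < e"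
        by blast
    qed
  qed
  finally show ?thesis .
qed

lemma F_space_simps [simp]:
  "vadd (F_space \<beta>) = vadd (BV_quot \<beta>)" "vscale (F_space \<beta>) = vscale (BV_quot \<beta>)"
  "vzero (F_space \<beta>) = null_funs \<beta>" "vnorm (F_space \<beta>) = vnorm (BV_quot \<beta>)"
  by (simp_all add: F_space_def) (simp add: BV_quot_def)

lemma cn_coordinates_F_space: "cn_coordinates (F_space \<beta>) Phi coords 2"
proof
  show "bij_betw Phi coords (carr (F_space \<beta>))"
    using Phi_inj by (auto simp: bij_betw_def inj_on_def carr_F_space)
qed (auto simp: coords_zero coords_add coords_scaleC Phi_def jump_fun_zero coset_zero jump_fun_add
    vadd_coset jump_fun_scaleC vscale_coset norm_le_quot_norm quot_norm_jump_fun_le)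

lemma interval_coset_in_F_space:
  "I \<in> shift_intervals \<beta> \<Longrightarrow> coset \<beta> (indicator I) \<in> carr (F_space \<beta>)"
  using coset_interval by (auto simp: carr_F_space)

section \<open>The transfer operator\<close>

lemma shift_case_nat [simp]: "shift (case_nat a x) = x"
  by (simp add: shift_def)

lemma case_nat_shift: "case_nat (y 0) (shift y) = y"
  by (auto simp: shift_def fun_eq_iff split: nat.split)

lemma less_fun_case_nat:
  "less_fun (case_nat a x) p \<longleftrightarrow> a < p 0 \<or> a = p 0 \<and> less_fun x (shift p)"
proof
  assume "less_fun (case_nat a x) p"
  then obtain k where k: "case_nat a x k < p k" "\<And>i. i < k \<Longrightarrow> case_nat a x i = p i"
    by (rule less_funE) blast
  show "a < p 0 \<or> a = p 0 \<and> less_fun x (shift p)"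
  proof (cases k)
    case (Suc m)
    have "a = p 0"
      using k(2)[of 0] Suc by simp
    moreover have "less_fun x (shift p)"
      by (rule less_fun_first_diff[of _ m]) (use k(1) k(2)[of "Suc _"] Suc in \<open>auto simp: shift_def\<close>)
    ultimately show ?thesis
      by simp
  qed (use k(1) in simp)
next
  assume "a < p 0 \<or> a = p 0 \<and> less_fun x (shift p)"
  then show "less_fun (case_nat a x) p"
  proof
    assume "a < p 0"
    then show ?thesis
      by (intro less_fun_first_diff[of _ 0]) auto
  next
    assume a: "a = p 0 \<and> less_fun x (shift p)"
    then obtain k where k: "x k < p (Suc k)" "\<And>i. i < k \<Longrightarrow> x i = p (Suc i)"
      by (auto simp: shift_def elim: less_funE)
    show ?thesis
      by (rule less_fun_first_diff[of _ "Suc k"]) (use k a in \<open>auto split: nat.split\<close>)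
  qed
qed

lemma lex_le_case_nat:
  "lex_le (case_nat a x) p \<longleftrightarrow> a < p 0 \<or> a = p 0 \<and> lex_le x (shift p)"
proof -
  have "case_nat a x = p \<longleftrightarrow> a = p 0 \<and> x = shift p"
    using case_nat_shift[of p] by auto
  then show ?thesis
    by (auto simp: lex_le_def less_fun_case_nat)
qed

lemma case_nat_mono: "lex_le x y \<Longrightarrow> lex_le (case_nat a x) (case_nat a y)"
  by (simp add: lex_le_case_nat)

text \<open>Prefixing a digit adds one new constraint, on the whole sequence, and that one is
  inherited by smaller sequences. So the inverse branch through 1 is defined on an initial
  segment.\<close>

lemma cons_one_down:
  assumes "x \<in> X" "case_nat 1 y \<in> X" "lex_le x y"
  shows "case_nat 1 x \<in> X"
proof (rule in_X_I)
  show "case_nat 1 x n \<le> 1" for n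
    using range_X[OF assms(1)] by (auto split: nat.split)
  show "lex_le (\<lambda>k. case_nat 1 x (k + n)) \<omega>" for n
  proof (cases n)
    case 0
    then show ?thesis
      using lex.order.trans[OF case_nat_mono[OF assms(3), of 1] le_seq_one[OF assms(2)]]
      by (simp del: One_nat_def)
  next
    case (Suc m)
    then show ?thesis
      using assms(1) by (simp add: beta_shift_iff)
  qed
qed

lemma potential_eq:
  assumes "y \<in> X"
  shows "potential \<beta> t y = complex_of_real (t * real (y 0))"
  using assms range_X[OF assms, of 0] by (auto simp: potential_def cyl_one_def indicator_def le_Suc_eq)

lemma preimages:
  assumes "x \<in> X"
  shows "{y \<in> X. shift y = x} = insert (case_nat 0 x) ({case_nat 1 x} \<inter> X)"
proof (intro equalityI subsetI)
  fix y assume "y \<in> {y \<in> X. shift y = x}"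
  then show "y \<in> insert (case_nat 0 x) ({case_nat 1 x} \<inter> X)"
    using range_X[of y 0] case_nat_shift[of y] by (auto simp: le_Suc_eq)
qed (use assms cons_zero_in_X in auto)

lemma transfer_fun_eq:
  assumes "x \<in> X"
  shows "transfer_fun \<beta> t f x =
    f (case_nat 0 x) + (if case_nat 1 x \<in> X then complex_of_real (exp t) * f (case_nat 1 x) else 0)"
proof -
  have "case_nat 0 x \<noteq> case_nat 1 x"
    by (metis One_nat_def nat.case(1) zero_neq_one)
  moreover have "potential \<beta> t (case_nat 0 x) = 0"
    using potential_eq[OF cons_zero_in_X[OF assms]] by simp
  moreover have "potential \<beta> t (case_nat 1 x) = of_real t" if "case_nat 1 x \<in> X"
    using potential_eq[OF that] by simp
  ultimately show ?thesis
    unfolding transfer_fun_def preimages[OF assms]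
    by (cases "case_nat 1 x \<in> X") (simp_all add: exp_of_real)
qed

lemma transfer_fun_diff:
  "transfer_fun \<beta> t (\<lambda>x. f x - g x) = (\<lambda>x. transfer_fun \<beta> t f x - transfer_fun \<beta> t g x)"
  by (simp add: transfer_fun_def right_diff_distrib sum_subtractf fun_eq_iff)

text \<open>Both inverse branches preserve the order and carry chains to chains; only the edge of
  the domain \<open>D\<close> of the second branch costs an additional jump.\<close>

lemma transfer_fun_BV:
  assumes f: "f \<in> BV_funs \<beta>"
  shows "transfer_fun \<beta> t f \<in> BV_funs \<beta>"
proof (rule BV_I(1))
  fix n c assume c: "mono_chain n c"
  define D where "D = {x \<in> X. case_nat 1 x \<in> X}"
  define d0 where "d0 i = case_nat 0 (c i)" for i
  \<comment> \<open>Outside \<open>D\<close> the missing preimage is replaced by the maximum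
    \<open>\<omega>\<close>, which keeps the chain increasing. The spurious value
    \<open>f \<omega>\<close> is subtracted again in \<open>L\<close>, by means of the indicator of
    \<open>D\<close>.\<close>
  define d1 where "d1 i = (if c i \<in> D then case_nat 1 (c i) else \<omega>)" for i
  have cX: "c i \<in> X" if "i \<le> n" for i
    using c that by (simp add: mono_chain_def)
  have c_le: "lex_le (c i) (c (Suc i))" if "i < n" for i
    using c that by (simp add: mono_chain_def)
  have D: "x \<in> D" if "y \<in> D" "x \<in> X" "lex_le x y" for x y
    using that cons_one_down[of x y] by (auto simp: D_def)
  have d0: "mono_chain n d0"
    using cX c_le by (simp add: mono_chain_def d0_def cons_zero_in_X case_nat_mono)
  have d1X: "d1 i \<in> X" for i
    by (simp add: d1_def D_def seq_one_in)
  have d1: "mono_chain n d1"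
    unfolding mono_chain_def
  proof (intro conjI allI impI)
    show "d1 i \<in> X" for i
      by (rule d1X)
    show "lex_le (d1 i) (d1 (Suc i))" if "i < n" for i
    proof (cases "c (Suc i) \<in> D")
      case True
      then have "c i \<in> D"
        using D[OF _ cX c_le] that by simp
      then show ?thesis
        using True c_le[OF that] by (simp add: d1_def case_nat_mono)
    next
      case False
      then have "d1 (Suc i) = \<omega>"
        by (simp add: d1_def)
      then show ?thesis
        using le_seq_one[OF d1X] by simp
    qed
  qed
  have L: "transfer_fun \<beta> t f (c i) =
      f (d0 i) + of_real (exp t) * (f (d1 i) - f \<omega> * (1 - indicator D (c i)))" if "i \<le> n" for i
    using cX[OF that] by (simp add: transfer_fun_eq d0_def d1_def D_def indicator_def)
  have tri: "cmod (u + of_real (exp t) * (v + w * z)) \<le> cmod u + exp t * (cmod v + cmod w * cmod z)"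
    for u v w z
  proof -
    have "cmod (v + w * z) \<le> cmod v + cmod w * cmod z"
      using norm_triangle_ineq[of v "w * z"] by (simp add: norm_mult)
    then have "exp t * cmod (v + w * z) \<le> exp t * (cmod v + cmod w * cmod z)"
      by simp
    moreover have "cmod (u + of_real (exp t) * (v + w * z)) \<le> cmod u + exp t * cmod (v + w * z)"
      using norm_triangle_ineq[of u "of_real (exp t) * (v + w * z)"] by (simp add: norm_mult)
    ultimately show ?thesis
      by linarith
  qed
  have "chain_sum (transfer_fun \<beta> t f) n c \<le>
      (\<Sum>i<n. cmod (f (d0 (Suc i)) - f (d0 i)) + exp t * (cmod (f (d1 (Suc i)) - f (d1 i)) +
        cmod (f \<omega>) * cmod (indicator D (c (Suc i)) - indicator D (c i))))"
    unfolding chain_sum_def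
  proof (rule sum_mono)
    fix i assume "i \<in> {..<n}"
    then have eq: "transfer_fun \<beta> t f (c (Suc i)) - transfer_fun \<beta> t f (c i) =
        (f (d0 (Suc i)) - f (d0 i)) + of_real (exp t) * ((f (d1 (Suc i)) - f (d1 i)) +
        f \<omega> * (indicator D (c (Suc i)) - indicator D (c i)))"
      by (simp add: L algebra_simps)
    show "cmod (transfer_fun \<beta> t f (c (Suc i)) - transfer_fun \<beta> t f (c i)) \<le>
        cmod (f (d0 (Suc i)) - f (d0 i)) + exp t * (cmod (f (d1 (Suc i)) - f (d1 i)) +
        cmod (f \<omega>) * cmod (indicator D (c (Suc i)) - indicator D (c i)))"
      unfolding eq by (rule tri)
  qed
  also have "\<dots> = chain_sum f n d0 + exp t * (chain_sum f n d1 + cmod (f \<omega>) * chain_sum (indicator D) n c)"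
    unfolding chain_sum_def sum.distrib sum_distrib_left[symmetric] ..
  also have "\<dots> \<le> variation \<beta> f + exp t * (variation \<beta> f + cmod (f \<omega>) * 1)"
    using chain_sum_le_variation[OF f d0] chain_sum_le_variation[OF f d1] down_set_chain_sum[OF D c]
    by (intro add_mono mult_left_mono) auto
  finally show "chain_sum (transfer_fun \<beta> t f) n c \<le> variation \<beta> f + exp t * (variation \<beta> f + cmod (f \<omega>) * 1)" .
qed

lemma transfer_fun_null:
  assumes "f \<in> null_funs \<beta>"
  shows "transfer_fun \<beta> t f \<in> null_funs \<beta>"
proof -
  have "{x \<in> X. transfer_fun \<beta> t f x \<noteq> 0} \<subseteq> shift ` {y \<in> X. f y \<noteq> 0}"
  proof
    fix x assume "x \<in> {x \<in> X. transfer_fun \<beta> t f x \<noteq> 0}"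
    then have "(\<Sum>y \<in> {y \<in> X. shift y = x}. exp (potential \<beta> t y) * f y) \<noteq> 0"
      by (simp add: transfer_fun_def)
    then obtain y where "y \<in> {y \<in> X. shift y = x}" "exp (potential \<beta> t y) * f y \<noteq> 0"
      by (rule sum.not_neutral_contains_not_neutral)
    then show "x \<in> shift ` {y \<in> X. f y \<noteq> 0}"
      by auto
  qed
  then show ?thesis
    using assms transfer_fun_BV countable_subset[OF _ countable_image]
    by (auto simp: null_funs_def)
qed

lemma transfer_op_coset: "transfer_op \<beta> t (coset \<beta> f) = coset \<beta> (transfer_fun \<beta> t f)"
  unfolding transfer_op_def
proof (rule Union_coset)
  fix g assume "g \<in> coset \<beta> f"
  then have "transfer_fun \<beta> t (\<lambda>x. g x - f x) \<in> null_funs \<beta>"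
    by (intro transfer_fun_null) (simp add: coset_def)
  then show "coset \<beta> (transfer_fun \<beta> t g) = coset \<beta> (transfer_fun \<beta> t f)"
    by (simp add: coset_eq_iff transfer_fun_diff)
qed

text \<open>For \<open>p 0 = 0\<close> only the preimage \<open>0x\<close> can lie below
  \<open>p\<close>, namely if \<open>x\<close> is below \<open>shift p\<close>. For
  \<open>p 0 = 1\<close> the preimage \<open>0x\<close> always does, with weight 1, which gives the
  constant term; \<open>1x\<close> does if \<open>x\<close> is below \<open>shift p\<close>, and is
  then admissible by \<open>cons_one_down\<close>.\<close>

lemma transfer_fun_seg:
  assumes "p \<in> X" "x \<in> X"
  shows "transfer_fun \<beta> t (seg p) x =
    complex_of_real (exp (t * real (p 0))) * seg (shift p) x + of_nat (p 0) * seg \<omega> x"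
proof -
  have down: "case_nat 1 x \<in> X" if "p 0 = 1" "lex_le x (shift p)"
    using cons_one_down[OF assms(2), of "shift p"] assms(1) that case_nat_shift[of p] by simp
  show ?thesis
  proof (cases "p 0 = 0")
    case True
    then show ?thesis
      by (simp add: transfer_fun_eq[OF assms(2)] seg_def lex_le_case_nat)
  next
    case False
    then have "p 0 = 1"
      using range_X[OF assms(1), of 0] by simp
    with down show ?thesis
      using le_seq_one[OF assms(2)]
      by (auto simp: transfer_fun_eq[OF assms(2)] seg_def lex_le_case_nat)
  qed
qed

section \<open>Weights along orbits\<close>

definition ones :: "nat \<Rightarrow> symseq \<Rightarrow> nat" where
  "ones n x = (\<Sum>i<n. x i)"

lemma ones_add: "ones (m + n) x = ones m x + ones n ((shift ^^ m) x)"
  by (induction n) (simp_all add: ones_def shift_pow add.commute)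

lemma ones_le: "x \<in> X \<Longrightarrow> ones n x \<le> n"
  using sum_bounded_above[of "{..<n}" x 1] range_X by (simp add: ones_def)

lemma cmod_exp_birkhoff:
  assumes "x \<in> X"
  shows "cmod (exp (birkhoff_sum n (potential \<beta> t) x)) = exp (t * real (ones n x))"
proof -
  have "birkhoff_sum n (potential \<beta> t) x = complex_of_real (t * real (ones n x))"
    unfolding birkhoff_sum_def using assms
    by (simp add: potential_eq shift_pow_in_X ones_def sum_distrib_left) (simp add: shift_pow)
  then show ?thesis
    by (simp add: norm_exp_eq_Re)
qed

lemma weight_norm_eq: "weight_norm \<beta> t n = (SUP x\<in>X. exp (t * real (ones n x)))"
  unfolding weight_norm_def sup_norm_def by (intro SUP_cong refl cmod_exp_birkhoff)

lemma exp_ones_le_weight_norm: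
  assumes "x \<in> X"
  shows "exp (t * real (ones n x)) \<le> weight_norm \<beta> t n"
  unfolding weight_norm_eq
proof (rule cSUP_upper[OF assms])
  have "t * real (ones n x) \<le> \<bar>t\<bar> * real n" if "x \<in> X" for x
    using ones_le[OF that, of n] by (intro mult_mono) auto
  then show "bdd_above ((\<lambda>x. exp (t * real (ones n x))) ` X)"
    by (intro bdd_aboveI[of _ "exp (\<bar>t\<bar> * real n)"]) auto
qed

lemma weight_norm_le:
  assumes "\<And>x. x \<in> X \<Longrightarrow> exp (t * real (ones n x)) \<le> B"
  shows "weight_norm \<beta> t n \<le> B"
  unfolding weight_norm_eq by (rule cSUP_least) (use assms seq_one_in in auto)

lemma weight_norm_pos: "0 < weight_norm \<beta> t n"
  using less_le_trans[OF exp_gt_zero exp_ones_le_weight_norm[OF seq_one_in]] .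

lemma weight_norm_add: "weight_norm \<beta> t (m + n) \<le> weight_norm \<beta> t m * weight_norm \<beta> t n"
proof (rule weight_norm_le)
  fix x assume "x \<in> X"
  then have "exp (t * real (ones m x)) * exp (t * real (ones n ((shift ^^ m) x))) \<le>
      weight_norm \<beta> t m * weight_norm \<beta> t n"
    by (intro mult_mono exp_ones_le_weight_norm shift_pow_in_X) (auto intro: less_imp_le weight_norm_pos)
  then show "exp (t * real (ones (m + n) x)) \<le> weight_norm \<beta> t m * weight_norm \<beta> t n"
    by (simp add: ones_add distrib_left exp_add)
qed

text \<open>By submultiplicativity blocks of length \<open>m\<close> split off, each costing at most
  \<open>s ^ m\<close>; \<open>C\<close> takes care of the remainder, which is shorter than
  \<open>m\<close>.\<close>

lemma weight_norm_geometric: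
  assumes "s > 0" "m \<ge> 1" "weight_norm \<beta> t m \<le> s ^ m"
  obtains C where "C > 0" "\<And>n. weight_norm \<beta> t n \<le> C * s ^ n"
proof -
  define C where "C = (\<Sum>i<m. weight_norm \<beta> t i / s ^ i)"
  have pos: "0 < weight_norm \<beta> t i / s ^ i" for i
    using weight_norm_pos assms(1) by simp
  have "weight_norm \<beta> t n \<le> C * s ^ n" for n
  proof (induction n rule: less_induct)
    case (less n)
    show ?case
    proof (cases "n < m")
      case True
      then have "weight_norm \<beta> t n / s ^ n \<le> C"
        unfolding C_def using pos by (intro member_le_sum) (auto intro: less_imp_le)
      then show ?thesis
        using assms(1) by (simp add: pos_divide_le_eq)
    next
      case False
      then have "weight_norm \<beta> t n \<le> weight_norm \<beta> t m * weight_norm \<beta> t (n - m)"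
        using weight_norm_add[of t m "n - m"] by simp
      also have "\<dots> \<le> s ^ m * (C * s ^ (n - m))"
        using less[of "n - m"] False assms weight_norm_pos
        by (intro mult_mono) (auto intro: less_imp_le)
      also have "\<dots> = C * s ^ n"
        using False by (simp add: power_add[symmetric] mult.left_commute)
      finally show ?thesis .
    qed
  qed
  moreover have "C > 0"
    unfolding C_def using pos assms(2) by (intro sum_pos) (auto simp: lessThan_empty_iff bot_nat_def)
  ultimately show thesis
    using that by blast
qed

lemma r_bound_geometric:
  assumes "r_bound \<beta> t < ereal R"
  obtains s C where "0 < s" "s < R" "C > 0" "\<And>n. weight_norm \<beta> t n \<le> C * s ^ n"
proof -
  obtain s where s: "r_bound \<beta> t < ereal s" "s < R"
    using ereal_dense2[OF assms] by auto
  from Limsup_lessD[OF s(1)[unfolded r_bound_def]]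
  have "\<forall>\<^sub>F n in sequentially. root n (weight_norm \<beta> t n) < s"
    by simp
  then obtain m where m: "m \<ge> 1" "root m (weight_norm \<beta> t m) < s"
    unfolding eventually_sequentially by (metis nle_le)
  have root: "0 < root m (weight_norm \<beta> t m)"
    using m(1) weight_norm_pos by simp
  have "weight_norm \<beta> t m = root m (weight_norm \<beta> t m) ^ m"
    using m(1) weight_norm_pos[of t m] by (simp add: real_root_pow_pos)
  also have "\<dots> \<le> s ^ m"
    using m(2) root by (intro power_mono) auto
  finally obtain C where "C > 0" "\<And>n. weight_norm \<beta> t n \<le> C * s ^ n"
    using weight_norm_geometric[of s m t] m root by auto
  with s(2) root m(2) show thesis
    by (intro that[of s C]) auto
qed

text \<open>A single good index suffices: with \<open>s\<close> the \<open>m\<close>-th root of its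
  weight, the geometric bound holds at radius \<open>s < l\<close>, and the \<open>n\<close>-th
  roots of the constant tend to 1. This yields a strict inequality for the limsup.\<close>

lemma r_bound_less:
  assumes m: "m \<ge> 1" "weight_norm \<beta> t m < l ^ m" and l: "l > 0"
  shows "r_bound \<beta> t < ereal l"
proof -
  define s where "s = root m (weight_norm \<beta> t m)"
  have s: "s > 0" "s ^ m = weight_norm \<beta> t m"
    using m(1) weight_norm_pos[of t m] by (simp_all add: s_def real_root_pow_pos)
  have "s < l"
    using m s l by (intro power_less_imp_less_base[of s m l]) auto
  obtain C where C: "C > 0" "\<And>n. weight_norm \<beta> t n \<le> C * s ^ n"
    using weight_norm_geometric[of s m t] s m(1) by auto
  have "root n (weight_norm \<beta> t n) \<le> root n C * s" if "n \<ge> 1" for n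
  proof -
    have "root n (weight_norm \<beta> t n) \<le> root n (C * s ^ n)"
      using that C by (intro real_root_le_mono) auto
    also have "\<dots> = root n C * s"
      using that s(1) by (simp add: real_root_mult real_root_power_cancel)
    finally show ?thesis .
  qed
  then have "\<forall>\<^sub>F n in sequentially. ereal (root n (weight_norm \<beta> t n)) \<le> ereal (root n C * s)"
    unfolding eventually_sequentially by (intro exI[of _ 1]) simp
  then have "r_bound \<beta> t \<le> limsup (\<lambda>n. ereal (root n C * s))"
    unfolding r_bound_def by (rule Limsup_mono)
  also have "(\<lambda>n. root n C * s) \<longlonglongrightarrow> 1 * s"
    by (intro tendsto_intros LIMSEQ_root_const C)
  then have "limsup (\<lambda>n. ereal (root n C * s)) = ereal s"
    by (intro lim_imp_Limsup) (auto simp: lim_ereal)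
  finally show ?thesis
    using \<open>s < l\<close> by (simp add: le_less_trans)
qed

section \<open>Growth of the weights against the eigenvalue\<close>

context
  fixes t l :: real and \<phi> :: "symseq \<Rightarrow> real"
  assumes l_pos: "l > 0"
    and phi_range: "x \<in> X \<Longrightarrow> 0 \<le> \<phi> x" "x \<in> X \<Longrightarrow> \<phi> x \<le> 1"
    and phi_one: "\<phi> \<omega> = 1"
    and phi_eq: "x \<in> X \<Longrightarrow> l * \<phi> x = exp (t * real (x 0)) * \<phi> (shift x) + real (x 0)"
begin

definition weight :: "nat \<Rightarrow> symseq \<Rightarrow> real" where
  "weight n x = exp (t * real (ones n x)) / l ^ n"

lemma weight_pos: "0 < weight n x"
  using l_pos by (simp add: weight_def)

lemma weight_nonneg: "0 \<le> weight n x"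
  by (rule less_imp_le[OF weight_pos])

lemma weight_0 [simp]: "weight 0 x = 1"
  by (simp add: weight_def ones_def)

lemma weight_add: "weight (m + n) x = weight m x * weight n ((shift ^^ m) x)"
  by (simp add: weight_def ones_add distrib_left exp_add power_add)

lemma weight_Suc: "weight (Suc n) x = weight n x * exp (t * real (x n)) / l"
  using weight_add[of n 1 x] by (simp add: weight_def ones_def shift_pow)

lemma phi_iterate:
  assumes "x \<in> X"
  shows "l * \<phi> x = (\<Sum>k<n. real (x k) * weight k x) + l * weight n x * \<phi> ((shift ^^ n) x)"
proof (induction n)
  case (Suc n)
  have "l * \<phi> ((shift ^^ n) x) = exp (t * real (x n)) * \<phi> ((shift ^^ Suc n) x) + real (x n)"
    using phi_eq[OF shift_pow_in_X[OF assms], of n] by (simp add: shift_pow shift_def)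
  then have "l * weight n x * \<phi> ((shift ^^ n) x) =
      weight n x * (exp (t * real (x n)) * \<phi> ((shift ^^ Suc n) x) + real (x n))"
    by (simp add: mult.left_commute mult.assoc)
  also have "\<dots> = real (x n) * weight n x + l * weight (Suc n) x * \<phi> ((shift ^^ Suc n) x)"
    using l_pos by (simp add: weight_Suc algebra_simps)
  finally show ?case
    using Suc by simp
qed simp

lemma sum_weight_le:
  assumes "x \<in> X"
  shows "(\<Sum>k<n. real (x k) * weight k x) \<le> l"
proof -
  have "0 \<le> l * weight n x * \<phi> ((shift ^^ n) x)"
    using phi_range(1)[OF shift_pow_in_X[OF assms]] weight_pos[of n x] l_pos by simp
  moreover have "l * \<phi> x \<le> l * 1"
    using phi_range(2)[OF assms] l_pos by (intro mult_left_mono) auto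
  ultimately show ?thesis
    using phi_iterate[OF assms, of n] by simp
qed

text \<open>At \<open>\<omega>\<close> the functional equation reads
  \<open>l = exp t * \<phi> (shift \<omega>) + 1\<close>. The value
  \<open>\<phi> (shift \<omega>)\<close> is positive because \<open>\<omega>\<close> contains a
  further one, whose term in \<open>phi_iterate\<close> is positive.\<close>

lemma eigenvalue_gt_1: "l > 1"
proof -
  have X: "shift \<omega> \<in> X"
    by (rule shift_in_X[OF seq_one_in])
  have "\<phi> (shift \<omega>) \<noteq> 0"
  proof
    assume 0: "\<phi> (shift \<omega>) = 0"
    obtain k where k: "k \<ge> 1" "\<omega> k > 0"
      using seq_one_infinitely_many_ones by blast
    define m where "m = k - 1"
    have m: "shift \<omega> m > 0"
      using k by (simp add: m_def shift_def)
    have "real (shift \<omega> m) * weight m (shift \<omega>) \<le> (\<Sum>i<Suc m. real (shift \<omega> i) * weight i (shift \<omega>))"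
      by (intro member_le_sum) (auto simp: weight_nonneg)
    also have "\<dots> \<le> 0"
    proof -
      have "0 \<le> l * weight (Suc m) (shift \<omega>) * \<phi> ((shift ^^ Suc m) (shift \<omega>))"
        using l_pos by (intro mult_nonneg_nonneg weight_nonneg phi_range shift_pow_in_X[OF X]) simp
      then show ?thesis
        using phi_iterate[OF X, of "Suc m"] unfolding 0 by linarith
    qed
    finally show False
      using m weight_pos[of m "shift \<omega>"] by (simp add: mult_le_0_iff)
  qed
  then have "0 < \<phi> (shift \<omega>)"
    using phi_range(1)[OF X] by simp
  then show ?thesis
    using phi_eq[OF seq_one_in] by (simp add: phi_one seq_one_first)
qed

text \<open>At a zero the weight decreases, since \<open>l > 1\<close>. At a one,
  \<open>sum_weight_le\<close> bounds the weight just before by \<open>l\<close>, so the factor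
  \<open>exp t / l\<close> brings it to at most \<open>exp t\<close>.\<close>

lemma weight_le:
  assumes "t \<ge> 0" "x \<in> X"
  shows "weight n x \<le> exp t"
proof (induction n)
  case (Suc n)
  have "x n = 0 \<or> x n = 1"
    using range_X[OF assms(2), of n] by auto
  then show ?case
  proof
    assume "x n = 0"
    then have "weight (Suc n) x \<le> weight n x"
      using weight_pos[of n x] eigenvalue_gt_1 by (simp add: weight_Suc divide_le_eq)
    with Suc show ?thesis
      by simp
  next
    assume x: "x n = 1"
    have "real (x n) * weight n x \<le> (\<Sum>i<Suc n. real (x i) * weight i x)"
      by (intro member_le_sum) (auto simp: weight_nonneg)
    also have "\<dots> \<le> l"
      by (rule sum_weight_le[OF assms(2)])
    finally show ?thesis
      using x l_pos by (simp add: weight_Suc divide_le_eq)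
  qed
qed (use assms in simp)

text \<open>A weight that is not small at time \<open>n\<close> was not small at any earlier time; then
  \<open>sum_weight_le\<close> bounds the number of ones up to time \<open>n\<close>, and the factor \<open>1 / l ^ n\<close> wins.\<close>

lemma weight_dichotomy:
  assumes t: "t \<ge> 0" and x: "x \<in> X" and e: "e > 0"
  shows "weight n x \<le> max e (exp (t * (l * exp t / e)) / l ^ n)"
proof (cases "weight n x \<le> e")
  case False
  have early: "e / exp t \<le> weight i x" if "i < n" for i
  proof -
    have "weight n x = weight i x * weight (n - i) ((shift ^^ i) x)"
      using weight_add[of i "n - i" x] that by simp
    also have "\<dots> \<le> weight i x * exp t"
      using weight_pos[of i x] weight_le[OF t shift_pow_in_X[OF x]] by (intro mult_left_mono) auto
    finally show ?thesis
      using False by (simp add: pos_divide_le_eq)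
  qed
  have "real (ones n x) * (e / exp t) = (\<Sum>k<n. real (x k) * (e / exp t))"
    by (simp add: ones_def sum_distrib_right sum_divide_distrib)
  also have "\<dots> \<le> (\<Sum>k<n. real (x k) * weight k x)"
    by (intro sum_mono mult_left_mono early) auto
  also have "\<dots> \<le> l"
    by (rule sum_weight_le[OF x])
  finally have "real (ones n x) \<le> l * exp t / e"
    using e by (simp add: field_simps)
  then have "t * real (ones n x) \<le> t * (l * exp t / e)"
    using t by (rule mult_left_mono)
  then have "exp (t * real (ones n x)) \<le> exp (t * (l * exp t / e))"
    by (simp only: exp_le_cancel_iff)
  then show ?thesis
    using l_pos by (simp add: weight_def divide_right_mono le_max_iff_disj)
qed simp

lemma weight_norm_ratio: "(\<lambda>n. weight_norm \<beta> t n / l ^ n) \<longlonglongrightarrow> 0"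
proof (cases "t \<ge> 0")
  case True
  show ?thesis
  proof (rule LIMSEQ_I)
    fix r :: real assume r: "r > 0"
    define e where "e = r / 2"
    define K where "K = exp (t * (l * exp t / e))"
    have e: "e > 0" "e < r"
      using r by (simp_all add: e_def)
    have "(\<lambda>n. K * (1 / l) ^ n) \<longlonglongrightarrow> K * 0"
      using eigenvalue_gt_1 by (intro tendsto_intros LIMSEQ_realpow_zero) auto
    then have "\<forall>\<^sub>F n in sequentially. K * (1 / l) ^ n < e"
      using e by (intro order_tendstoD(2)) auto
    then obtain N where N: "\<And>n. n \<ge> N \<Longrightarrow> K * (1 / l) ^ n < e"
      unfolding eventually_sequentially by blast
    have "norm (weight_norm \<beta> t n / l ^ n - 0) < r" if "n \<ge> N" for n
    proof -
      have "weight_norm \<beta> t n \<le> e * l ^ n"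
      proof (rule weight_norm_le)
        fix x assume "x \<in> X"
        then have "weight n x \<le> max e (K / l ^ n)"
          unfolding K_def by (rule weight_dichotomy[OF True _ e(1)])
        also have "\<dots> = e"
          using N[OF that] by (simp add: power_one_over)
        finally show "exp (t * real (ones n x)) \<le> e * l ^ n"
          using l_pos by (simp add: weight_def pos_divide_le_eq)
      qed
      then have "weight_norm \<beta> t n / l ^ n \<le> e"
        using l_pos by (simp add: pos_divide_le_eq)
      moreover have "0 \<le> weight_norm \<beta> t n / l ^ n"
        using weight_norm_pos[of t n] l_pos by simp
      ultimately show ?thesis
        using e by simp
    qed
    then show "\<exists>no. \<forall>n\<ge>no. norm (weight_norm \<beta> t n / l ^ n - 0) < r"
      by blast
  qed
next
  case False
  \<comment> \<open>For negative \<open>t\<close> the exponents are nonpositive, and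
    \<open>l > 1\<close> alone forces the decay.\<close>
  have "weight_norm \<beta> t n \<le> 1" for n
    by (rule weight_norm_le) (use False in \<open>simp add: mult_nonpos_nonneg\<close>)
  then have le: "weight_norm \<beta> t n / l ^ n \<le> (1 / l) ^ n" for n
    using l_pos by (simp add: power_one_over divide_right_mono)
  have nonneg: "0 \<le> weight_norm \<beta> t n / l ^ n" for n
    using weight_norm_pos[of t n] l_pos by simp
  have lim: "(\<lambda>n. (1 / l) ^ n) \<longlonglongrightarrow> 0"
    using eigenvalue_gt_1 by (intro LIMSEQ_realpow_zero) auto
  show ?thesis
    by (rule tendsto_sandwich[OF always_eventually always_eventually tendsto_const lim])
      (use le nonneg in blast)+
qed

lemma r_bound_less_eigenvalue: "r_bound \<beta> t < ereal l"
proof -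
  have "\<forall>\<^sub>F n in sequentially. weight_norm \<beta> t n / l ^ n < 1"
    by (rule order_tendstoD(2)[OF weight_norm_ratio]) simp
  then obtain N where "\<And>n. n \<ge> N \<Longrightarrow> weight_norm \<beta> t n / l ^ n < 1"
    unfolding eventually_sequentially by blast
  from this[of "Suc N"] show ?thesis
    using l_pos by (intro r_bound_less[of "Suc N"]) (auto simp: pos_divide_less_eq)
qed

end

section \<open>The function on the beta-shift attached to an eigenpair\<close>

lemma coset_seg_in_F_space: "p \<in> X \<Longrightarrow> coset \<beta> (seg p) \<in> carr (F_space \<beta>)"
  using Phi_basis_interval[of p] interval_coset_in_F_space by auto

lemma F_space_add:
  "v \<in> carr (F_space \<beta>) \<Longrightarrow> w \<in> carr (F_space \<beta>) \<Longrightarrow> vadd (BV_quot \<beta>) v w \<in> carr (F_space \<beta>)"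
  using cn_subspace_Phi unfolding cn_subspace_def carr_F_space by blast

lemma F_space_scale:
  "v \<in> carr (F_space \<beta>) \<Longrightarrow> vscale (BV_quot \<beta>) z v \<in> carr (F_space \<beta>)"
  using cn_subspace_Phi unfolding cn_subspace_def carr_F_space by blast

text \<open>The bounds are positivity of the functional on \<open>seg p\<close> and on
  \<open>seg \<omega> - seg p\<close>, the second being nonnegative because
  \<open>seg \<omega>\<close> is 1 on \<open>X\<close>. The equation is the dual eigenvalue equation
  evaluated through \<open>transfer_fun_seg\<close>.\<close>

lemma eigenpair_phi:
  assumes "eigenpair \<beta> t l \<nu>"
  defines "\<phi> \<equiv> \<lambda>p. Re (\<nu> (coset \<beta> (seg p)))"
  shows "p \<in> X \<Longrightarrow> 0 \<le> \<phi> p" and "p \<in> X \<Longrightarrow> \<phi> p \<le> 1" and "\<phi> \<omega> = 1"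
    and "p \<in> X \<Longrightarrow> l * \<phi> p = exp (t * real (p 0)) * \<phi> (shift p) + real (p 0)"
proof -
  have add: "\<nu> (vadd (BV_quot \<beta>) v w) = \<nu> v + \<nu> w"
    if "v \<in> carr (F_space \<beta>)" "w \<in> carr (F_space \<beta>)" for v w
    using assms(1) that by (simp add: eigenpair_def cn_dual_def)
  have scale: "\<nu> (vscale (BV_quot \<beta>) z v) = z * \<nu> v" if "v \<in> carr (F_space \<beta>)" for z v
    using assms(1) that by (simp add: eigenpair_def cn_dual_def)
  have pos: "0 \<le> Re (\<nu> (coset \<beta> f))"
    if "coset \<beta> f \<in> carr (F_space \<beta>)" "\<And>x. x \<in> X \<Longrightarrow> f x \<in> \<real>\<^sub>\<ge>\<^sub>0" for f
  proof -
    have "\<nu> (coset \<beta> f) \<in> \<real>\<^sub>\<ge>\<^sub>0"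
      using assms(1) that coset_self[of f] unfolding eigenpair_def by blast
    then show ?thesis
      by (simp add: complex_nonneg_Reals_iff)
  qed
  have "coset \<beta> (seg \<omega>) = coset \<beta> (\<lambda>_. 1)"
    by (rule coset_cong) (simp add: seg_def le_seq_one)
  then have one: "\<nu> (coset \<beta> (seg \<omega>)) = 1"
    using assms(1) by (simp add: eigenpair_def)
  then show "\<phi> \<omega> = 1"
    by (simp add: \<phi>_def)
  show "0 \<le> \<phi> p" if "p \<in> X"
    unfolding \<phi>_def by (rule pos[OF coset_seg_in_F_space[OF that]]) (simp add: seg_def)
  show "\<phi> p \<le> 1" if p: "p \<in> X"
  proof -
    have eq: "coset \<beta> (\<lambda>x. seg \<omega> x + (-1) * seg p x) =
        vadd (BV_quot \<beta>) (coset \<beta> (seg \<omega>)) (vscale (BV_quot \<beta>) (-1) (coset \<beta> (seg p)))"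
      by (simp only: vadd_coset vscale_coset)
    have "0 \<le> Re (\<nu> (coset \<beta> (\<lambda>x. seg \<omega> x + (-1) * seg p x)))"
    proof (rule pos)
      show "coset \<beta> (\<lambda>x. seg \<omega> x + (-1) * seg p x) \<in> carr (F_space \<beta>)"
        unfolding eq by (intro F_space_add F_space_scale coset_seg_in_F_space p seq_one_in)
    qed (simp add: seg_def le_seq_one)
    then show ?thesis
      unfolding eq using one
      by (simp add: \<phi>_def add scale F_space_scale coset_seg_in_F_space p seq_one_in)
  qed
  show "l * \<phi> p = exp (t * real (p 0)) * \<phi> (shift p) + real (p 0)" if p: "p \<in> X"
  proof -
    have "of_real l * \<nu> (coset \<beta> (seg p)) = \<nu> (transfer_op \<beta> t (coset \<beta> (seg p)))"
      using assms(1) coset_seg_in_F_space[OF p] by (simp add: eigenpair_def)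
    also have "transfer_op \<beta> t (coset \<beta> (seg p)) =
        coset \<beta> (\<lambda>x. complex_of_real (exp (t * real (p 0))) * seg (shift p) x + of_nat (p 0) * seg \<omega> x)"
      unfolding transfer_op_coset by (rule coset_cong) (rule transfer_fun_seg[OF p])
    also have "\<dots> = vadd (BV_quot \<beta>)
        (vscale (BV_quot \<beta>) (of_real (exp (t * real (p 0)))) (coset \<beta> (seg (shift p))))
        (vscale (BV_quot \<beta>) (of_nat (p 0)) (coset \<beta> (seg \<omega>)))"
      by (simp only: vadd_coset vscale_coset)
    also have "\<nu> \<dots> = of_real (exp (t * real (p 0))) * \<nu> (coset \<beta> (seg (shift p))) + of_nat (p 0) * 1"
      by (simp only: add scale F_space_scale coset_seg_in_F_space shift_in_X[OF p] seq_one_in one)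
    finally have "Re (of_real l * \<nu> (coset \<beta> (seg p))) =
        Re (of_real (exp (t * real (p 0))) * \<nu> (coset \<beta> (seg (shift p))) + of_nat (p 0) * 1)"
      by simp
    then show ?thesis
      by (simp add: \<phi>_def)
  qed
qed

section \<open>The transfer operator in coordinates\<close>

context
  fixes t :: real
begin

text \<open>The value 0 off \<open>P\<close> makes \<open>push\<close> bounded on all of
  \<open>\<ell>\<^sup>1\<close>; for arbitrary sequences the first entry, and with it the
  exponential, may be unbounded.\<close>

definition step_weight :: "symseq \<Rightarrow> complex" where
  "step_weight p = (if p \<in> P then of_real (exp (t * real (p 0))) else 0)"

definition orbit_weight :: "nat \<Rightarrow> symseq \<Rightarrow> complex" where
  "orbit_weight n p = (\<Prod>i<n. step_weight ((shift ^^ i) p))"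

definition push :: "symseq ell1 \<Rightarrow> symseq ell1" where
  "push = ell1_extend (\<lambda>p. step_weight p *\<^sub>C basis_ell1 (shift p))"

definition first_one :: "symseq ell1 \<Rightarrow> complex" where
  "first_one = ell1_extend (\<lambda>p. if p \<in> P then of_nat (p 0) else 0)"

text \<open>The Neumann series of the inverse of \<open>z - push\<close> at a basis vector: powers
  of \<open>push\<close> only move the vector along the orbit of \<open>p\<close> and multiply it by
  \<open>orbit_weight\<close>.\<close>

definition orbit_series :: "complex \<Rightarrow> symseq \<Rightarrow> symseq ell1" where
  "orbit_series z p = (\<Sum>n. (orbit_weight n p / z ^ Suc n) *\<^sub>C basis_ell1 ((shift ^^ n) p))"

definition push_resolvent :: "complex \<Rightarrow> symseq ell1 \<Rightarrow> symseq ell1" where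
  "push_resolvent z = ell1_extend (orbit_series z)"

lemma orbit_weight_0 [simp]: "orbit_weight 0 p = 1"
  by (simp add: orbit_weight_def)

lemma orbit_weight_Suc: "orbit_weight (Suc n) p = orbit_weight n p * step_weight ((shift ^^ n) p)"
  by (simp add: orbit_weight_def)

lemma orbit_weight_Suc_shift: "orbit_weight (Suc n) p = step_weight p * orbit_weight n (shift p)"
  unfolding orbit_weight_def by (subst prod.lessThan_Suc_shift) (simp add: funpow_Suc_right del: funpow.simps)

lemma shift_pow_in_P: "p \<in> P \<Longrightarrow> (shift ^^ n) p \<in> P"
  by (induction n) (simp_all add: shift_in_P)

lemma orbit_weight_bound: "cmod (orbit_weight n p) \<le> weight_norm \<beta> t n"
proof (cases "p \<in> P")
  case True
  have "orbit_weight n p = of_real (exp (t * real (ones n p)))"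
  proof (induction n)
    case (Suc n)
    then show ?case
      using shift_pow_in_P[OF True, of n]
      by (simp add: orbit_weight_Suc step_weight_def shift_pow ones_def distrib_left exp_add)
  qed (simp add: ones_def)
  then show ?thesis
    using exp_ones_le_weight_norm[OF P_subset[OF True]] by simp
next
  case False
  show ?thesis
  proof (cases n)
    case 0
    then show ?thesis
      using exp_ones_le_weight_norm[OF seq_one_in, of t 0] by (simp add: ones_def)
  next
    case (Suc m)
    then show ?thesis
      using False weight_norm_pos[of t n] by (simp add: orbit_weight_Suc_shift step_weight_def less_imp_le)
  qed
qed

lemma step_weight_bound: "cmod (step_weight p) \<le> exp \<bar>t\<bar>"
proof (cases "p \<in> P")
  case True
  have "t * real (p 0) \<le> \<bar>t\<bar> * 1"
    using range_X[OF P_subset[OF True], of 0] by (intro mult_mono) auto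
  with True show ?thesis
    by (simp add: step_weight_def)
qed (simp add: step_weight_def)

lemma first_one_bound: "cmod (if p \<in> P then of_nat (p 0) else 0) \<le> 1"
  using range_X[OF P_subset, of p 0] by simp

lemma bounded_clinear_push: "bounded_clinear push"
  unfolding push_def
  by (rule bounded_clinear_ell1_extend[where B = "exp \<bar>t\<bar>"]) (simp add: step_weight_bound)

lemma bounded_clinear_first_one: "bounded_clinear first_one"
  unfolding first_one_def by (rule bounded_clinear_ell1_extend[OF first_one_bound])

lemma push_basis [simp]: "push (basis_ell1 p) = step_weight p *\<^sub>C basis_ell1 (shift p)"
  by (simp add: push_def)

lemma first_one_basis [simp]: "first_one (basis_ell1 p) = (if p \<in> P then of_nat (p 0) else 0)"
  by (simp add: first_one_def)

lemma push_resolvent_basis [simp]: "push_resolvent z (basis_ell1 p) = orbit_series z p"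
  by (simp add: push_resolvent_def)

lemma coords_invariant:
  assumes G: "bounded_clinear G" and "\<And>p. p \<in> P \<Longrightarrow> G (basis_ell1 p) \<in> coords" and "a \<in> coords"
  shows "G a \<in> coords"
  unfolding coords_def
proof (intro CollectI allI impI)
  fix q assume "q \<notin> P"
  show "coeff (G a) q = 0"
  proof (rule ell1_op_eq_on_support[where G = "\<lambda>a. coeff (G a) q" and H = "\<lambda>_. 0"])
    show "bounded_clinear (\<lambda>a. coeff (G a) q)"
      by (rule bounded_clinear_compose[OF bounded_clinear_coeff G])
    show "bounded_clinear (\<lambda>_::symseq ell1. 0 :: complex)"
      by (rule bounded_clinearI[where K = 0]) auto
    fix p assume "coeff a p \<noteq> 0"
    then have "p \<in> P"
      using assms(3) by (auto simp: coords_def)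
    then show "coeff (G (basis_ell1 p)) q = 0"
      using assms(2) \<open>q \<notin> P\<close> by (auto simp: coords_def)
  qed
qed

context
  fixes s C :: real and z :: complex
  assumes s: "0 < s" "C > 0" "\<And>n. weight_norm \<beta> t n \<le> C * s ^ n" and z: "s < cmod z"
begin

lemma z_nonzero: "z \<noteq> 0"
  using s(1) z by auto

lemma orbit_term_bound:
  "norm ((orbit_weight n p / z ^ Suc n) *\<^sub>C basis_ell1 ((shift ^^ n) p)) \<le> C / cmod z * (s / cmod z) ^ n"
proof -
  have "cmod (orbit_weight n p) / cmod z ^ Suc n \<le> C * s ^ n / cmod z ^ Suc n"
    using orbit_weight_bound[of n p] s(3)[of n] by (intro divide_right_mono) auto
  then show ?thesis
    by (simp add: norm_divide norm_mult norm_power power_divide mult.commute)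
qed

lemma geometric: "summable (\<lambda>n. C / cmod z * (s / cmod z) ^ n)"
proof (intro summable_mult summable_geometric)
  show "norm (s / cmod z) < 1"
    using s(1) z z_nonzero by (simp add: divide_less_eq_1_pos)
qed

lemma orbit_series_summable:
  "summable (\<lambda>n. (orbit_weight n p / z ^ Suc n) *\<^sub>C basis_ell1 ((shift ^^ n) p))"
  by (rule summable_comparison_test'[OF geometric, of 0]) (rule orbit_term_bound)

lemma orbit_series_bound: "norm (orbit_series z p) \<le> (\<Sum>n. C / cmod z * (s / cmod z) ^ n)"
  unfolding orbit_series_def by (rule norm_suminf_le[OF orbit_term_bound geometric])

lemma orbit_series_apply:
  assumes "bounded_clinear (G :: symseq ell1 \<Rightarrow> 'b::complex_banach)"
  shows "(\<lambda>n. (orbit_weight n p / z ^ Suc n) *\<^sub>C G (basis_ell1 ((shift ^^ n) p))) sums G (orbit_series z p)"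
  using bounded_linear.sums[OF bounded_clinear_bounded_linear[OF assms]
      summable_sums[OF orbit_series_summable]]
  by (simp add: orbit_series_def bounded_clinear_scaleC[OF assms])

lemma bounded_clinear_push_resolvent: "bounded_clinear (push_resolvent z)"
  unfolding push_resolvent_def by (rule bounded_clinear_ell1_extend[OF orbit_series_bound])

text \<open>Dropping the first term of the series describes both \<open>push\<close> applied to the
  series of \<open>p\<close> and the weighted series of \<open>shift p\<close>. Comparing with this
  tail gives the right and the left inverse identity.\<close>

lemma orbit_series_tail:
  "(\<lambda>n. (orbit_weight (Suc n) p / z ^ Suc n) *\<^sub>C basis_ell1 ((shift ^^ Suc n) p)) sums
    (z *\<^sub>C orbit_series z p - basis_ell1 p)"
proof -
  have "(\<lambda>n. (orbit_weight n p / z ^ n) *\<^sub>C basis_ell1 ((shift ^^ n) p)) sums (z *\<^sub>C orbit_series z p)"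
    using orbit_series_apply[OF bounded_clinear_const_scaleC[OF bounded_clinear_ident], of p z] z_nonzero
    by (simp add: field_simps)
  from this[unfolded sums_Suc_iff[symmetric, where f = "\<lambda>n. (orbit_weight n p / z ^ n) *\<^sub>C basis_ell1 ((shift ^^ n) p)"]]
  show ?thesis
    by (subst sums_Suc_iff) (simp del: funpow.simps)
qed

lemma push_orbit_series: "push (orbit_series z p) = z *\<^sub>C orbit_series z p - basis_ell1 p"
  using orbit_series_apply[OF bounded_clinear_push, of p] orbit_series_tail[of p]
  by (rule_tac sums_unique2) (simp_all add: orbit_weight_Suc)

lemma orbit_series_shift: "step_weight p *\<^sub>C orbit_series z (shift p) = z *\<^sub>C orbit_series z p - basis_ell1 p"
proof (rule sums_unique2)
  show "(\<lambda>n. (orbit_weight (Suc n) p / z ^ Suc n) *\<^sub>C basis_ell1 ((shift ^^ Suc n) p)) sums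
      (step_weight p *\<^sub>C orbit_series z (shift p))"
    using orbit_series_apply[OF bounded_clinear_const_scaleC[OF bounded_clinear_ident], of "shift p" "step_weight p"]
    by (simp add: orbit_weight_Suc_shift funpow_Suc_right mult.commute del: funpow.simps)
qed (rule orbit_series_tail)

lemma push_resolvent_right: "z *\<^sub>C push_resolvent z a - push (push_resolvent z a) = a"
proof (rule bounded_clinear_eqI)
  show "bounded_clinear (\<lambda>a. z *\<^sub>C push_resolvent z a - push (push_resolvent z a))"
    by (intro bounded_clinear_minus bounded_clinear_const_scaleC bounded_clinear_push_resolvent
        bounded_clinear_compose[OF bounded_clinear_push])
qed (simp_all add: bounded_clinear_ident push_orbit_series)

lemma push_resolvent_left: "push_resolvent z (z *\<^sub>C a - push a) = a"
proof (rule bounded_clinear_eqI[where G = "\<lambda>a. push_resolvent z (z *\<^sub>C a - push a)"])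
  show "bounded_clinear (\<lambda>a. push_resolvent z (z *\<^sub>C a - push a))"
    by (intro bounded_clinear_minus bounded_clinear_const_scaleC bounded_clinear_ident
        bounded_clinear_compose[OF bounded_clinear_push_resolvent] bounded_clinear_push)
qed (simp_all add: bounded_clinear_ident bounded_clinear_diff[OF bounded_clinear_push_resolvent]
    bounded_clinear_scaleC[OF bounded_clinear_push_resolvent] orbit_series_shift)

lemma push_resolvent_coords: "a \<in> coords \<Longrightarrow> push_resolvent z a \<in> coords"
proof (rule coords_invariant[OF bounded_clinear_push_resolvent])
  fix p assume p: "p \<in> P"
  show "push_resolvent z (basis_ell1 p) \<in> coords"
    unfolding coords_def
  proof (intro CollectI allI impI)
    fix q assume "q \<notin> P"
    then have "coeff (basis_ell1 ((shift ^^ n) p)) q = 0" for n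
      using shift_pow_in_P[OF p, of n] by auto
    then show "coeff (push_resolvent z (basis_ell1 p)) q = 0"
      using orbit_series_apply[OF bounded_clinear_coeff, of p q] by (simp add: sums_iff)
  qed
qed

lemma first_one_sums:
  "(\<lambda>n. orbit_weight n \<omega> * of_nat (\<omega> n) / z ^ Suc n) sums first_one (push_resolvent z (basis_ell1 \<omega>))"
  using orbit_series_apply[OF bounded_clinear_first_one, of \<omega>] shift_pow_in_P[OF seq_one_in_P]
  by (simp add: scaleC_complex_def shift_pow)

end

lemma rank_one_perturbation_push:
  assumes "0 < s" "C > 0" "\<And>n. weight_norm \<beta> t n \<le> C * s ^ n"
  shows "rank_one_perturbation push first_one (basis_ell1 \<omega>) s push_resolvent
    (\<lambda>n. orbit_weight n \<omega> * of_nat (\<omega> n)) C"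
proof
  show "cmod (orbit_weight n \<omega> * of_nat (\<omega> n)) \<le> C * s ^ n" for n
  proof -
    have "cmod (orbit_weight n \<omega> * of_nat (\<omega> n)) \<le> cmod (orbit_weight n \<omega>) * 1"
      unfolding norm_mult using seq_one_range[of n] by (intro mult_left_mono) auto
    then show ?thesis
      using orbit_weight_bound[of n \<omega>] assms(3)[of n] by simp
  qed
qed (use assms bounded_clinear_push bounded_clinear_first_one bounded_clinear_push_resolvent[OF assms]
    push_resolvent_right[OF assms] push_resolvent_left[OF assms] first_one_sums[OF assms] in auto)

lemma transfer_op_Phi:
  assumes "a \<in> coords"
  shows "transfer_op \<beta> t (Phi a) = Phi (push a + first_one a *\<^sub>C basis_ell1 \<omega>)"
  unfolding Phi_def transfer_op_coset
proof (rule coset_cong)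
  fix x assume x: "x \<in> X"
  show "transfer_fun \<beta> t (jump_fun a) x = jump_fun (push a + first_one a *\<^sub>C basis_ell1 \<omega>) x"
  proof (rule ell1_op_eq_on_support[where G = "\<lambda>a. transfer_fun \<beta> t (jump_fun a) x"
        and H = "\<lambda>a. jump_fun (push a + first_one a *\<^sub>C basis_ell1 \<omega>) x"])
    have "transfer_fun \<beta> t (jump_fun a) x =
        jump_fun a (case_nat 0 x) + (if case_nat 1 x \<in> X then of_real (exp t) else 0) *\<^sub>C jump_fun a (case_nat 1 x)" for a
      by (simp add: transfer_fun_eq[OF x] scaleC_complex_def)
    then show "bounded_clinear (\<lambda>a. transfer_fun \<beta> t (jump_fun a) x)"
      by (simp only:) (intro bounded_clinear_plus bounded_clinear_const_scaleC bounded_clinear_jump_fun)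
    have "jump_fun (push a + first_one a *\<^sub>C basis_ell1 \<omega>) x = jump_fun (push a) x + seg \<omega> x *\<^sub>C first_one a" for a
      by (simp add: jump_fun_add jump_fun_scaleC scaleC_complex_def mult.commute)
    then show "bounded_clinear (\<lambda>a. jump_fun (push a + first_one a *\<^sub>C basis_ell1 \<omega>) x)"
      by (simp only:) (intro bounded_clinear_plus bounded_clinear_const_scaleC bounded_clinear_first_one
          bounded_clinear_compose[OF bounded_clinear_jump_fun bounded_clinear_push])
    fix p assume "coeff a p \<noteq> 0"
    then have p: "p \<in> P"
      using assms by (auto simp: coords_def)
    then show "transfer_fun \<beta> t (jump_fun (basis_ell1 p)) x =
        jump_fun (push (basis_ell1 p) + first_one (basis_ell1 p) *\<^sub>C basis_ell1 \<omega>) x"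
      by (simp add: transfer_fun_seg[OF P_subset x] jump_fun_add jump_fun_scaleC step_weight_def)
  qed
qed

theorem quasi_compact_transfer_op: "cn_quasi_compact (F_space \<beta>) (transfer_op \<beta> t) (r_bound \<beta> t)"
proof (rule cn_coordinates.cn_quasi_compact_rank_one[OF cn_coordinates_F_space])
  fix z assume "r_bound \<beta> t < ereal (cmod z)"
  then obtain s C where s: "0 < s" "s < cmod z" "C > 0" "\<And>n. weight_norm \<beta> t n \<le> C * s ^ n"
    using r_bound_geometric by blast
  show "\<exists>s c C. s < cmod z \<and> rank_one_perturbation push first_one (basis_ell1 \<omega>) s push_resolvent c C \<and>
      (\<forall>y. s < cmod y \<longrightarrow> push_resolvent y ` coords \<subseteq> coords)"
    using s(2) rank_one_perturbation_push[OF s(1,3,4)] push_resolvent_coords[OF s(1,3,4)] by blast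
next
  show "push a \<in> coords" if "a \<in> coords" for a
    by (rule coords_invariant[OF bounded_clinear_push _ that])
      (simp add: coords_scaleC coords_basis shift_in_P)
qed (use coords_basis[OF seq_one_in_P] transfer_op_Phi in auto)

end

section \<open>The potential\<close>

lemma beta_dist_eq_iff: "beta_dist \<beta> x y = 0 \<longleftrightarrow> x = y"
  using beta_gt by (simp add: beta_dist_def)

text \<open>At the first index where \<open>x\<close> and \<open>z\<close> differ, \<open>y\<close>
  differs from one of them. One of the two distances on the right is therefore already at least that
  between \<open>x\<close> and \<open>z\<close>.\<close>

lemma Metric_space_beta_dist: "Metric_space X (beta_dist \<beta>)"
proof
  show "0 \<le> beta_dist \<beta> x y" for x y
    using beta_gt by (simp add: beta_dist_def)
  show "beta_dist \<beta> x y = beta_dist \<beta> y x" for x y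
    by (simp add: beta_dist_def eq_commute)
  show "beta_dist \<beta> x z \<le> beta_dist \<beta> x y + beta_dist \<beta> y z" for x y z
  proof (cases "x = z")
    case False
    define k where "k = (LEAST k. x k \<noteq> z k)"
    have k: "x k \<noteq> z k"
      unfolding k_def by (rule LeastI_ex) (use False in auto)
    have nonneg: "0 \<le> beta_dist \<beta> u v" for u v
      using beta_gt by (simp add: beta_dist_def)
    have far: "1 / \<beta> ^ k \<le> beta_dist \<beta> u v" if "u k \<noteq> v k" for u v
    proof -
      have "(LEAST k. u k \<noteq> v k) \<le> k"
        using that by (rule Least_le)
      then have "\<beta> ^ (LEAST k. u k \<noteq> v k) \<le> \<beta> ^ k"
        using beta_gt by (intro power_increasing) auto
      then show ?thesis
        using that beta_gt by (auto simp: beta_dist_def intro!: divide_left_mono)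
    qed
    have "beta_dist \<beta> x z = 1 / \<beta> ^ k"
      using False by (simp add: beta_dist_def k_def)
    moreover have "x k \<noteq> y k \<or> y k \<noteq> z k"
      using k by auto
    ultimately show ?thesis
      using far[of x y] far[of y z] nonneg[of x y] nonneg[of y z] by auto
  qed (use beta_gt in \<open>simp add: beta_dist_def\<close>)
qed (rule beta_dist_eq_iff)

text \<open>The potential depends on the first digit only, and points with different first digits
  have distance 1; hence the constant \<open>\<bar>t\<bar>\<close>.\<close>

lemma Lipschitz_potential:
  "Lipschitz_continuous_map (metric (X, beta_dist \<beta>)) euclidean_metric (potential \<beta> t)"
proof -
  have "dist (potential \<beta> t x) (potential \<beta> t y) \<le> \<bar>t\<bar> * beta_dist \<beta> x y" if "x \<in> X" "y \<in> X" for x y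
  proof (cases "x 0 = y 0")
    case True
    then show ?thesis
      using that beta_gt by (simp add: potential_eq beta_dist_def)
  next
    case False
    then have "(LEAST k. x k \<noteq> y k) = 0"
      by (intro Least_equality) auto
    then have "beta_dist \<beta> x y = 1"
      using False by (auto simp: beta_dist_def)
    moreover have "dist (potential \<beta> t x) (potential \<beta> t y) = \<bar>t\<bar> * \<bar>real (x 0) - real (y 0)\<bar>"
      unfolding potential_eq[OF that(1)] potential_eq[OF that(2)] dist_of_real dist_real_def
        abs_mult[symmetric] right_diff_distrib ..
    moreover have "\<bar>real (x 0) - real (y 0)\<bar> \<le> 1"
      using range_X[OF that(1), of 0] range_X[OF that(2), of 0] by linarith
    ultimately show ?thesis
      by (simp add: mult_left_le)
  qed
  then show ?thesis
    unfolding Lipschitz_continuous_map_def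
    by (auto simp: Metric_space.mspace_metric[OF Metric_space_beta_dist]
        Metric_space.mdist_metric[OF Metric_space_beta_dist] intro!: exI[of _ "\<bar>t\<bar>"])
qed

text \<open>As 1 is the largest digit, the cylinder is a final segment of \<open>X\<close>, in
  particular an interval.\<close>

lemma potential_in_F_space: "coset \<beta> (potential \<beta> t) \<in> carr (F_space \<beta>)"
proof -
  have "z 0 = 1" if x: "x 0 = 1" and z: "z \<in> X" "lex_le x z" for x z :: symseq
  proof (rule ccontr)
    assume "z 0 \<noteq> 1"
    then have "z 0 < x 0"
      using range_X[OF z(1), of 0] x by simp
    then have "less_fun z x"
      by (intro less_fun_first_diff[of z 0 x]) auto
    then show False
      using lex.leD[OF z(2)] by simp
  qed
  then have "cyl_one \<beta> \<in> shift_intervals \<beta>"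
    unfolding shift_intervals_def cyl_one_def by blast
  then have "vscale (BV_quot \<beta>) (of_real t) (coset \<beta> (indicator (cyl_one \<beta>))) \<in> carr (F_space \<beta>)"
    by (intro F_space_scale interval_coset_in_F_space)
  then show ?thesis
    by (simp add: vscale_coset potential_def[abs_def])
qed

end

theorem proposition3p1:
  fixes \<beta> t :: real
  assumes "1 < \<beta>" and "\<beta> \<le> 2"
  shows "(\<forall>x\<in>beta_shift \<beta>. potential \<beta> t x \<in> \<real>) \<and>
         Lipschitz_continuous_map (metric (beta_shift \<beta>, beta_dist \<beta>)) euclidean_metric
           (potential \<beta> t) \<and>
         coset \<beta> (potential \<beta> t) \<in> carr (F_space \<beta>) \<and>
         (\<forall>l \<nu>. eigenpair \<beta> t l \<nu> \<longrightarrow>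
            (\<lambda>n. weight_norm \<beta> t n / l ^ n) \<longlonglongrightarrow> 0 \<and> r_bound \<beta> t < ereal l) \<and>
         cn_quasi_compact (F_space \<beta>) (transfer_op \<beta> t) (r_bound \<beta> t)"
proof -
  interpret beta_base \<beta>
    by standard (fact assms)+
  show ?thesis
  proof (intro conjI ballI allI impI)
    show "potential \<beta> t x \<in> \<real>" for x
      by (simp add: potential_def indicator_def)
    show "(\<lambda>n. weight_norm \<beta> t n / l ^ n) \<longlonglongrightarrow> 0" "r_bound \<beta> t < ereal l"
      if "eigenpair \<beta> t l \<nu>" for l \<nu>
    proof -
      have "l > 0"
        using that by (simp add: eigenpair_def)
      note phi = this eigenpair_phi[OF that]
      show "(\<lambda>n. weight_norm \<beta> t n / l ^ n) \<longlonglongrightarrow> 0"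
        by (rule weight_norm_ratio[OF phi])
      show "r_bound \<beta> t < ereal l"
        by (rule r_bound_less_eigenvalue[OF phi])
    qed
  qed (fact Lipschitz_potential potential_in_F_space quasi_compact_transfer_op)+
qed

end
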